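(* Let $(V,E,r_N)$ be a finite strongly connected weighted directed graph with positive rates satisfying Assumption (A) of the context, let $\pi_N$ be the invariant probability measure of the associated continuous-time Markov chain and $\pi=\lim_{N\to\infty}\pi_N$. Let $\mathcal M^{(i)}$, $\mu^{(i-1)}_{M^{(i)}}$, $k$, $M^{(k)}$, $\mathrm{Su}(\cdot)$ be as in the context. Then $\pi=\bar\pi^{(0)}$, where $(\bar\pi^{(i)})_{0\le i\le k}$ is the unique solution of the recursion $$\bar\pi^{(i-1)}=\sum_{M^{(i)}\in\mathcal M^{(i)}}\bar\pi^{(i)}(M^{(i)})\,\mu^{(i-1)}_{M^{(i)}},\qquad 1\le i\le k,\qquad \bar\pi^{(k)}(M^{(k)})=1 .$$ Moreover, for every $x\in V=\mathcal M^{(0)}$, writing $M^{(0)}=x$, $$\pi(x)=\begin{cases}\displaystyle\prod_{(M^{(i)},M^{(i-1)})\in\gamma_{x}}\mu^{(i-1)}_{M^{(i)}}\big(M^{(i-1)}\big) & \text{if }x\in \mathrm{Su}(M^{(k)}),\\[4pt] 0&\text{if }x\notin \mathrm{Su}(M^{(k)}),\end{cases}$$ where, for $x\in\mathrm{Su}(M^{(k)})$, $\gamma_x$ is the unique path $M^{(k)}\ni M^{(k-1)}\ni\dots\ni M^{(1)}\ni M^{(0)}=x$ with $M^{(i)}\in\mathcal M^{(i)}$, viewed as the set of its edges $(M^{(i)},M^{(i-1)})$, $1\le i\le k$.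
   Context: Setting. $(V,E)$ is a finite strongly connected directed graph; for every $N>0$ each edge $(x,y)\in E$ has a weight $r_N(x,y)>0$, and $r_N(x,y)=0$ if $(x,y)\notin E$. The associated continuous-time Markov chain on $V$ has jump rates $r_N$. Assumption (A): for every pair of families of non-negative integers $(m_e)_{e\in E}$, $(n_e)_{e\in E}$ with $\sum_e m_e=\sum_e n_e$, the limit $\lim_{N\to\infty}\prod_{e}r_N(e)^{m_e}/\prod_{e}r_N(e)^{n_e}$ exists in $[0,\infty]$. One step of the construction. Given a finite strongly connected weighted graph $(V,E,r_N)$ satisfying (A): (1) $E_F$ is the set of $e\in E$ with $\lim_N r_N(e')/r_N(e)<\infty$ for all $e'\in E$. Fast classes are the equivalence classes of $V$ under mutual reachability in $(V,E_F)$; a fast class $M$ is minimal if no edge of $E_F$ goes from $M$ to $V\setminus M$. $\mathcal M$ is the set of minimal fast classes, $\hat V=\bigcup_{M\in\mathcal M}M$, and $E_F[M]$ is the set of edges of $E_F$ with both endpoints in $M$. (2) Reduced rates: for $x\neq y$ in $\hat V$, $\hat r_N(x,y)=r_N(x,y)+\sum_{z\in V\setminus\hat V}r_N(x,z)P_N^{\hat V}(y|z)$, where $P_N^{\hat V}(y|z)$ is the probability that the chain with rates $r_N$ started at $z$ first enters $\hat V$ at $y$. (3) For $M\in\mathcal M$, $\mu^N_M$ is the unique invariant probability measure of the chain on $M$ with edge set $E_F[M]$ and rates $r_N$, and $\mu_M=\lim_N\mu_M^N$ (which exists). (4) Effective rates: for $M_1\ne M_2$ in $\mathcal M$, $\bar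 r_N(M_1,M_2)=\sum_{y_1\in M_1,y_2\in M_2}\mu^N_{M_1}(y_1)\hat r_N(y_1,y_2)$, and $\bar E=\{(M_1,M_2):\bar r_N(M_1,M_2)>0\}$. The graph $(\mathcal M,\bar E,\bar r_N)$ is again strongly connected and satisfies (A). Iteration. Put $(\mathcal M^{(0)},\bar E^{(0)},\bar r^{(0)}_N)=(V,E,r_N)$, and for $i\ge1$ let $(\mathcal M^{(i)},\bar E^{(i)},\bar r^{(i)}_N)$ be the effective graph obtained by applying one step to $(\mathcal M^{(i-1)},\bar E^{(i-1)},\bar r_N^{(i-1)})$. Thus elements of $\mathcal M^{(i)}$ are pairwise disjoint subsets of $\mathcal M^{(i-1)}$. For $M^{(i)}\in\mathcal M^{(i)}$, $\mu^{(i-1)}_{M^{(i)}}$ is the limiting measure $\mu_M$ of (3) for $M=M^{(i)}$ at that step: a probability measure on $\mathcal M^{(i-1)}$ supported on $M^{(i)}$. Each unknown $\bar\pi^{(i)}$ in the recursion is a measure on $\mathcal M^{(i)}$. $k$ is the smallest $i$ with $|\mathcal M^{(i)}|=1$ (it is finite), and $M^{(k)}$ is the unique element of $\mathcal M^{(k)}$. Supports: $\mathrm{Su}(x)=\{x\}$ for $x\in V=\mathcal M^{(0)}$, and $\mathrm{Su}(M^{(i)})=\bigcup_{M^{(i-1)}\in M^{(i)}}\mathrm{Su}(M^{(i-1)})\subseteq V$. *)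

theory Defs
  imports "HOL-Probability.Probability" "HOL-Library.FSet"
begin

record 'v wgraph =
  verts :: "'v set"
  edges :: "('v \<times> 'v) set"
  rate :: "real \<Rightarrow> 'v \<Rightarrow> 'v \<Rightarrow> real"

definition weighted_graph :: "'v wgraph \<Rightarrow> bool" where
  "weighted_graph G \<longleftrightarrow>
     finite (verts G) \<and> verts G \<noteq> {} \<and> edges G \<subseteq> verts G \<times> verts G \<and>
     (\<forall>x\<in>verts G. \<forall>y\<in>verts G. (x, y) \<in> (edges G)\<^sup>*) \<and>
     (\<forall>N>0. \<forall>x\<in>verts G. \<forall>y\<in>verts G.
        (if (x, y) \<in> edges G then rate G N x y > 0 else rate G N x y = 0))"

definition assumption_A :: "'v wgraph \<Rightarrow> bool" where
  "assumption_A G \<longleftrightarrow>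
     (\<forall>m n :: 'v \<times> 'v \<Rightarrow> nat. (\<Sum>e\<in>edges G. m e) = (\<Sum>e\<in>edges G. n e) \<longrightarrow>
        (\<exists>L::ennreal.
           ((\<lambda>N. ennreal ((\<Prod>(x, y)\<in>edges G. rate G N x y ^ m (x, y)) /
                          (\<Prod>(x, y)\<in>edges G. rate G N x y ^ n (x, y)))) \<longlongrightarrow> L) at_top))"

text \<open>
  Invariance is \<open>\<mu> Q = 0\<close> for the generator \<open>Q\<close> of the chain that jumps along the edges.
  Loops, if any, contribute the same term to both sides of the balance equation.
  Measures on a finite set are represented by their point masses, extended by 0.
\<close>

definition measure_on :: "'v set \<Rightarrow> ('v \<Rightarrow> real) \<Rightarrow> bool" where
  "measure_on S \<mu> \<longleftrightarrow> (\<forall>x\<in>S. \<mu> x \<ge> 0) \<and> (\<forall>x. x \<notin> S \<longrightarrow> \<mu> x = 0)"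

definition invariant_prob :: "'v wgraph \<Rightarrow> real \<Rightarrow> ('v \<Rightarrow> real) \<Rightarrow> bool" where
  "invariant_prob G N \<mu> \<longleftrightarrow>
     measure_on (verts G) \<mu> \<and> (\<Sum>x\<in>verts G. \<mu> x) = 1 \<and>
     (\<forall>y\<in>verts G. (\<Sum>x | (x, y) \<in> edges G. \<mu> x * rate G N x y) =
                   \<mu> y * (\<Sum>z | (y, z) \<in> edges G. rate G N y z))"

definition inv_measure :: "'v wgraph \<Rightarrow> real \<Rightarrow> 'v \<Rightarrow> real" where
  "inv_measure G N = (THE \<mu>. invariant_prob G N \<mu>)"

text \<open>
  The existence of a real limit expresses that the limit, which lies in \<open>[0, \<infinity>]\<close>, is finite.
\<close>

definition fast_edges :: "'v wgraph \<Rightarrow> ('v \<times> 'v) set" where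
  "fast_edges G =
     {(x, y) \<in> edges G. \<forall>(x', y')\<in>edges G.
        \<exists>L::real. ((\<lambda>N. rate G N x' y' / rate G N x y) \<longlongrightarrow> L) at_top}"

definition fast_classes :: "'v wgraph \<Rightarrow> 'v set set" where
  "fast_classes G =
     verts G // {(x, y) \<in> verts G \<times> verts G.
                   (x, y) \<in> (fast_edges G)\<^sup>* \<and> (y, x) \<in> (fast_edges G)\<^sup>*}"

definition minimal_classes :: "'v wgraph \<Rightarrow> 'v set set" where
  "minimal_classes G =
     {M \<in> fast_classes G. \<forall>x\<in>M. \<forall>y\<in>verts G - M. (x, y) \<notin> fast_edges G}"

definition hat_verts :: "'v wgraph \<Rightarrow> 'v set" where
  "hat_verts G = \<Union>(minimal_classes G)"

text \<open>
  The place where the continuous-time chain first enters a set is a function of its embedded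
  jump chain. \<open>trajectory G N n z\<close> is the law of \<open>(X\<^sub>0, \<dots>, X\<^sub>n)\<close> for the jump chain
  with \<open>X\<^sub>0 = z\<close>; \<open>first_entry_prob\<close> sums over the disjoint events that the first visit to
  \<open>A\<close> occurs at step \<open>n\<close> and at the point \<open>y\<close>.
\<close>

definition jump_pmf :: "'v wgraph \<Rightarrow> real \<Rightarrow> 'v \<Rightarrow> 'v pmf" where
  "jump_pmf G N x =
     embed_pmf (\<lambda>y. if (x, y) \<in> edges G \<and> y \<noteq> x
       then rate G N x y / (\<Sum>w | (x, w) \<in> edges G \<and> w \<noteq> x. rate G N x w) else 0)"

primrec trajectory :: "'v wgraph \<Rightarrow> real \<Rightarrow> nat \<Rightarrow> 'v \<Rightarrow> 'v list pmf" where
  "trajectory G N 0 = (\<lambda>z. return_pmf [z])"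
| "trajectory G N (Suc n) =
     (\<lambda>z. bind_pmf (jump_pmf G N z) (\<lambda>w. map_pmf ((#) z) (trajectory G N n w)))"

definition first_entry_prob :: "'v wgraph \<Rightarrow> real \<Rightarrow> 'v set \<Rightarrow> 'v \<Rightarrow> 'v \<Rightarrow> real" where
  "first_entry_prob G N A z y =
     (\<Sum>n. measure_pmf.prob (trajectory G N n z)
        {xs. (\<forall>i<n. xs ! i \<notin> A) \<and> xs ! n \<in> A \<and> xs ! n = y})"

definition reduced_rate :: "'v wgraph \<Rightarrow> real \<Rightarrow> 'v \<Rightarrow> 'v \<Rightarrow> real" where
  "reduced_rate G N x y =
     rate G N x y +
     (\<Sum>z\<in>verts G - hat_verts G. rate G N x z * first_entry_prob G N (hat_verts G) z y)"

definition class_graph :: "'v wgraph \<Rightarrow> 'v set \<Rightarrow> 'v wgraph" where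
  "class_graph G M = \<lparr>verts = M, edges = fast_edges G \<inter> (M \<times> M), rate = rate G\<rparr>"

definition class_measure :: "'v wgraph \<Rightarrow> real \<Rightarrow> 'v set \<Rightarrow> 'v \<Rightarrow> real" where
  "class_measure G N M = inv_measure (class_graph G M) N"

definition limit_measure :: "'v wgraph \<Rightarrow> 'v set \<Rightarrow> 'v \<Rightarrow> real" where
  "limit_measure G M x = Lim at_top (\<lambda>N. class_measure G N M x)"

definition effective_rate :: "'v wgraph \<Rightarrow> real \<Rightarrow> 'v set \<Rightarrow> 'v set \<Rightarrow> real" where
  "effective_rate G N M1 M2 =
     (if M1 \<in> minimal_classes G \<and> M2 \<in> minimal_classes G \<and> M1 \<noteq> M2
      then \<Sum>y1\<in>M1. \<Sum>y2\<in>M2. class_measure G N M1 y1 * reduced_rate G N y1 y2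
      else 0)"

text \<open>Positivity of the effective rates does not depend on \<open>N > 0\<close>.\<close>

definition effective_graph :: "'v wgraph \<Rightarrow> 'v set wgraph" where
  "effective_graph G =
     \<lparr>verts = minimal_classes G,
      edges = {(M1, M2). \<forall>N>0. effective_rate G N M1 M2 > 0},
      rate = effective_rate G\<rparr>"

text \<open>
  The vertices of the \<open>i\<close>-th graph are \<open>i\<close> times nested finite sets of original vertices.
  To iterate inside a single type, all of them are taken from the type of hereditarily
  finite sets over \<open>'a\<close>, and \<open>map_wgraph f g\<close> renames vertices along \<open>f\<close>, with inverse \<open>g\<close>.
\<close>

datatype 'a hvert = Vtx (the_vtx: 'a) | Cls (members: "'a hvert fset")

definition elems :: "'a hvert \<Rightarrow> 'a hvert set" where
  "elems c = fset (members c)"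

primrec Su :: "'a hvert \<Rightarrow> 'a set" where
  "Su (Vtx x) = {x}"
| "Su (Cls A) = \<Union>(fset (Su |`| A))"

definition map_wgraph :: "('v \<Rightarrow> 'w) \<Rightarrow> ('w \<Rightarrow> 'v) \<Rightarrow> 'v wgraph \<Rightarrow> 'w wgraph" where
  "map_wgraph f g G =
     \<lparr>verts = f ` verts G, edges = map_prod f f ` edges G,
      rate = (\<lambda>N x y. rate G N (g x) (g y))\<rparr>"

primrec level_graph :: "'a wgraph \<Rightarrow> nat \<Rightarrow> 'a hvert wgraph" where
  "level_graph G 0 = map_wgraph Vtx the_vtx G"
| "level_graph G (Suc i) =
     map_wgraph (\<lambda>M. Cls (Abs_fset M)) elems (effective_graph (level_graph G i))"

definition level :: "'a wgraph \<Rightarrow> nat \<Rightarrow> 'a hvert set" where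
  "level G i = verts (level_graph G i)"

text \<open>
  For \<open>c \<in> level G (Suc i)\<close>, \<open>level_measure G i c\<close> is the limiting measure on \<open>level G i\<close>
  belonging to the class \<open>c\<close>.
\<close>

definition level_measure :: "'a wgraph \<Rightarrow> nat \<Rightarrow> 'a hvert \<Rightarrow> 'a hvert \<Rightarrow> real" where
  "level_measure G i c = limit_measure (level_graph G i) (elems c)"

definition top_level :: "'a wgraph \<Rightarrow> nat" where
  "top_level G = (LEAST i. card (level G i) = 1)"

definition root_class :: "'a wgraph \<Rightarrow> 'a hvert" where
  "root_class G = the_elem (level G (top_level G))"

definition solves_recursion :: "'a wgraph \<Rightarrow> (nat \<Rightarrow> 'a hvert \<Rightarrow> real) \<Rightarrow> bool" where
  "solves_recursion G \<rho> \<longleftrightarrow>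
     (\<forall>i\<le>top_level G. measure_on (level G i) (\<rho> i)) \<and>
     (\<forall>i\<in>{1..top_level G}. \<forall>y\<in>level G (i - 1).
        \<rho> (i - 1) y = (\<Sum>c\<in>level G i. \<rho> i c * level_measure G (i - 1) c y)) \<and>
     \<rho> (top_level G) (root_class G) = 1"

text \<open>A path is listed from the bottom: its \<open>i\<close>-th entry lies in \<open>level G i\<close>.\<close>

definition hier_path :: "'a wgraph \<Rightarrow> 'a \<Rightarrow> 'a hvert list \<Rightarrow> bool" where
  "hier_path G x \<gamma> \<longleftrightarrow>
     length \<gamma> = Suc (top_level G) \<and> \<gamma> ! 0 = Vtx x \<and> \<gamma> ! top_level G = root_class G \<and>
     (\<forall>i\<le>top_level G. \<gamma> ! i \<in> level G i) \<and>
     (\<forall>i\<in>{1..top_level G}. \<gamma> ! (i - 1) \<in> elems (\<gamma> ! i))"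

end

theory Submission
  imports Defs
begin

text \<open>
  Eliminating states one at a time expresses invariant measures and first-entry probabilities
  through the rates by additions, multiplications and divisions only. By Assumption (A), the
  functions asymptotic to a positive constant times a quotient of two monomials of equal degree in
  the rates are closed under these operations, and all of them have limits in \<open>[0, \<infinity>]\<close>. After
  division by a fastest rate, everything in the construction lies in this class; this gives
  the existence of all limits, and (A) for the effective graph.

  For one step, the invariant measure restricted to the union of the minimal fast classes is invariant
  for the reduced rates. The flow into a minimal class equals the flow out of it, which is
  negligible at the fast scale, so the measure conditioned on a class \<open>M\<close> tends to \<open>\<mu>\<^sub>M\<close>. Hence
  the masses of the classes are invariant for rates that differ from the effective ones by
  factors tending to 1. The elimination formulas transfer such factors from the rates to the invariant
  measure, so these masses have the same limit as the effective invariant measure. Iterating this,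
  the product formula follows from the disjointness of the classes of each level.
\<close>

section \<open>State elimination\<close>

text \<open>The obstacle is cancellation: a difference of two quantities with known asymptotics can
  behave in any way, so formulas with signs are of no use. Censoring one state at a time yields
  formulas free of subtraction, and \<open>pos_class\<close> records the closure properties that
  they need. It is instantiated three times: by all positive functions, for existence and uniqueness
  at each fixed N; by \<open>monomial_like\<close>, for the existence of limits; and by
  \<open>ratio_class\<close>, for the comparison of two chains. Zero cannot lie in such a class, so
  it is adjoined in \<open>Kz\<close>; a rate is then zero at every index or positive at every
  index, and the edges of the effective graph do not depend on N. Rates of many orders coexist, so
  chains are compared multiplicatively: an additively small error can still exceed the slow rates
  that decide the masses of the classes.\<close>

locale pos_class =
  fixes I :: "'i set" and K :: "('i \<Rightarrow> real) set"
  assumes pos: "f \<in> K \<Longrightarrow> i \<in> I \<Longrightarrow> f i > 0"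
    and one: "(\<lambda>i. 1) \<in> K"
    and add: "f \<in> K \<Longrightarrow> g \<in> K \<Longrightarrow> (\<lambda>i. f i + g i) \<in> K"
    and mult: "f \<in> K \<Longrightarrow> g \<in> K \<Longrightarrow> (\<lambda>i. f i * g i) \<in> K"
    and divide: "f \<in> K \<Longrightarrow> g \<in> K \<Longrightarrow> (\<lambda>i. f i / g i) \<in> K"
    and cong: "f \<in> K \<Longrightarrow> (\<And>i. i \<in> I \<Longrightarrow> g i = f i) \<Longrightarrow> g \<in> K"
begin

definition Kz :: "('i \<Rightarrow> real) set" where
  "Kz = K \<union> {f. \<forall>i\<in>I. f i = 0}"

lemma KzI: "f \<in> K \<Longrightarrow> f \<in> Kz"
  by (simp add: Kz_def)

lemma Kz_zero [simp]: "(\<lambda>i. 0) \<in> Kz"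
  by (simp add: Kz_def)

lemma Kz_nonneg: "f \<in> Kz \<Longrightarrow> i \<in> I \<Longrightarrow> f i \<ge> 0"
  by (auto simp: Kz_def dest: pos)

lemma Kz_cong: "f \<in> Kz \<Longrightarrow> (\<And>i. i \<in> I \<Longrightarrow> g i = f i) \<Longrightarrow> g \<in> Kz"
  using cong by (auto simp: Kz_def)

text \<open>Positivity at a single index rules out the zero branch, so one index decides for all.
  This makes supports of rates independent of N.\<close>

lemma Kz_pos_iff: "f \<in> Kz \<Longrightarrow> i \<in> I \<Longrightarrow> f i > 0 \<longleftrightarrow> f \<in> K"
  by (auto simp: Kz_def dest: pos)

lemma add_Kz: "f \<in> K \<Longrightarrow> g \<in> Kz \<Longrightarrow> (\<lambda>i. f i + g i) \<in> K"
  by (auto simp: Kz_def intro: add cong[of f])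

lemma add_Kz': "f \<in> Kz \<Longrightarrow> g \<in> K \<Longrightarrow> (\<lambda>i. f i + g i) \<in> K"
  by (auto simp: Kz_def intro: add cong[of g])

lemma Kz_add: "f \<in> Kz \<Longrightarrow> g \<in> Kz \<Longrightarrow> (\<lambda>i. f i + g i) \<in> Kz"
  by (auto simp: Kz_def intro: add cong[of f] cong[of g])

lemma Kz_mult: "f \<in> Kz \<Longrightarrow> g \<in> Kz \<Longrightarrow> (\<lambda>i. f i * g i) \<in> Kz"
  by (auto simp: Kz_def intro: mult)

lemma Kz_divide: "f \<in> Kz \<Longrightarrow> g \<in> K \<Longrightarrow> (\<lambda>i. f i / g i) \<in> Kz"
  by (auto simp: Kz_def intro: divide)

lemma Kz_sum: "(\<And>x. x \<in> A \<Longrightarrow> f x \<in> Kz) \<Longrightarrow> (\<lambda>i. \<Sum>x\<in>A. f x i) \<in> Kz"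
  by (induction A rule: infinite_finite_induct) (simp_all add: Kz_add)

lemma sum_in_K:
  assumes "finite A" "a \<in> A" "f a \<in> K" "\<And>x. x \<in> A \<Longrightarrow> f x \<in> Kz"
  shows "(\<lambda>i. \<Sum>x\<in>A. f x i) \<in> K"
proof -
  have "(\<lambda>i. f a i + (\<Sum>x\<in>A-{a}. f x i)) \<in> K"
    using assms by (intro add_Kz Kz_sum) auto
  then show ?thesis
    using assms by (simp add: sum.remove)
qed

lemma power_K: "f \<in> K \<Longrightarrow> (\<lambda>i. f i ^ n) \<in> K"
  by (induction n) (simp_all add: one mult)

lemma prod_K: "(\<And>x. x \<in> A \<Longrightarrow> f x \<in> K) \<Longrightarrow> (\<lambda>i. \<Prod>x\<in>A. f x i) \<in> K"
  by (induction A rule: infinite_finite_induct) (simp_all add: one mult)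

definition conn :: "'v set \<Rightarrow> ('v \<Rightarrow> 'v \<Rightarrow> 'i \<Rightarrow> real) \<Rightarrow> ('v \<times> 'v) set" where
  "conn V r = {(x, y). x \<in> V \<and> y \<in> V \<and> x \<noteq> y \<and> r x y \<in> K}"

definition irred :: "'v set \<Rightarrow> ('v \<Rightarrow> 'v \<Rightarrow> 'i \<Rightarrow> real) \<Rightarrow> bool" where
  "irred V r \<longleftrightarrow> finite V \<and> (\<forall>x\<in>V. \<forall>y\<in>V. x \<noteq> y \<longrightarrow> r x y \<in> Kz) \<and>
     (\<forall>x\<in>V. \<forall>y\<in>V. (x, y) \<in> (conn V r)\<^sup>*)"

lemma irred_Kz: "irred V r \<Longrightarrow> x \<in> V \<Longrightarrow> y \<in> V \<Longrightarrow> x \<noteq> y \<Longrightarrow> r x y \<in> Kz"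
  by (simp add: irred_def)

lemma irredI:
  assumes "finite V" "E \<subseteq> V \<times> V" "\<And>x y. x \<in> V \<Longrightarrow> y \<in> V \<Longrightarrow> (x, y) \<in> E\<^sup>*"
    and E: "\<And>x y. (x, y) \<in> E \<Longrightarrow> x \<noteq> y \<Longrightarrow> r x y \<in> K"
    and "\<And>x y. x \<in> V \<Longrightarrow> y \<in> V \<Longrightarrow> x \<noteq> y \<Longrightarrow> r x y \<in> Kz"
  shows "irred V r"
proof -
  have "E - Id \<subseteq> conn V r" using assms(2) E by (auto simp: conn_def)
  then have "E\<^sup>* \<subseteq> (conn V r)\<^sup>*"
    using rtrancl_mono[of "E - Id" "conn V r"] by (simp add: rtrancl_r_diff_Id)
  then show ?thesis using assms(1,3,5) by (auto simp: irred_def)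
qed

definition exit_rate :: "'v set \<Rightarrow> ('v \<Rightarrow> 'v \<Rightarrow> 'i \<Rightarrow> real) \<Rightarrow> 'v \<Rightarrow> 'i \<Rightarrow> real" where
  "exit_rate V r z i = (\<Sum>w\<in>V-{z}. r z w i)"

text \<open>Censoring the chain at the single state \<open>z\<close>.\<close>

definition elim ::
    "'v set \<Rightarrow> ('v \<Rightarrow> 'v \<Rightarrow> 'i \<Rightarrow> real) \<Rightarrow> 'v \<Rightarrow> 'v \<Rightarrow> 'v \<Rightarrow> 'i \<Rightarrow> real" where
  "elim V r z x y i = r x y i + r x z i * r z y i / exit_rate V r z i"

text \<open>A path from \<open>z\<close> to another vertex has an edge out of \<open>z\<close>,
  which supplies the summand in \<open>K\<close> that \<open>sum_in_K\<close> asks for.\<close>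

lemma exit_rate_K:
  assumes "irred V r" "z \<in> V" "V - {z} \<noteq> {}"
  shows "exit_rate V r z \<in> K"
proof -
  obtain y where y: "y \<in> V" "y \<noteq> z" using assms(3) by auto
  have "(z, y) \<in> (conn V r)\<^sup>*" using assms y by (simp add: irred_def)
  then obtain w where "(z, w) \<in> conn V r"
    using y by (auto elim: converse_rtranclE)
  then have "(\<lambda>i. \<Sum>w\<in>V-{z}. r z w i) \<in> K"
    using assms by (intro sum_in_K[of _ w]) (auto simp: irred_def conn_def)
  then show ?thesis by (simp add: exit_rate_def [abs_def])
qed

lemma elim_K:
  assumes "r x y \<in> K \<or> r x z \<in> K \<and> r z y \<in> K"
    "r x y \<in> Kz" "r x z \<in> Kz" "r z y \<in> Kz" "exit_rate V r z \<in> K"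
  shows "elim V r z x y \<in> K"
proof -
  have Kz: "(\<lambda>i. r x z i * r z y i / exit_rate V r z i) \<in> Kz"
    using assms by (intro Kz_divide Kz_mult) auto
  show ?thesis
  proof (cases "r x y \<in> K")
    case True
    then show ?thesis using Kz by (simp add: elim_def[abs_def] add_Kz)
  next
    case False
    with assms have "(\<lambda>i. r x z i * r z y i / exit_rate V r z i) \<in> K"
      by (intro divide mult) auto
    then show ?thesis using assms by (simp add: elim_def[abs_def] add_Kz')
  qed
qed

text \<open>A visit of a path to \<open>z\<close> is an entry from some \<open>w\<close> followed by
  an exit to some \<open>y'\<close>; the censored chain replaces both by one edge from
  \<open>w\<close> to \<open>y'\<close>.\<close>

lemma irred_elim:
  assumes irr: "irred V r" and z: "z \<in> V" "V - {z} \<noteq> {}"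
  shows "irred (V - {z}) (elim V r z)"
proof -
  have D: "exit_rate V r z \<in> K" using assms by (rule exit_rate_K)
  have Kz: "r x y \<in> Kz" if "x \<in> V" "y \<in> V" "x \<noteq> y" for x y
    using irr that by (simp add: irred_def)
  let ?C = "conn V r" and ?C' = "conn (V - {z}) (elim V r z)"
  \<comment> \<open>While the path stands at \<open>z\<close>, which is no vertex of the censored
    graph, the claim remembers a vertex \<open>w\<close> from which \<open>z\<close> was
    entered.\<close>
  have path: "(y \<noteq> z \<longrightarrow> (x, y) \<in> ?C'\<^sup>*) \<and>
      (y = z \<longrightarrow> (\<exists>w\<in>V-{z}. (x, w) \<in> ?C'\<^sup>* \<and> r w z \<in> K))"
    if "(x, y) \<in> ?C\<^sup>*" "x \<in> V - {z}" for x y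
    using that
  proof (induction rule: rtrancl_induct)
    case base
    then show ?case by auto
  next
    case (step y y')
    then have yy': "y \<in> V" "y' \<in> V" "y \<noteq> y'" "r y y' \<in> K"
      by (auto simp: conn_def)
    consider "y = z" | "y' = z" "y \<noteq> z" | "y \<noteq> z" "y' \<noteq> z" by blast
    then show ?case
    proof cases
      case 1
      then obtain w where w: "w \<in> V - {z}" "(x, w) \<in> ?C'\<^sup>*" "r w z \<in> K"
        using step by auto
      show ?thesis
      \<comment> \<open>An excursion that returns to its starting point needs no edge in the
        censored graph.\<close>
      proof (cases "w = y'")
        case True
        then show ?thesis using w 1 yy' by auto
      next
        case False
        have "elim V r z w y' \<in> K"
          using w 1 yy' False D by (intro elim_K Kz) auto
        then have "(w, y') \<in> ?C'" using w 1 yy' False by (auto simp: conn_def)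
        then show ?thesis using w(2) 1 yy' by auto
      qed
    next
      case 2
      then show ?thesis using step yy' by auto
    next
      case 3
      have "elim V r z y y' \<in> K"
        using 3 yy' D z by (intro elim_K Kz) auto
      then have "(y, y') \<in> ?C'" using 3 yy' by (auto simp: conn_def)
      then show ?thesis using step 3 by (auto intro: rtrancl.rtrancl_into_rtrancl)
    qed
  qed
  have "elim V r z x y \<in> Kz" if "x \<in> V - {z}" "y \<in> V - {z}" "x \<noteq> y" for x y
    unfolding elim_def[abs_def] using that D z
    by (intro Kz_add[OF Kz Kz_divide[OF Kz_mult[OF Kz Kz]]]) auto
  with path irr show ?thesis
    unfolding irred_def by auto
qed

text \<open>A solution for the rates censored at \<open>z\<close> extends to \<open>z\<close> by the
  balance equation there. The solution is left unnormalised, so its values on \<open>V\<close> need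
  not change when \<open>z\<close> is added.\<close>

lemma invariant_exists_K:
  assumes "irred V r" "V \<noteq> {}"
  shows "\<exists>u. (\<forall>x\<in>V. u x \<in> K) \<and>
    (\<forall>i\<in>I. \<forall>y\<in>V. (\<Sum>x\<in>V-{y}. u x i * r x y i) = u y i * exit_rate V r y i)"
proof -
  have "finite V" using assms by (simp add: irred_def)
  then show ?thesis using assms(2,1)
  proof (induction V arbitrary: r rule: finite_ne_induct)
    case (singleton a)
    show ?case
      by (rule exI[of _ "\<lambda>_ _. 1"]) (simp add: one exit_rate_def)
  next
    case (insert z V)
    let ?D = "exit_rate (insert z V) r z" and ?r = "elim (insert z V) r z"
    have ne: "insert z V - {z} = V" using insert by auto
    have D: "?D \<in> K"
      using insert by (intro exit_rate_K) auto
    have "irred V ?r"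
      using irred_elim[OF insert.prems, of z] insert.hyps ne by auto
    then obtain u where u: "\<And>x. x \<in> V \<Longrightarrow> u x \<in> K"
      and inv: "\<And>i y. i \<in> I \<Longrightarrow> y \<in> V \<Longrightarrow>
        (\<Sum>x\<in>V-{y}. u x i * ?r x y i) = u y i * exit_rate V ?r y i"
      using insert.IH[of ?r] by blast
    have Kz: "r x y \<in> Kz" if "x \<in> insert z V" "y \<in> insert z V" "x \<noteq> y" for x y
      using insert.prems that by (rule irred_Kz)
    \<comment> \<open>Some edge enters \<open>z\<close>, so the numerator of \<open>uz\<close> has a
      summand in \<open>K\<close>, and \<open>uz\<close> is in \<open>K\<close> and not merely in
      \<open>Kz\<close>.\<close>
    obtain a where a: "a \<in> V" "r a z \<in> K"
    proof -
      obtain b where "b \<in> V" using insert by auto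
      then have "(b, z) \<in> (conn (insert z V) r)\<^sup>*" "b \<noteq> z"
        using insert by (auto simp: irred_def)
      then obtain a where "(a, z) \<in> conn (insert z V) r" by (meson rtranclE)
      then show ?thesis using that by (auto simp: conn_def)
    qed
    define uz where "uz i = (\<Sum>x\<in>V. u x i * r x z i) / ?D i" for i
    have "(\<lambda>i. u x i * r x z i) \<in> Kz" if "x \<in> V" for x
      using that insert.hyps by (intro Kz_mult KzI u Kz) auto
    then have "(\<lambda>i. \<Sum>x\<in>V. u x i * r x z i) \<in> K"
      using insert.hyps a mult[OF u[OF a(1)] a(2)]
      by (intro sum_in_K[where a = a and f = "\<lambda>x i. u x i * r x z i"]) auto
    then have uz: "uz \<in> K"
      unfolding uz_def[abs_def] using D by (rule divide)
    define v where "v = u(z := uz)"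
    have vV: "v x = u x" if "x \<in> V" for x using that insert by (auto simp: v_def)
    have "(\<Sum>x\<in>insert z V-{y}. v x i * r x y i) = v y i * exit_rate (insert z V) r y i"
      if i: "i \<in> I" and y: "y \<in> insert z V" for i y
    proof (cases "y = z")
      case True
      have "?D i > 0" using pos D i by auto
      then show ?thesis
        using True ne \<open>z \<notin> V\<close> by (auto simp: uz_def v_def intro!: sum.cong)
    next
      case False
      then have y: "y \<in> V" using y by auto
      have D0: "?D i \<noteq> 0" using pos[OF D i] by simp
      have fin: "finite V" by fact
      have split: "insert z V - {y} = insert z (V - {y})" "z \<notin> V - {y}"
        using False insert by auto
      define q where "q = ?D i"
      have q: "q = r z y i + (\<Sum>w\<in>V-{y}. r z w i)" "q \<noteq> 0"
        using ne y fin D0 by (auto simp: q_def exit_rate_def sum.remove)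
      \<comment> \<open>The censored chain does not count the excursion from \<open>y\<close> to
        \<open>z\<close> and straight back as a jump, hence \<open>q - r z y i\<close>. The same
        excursion appears in the inflow through \<open>uz\<close>, where the two cancel. The
        subtraction occurs in this verification only, not in the formula for the solution.\<close>
      have A: "(\<Sum>x\<in>V-{y}. u x i * r x y i)
          + (\<Sum>x\<in>V-{y}. u x i * r x z i) * r z y i / q
          = u y i * ((\<Sum>w\<in>V-{y}. r y w i) + r y z i * (q - r z y i) / q)"
        using inv[OF i y] q
        by (simp add: elim_def exit_rate_def[of V] q_def[symmetric] sum.distrib ring_distribs
            sum_distrib_left sum_distrib_right sum_divide_distrib mult.assoc)
      have X: "r y z i * (q - r z y i) / q = r y z i - r y z i * r z y i / q"
        using q(2) by (simp add: field_simps)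
      have eq: "(\<Sum>x\<in>V-{y}. u x i * r x y i)
          + (\<Sum>x\<in>V-{y}. u x i * r x z i) * r z y i / q
          = u y i * ((\<Sum>w\<in>V-{y}. r y w i) + r y z i) - u y i * r y z i * r z y i / q"
        unfolding A X by (simp add: ring_distribs mult.assoc)
      have "(\<Sum>x\<in>insert z V-{y}. v x i * r x y i)
          = (\<Sum>x\<in>V-{y}. u x i * r x y i) + uz i * r z y i"
        unfolding split(1) using fin split(2) \<open>z \<notin> V\<close>
        by (simp add: v_def) (intro sum.cong refl, auto)
      also have "uz i = (u y i * r y z i + (\<Sum>x\<in>V-{y}. u x i * r x z i)) / q"
        using y fin by (simp add: uz_def q_def sum.remove)
      finally have "(\<Sum>x\<in>insert z V-{y}. v x i * r x y i)
          = u y i * ((\<Sum>w\<in>V-{y}. r y w i) + r y z i)"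
        using eq by (simp add: add_divide_distrib algebra_simps)
      also have "\<dots> = v y i * exit_rate (insert z V) r y i"
        unfolding exit_rate_def split(1) using fin split(2) by (simp add: vV y)
      finally show ?thesis .
    qed
    moreover have "v x \<in> K" if "x \<in> insert z V" for x
      using that u uz by (auto simp: v_def)
    ultimately show ?case by blast
  qed
qed

text \<open>Harmonic functions are dual to invariant measures, and the same elimination serves them:
  the value at \<open>z\<close> is restored as the mean of \<open>h\<close> after a jump from
  \<open>z\<close>. Values may vanish, as first-entry probabilities can, hence
  \<open>Kz\<close>.\<close>

lemma dirichlet_exists_Kz:
  assumes "finite B" "A \<noteq> {}" "A \<inter> B = {}" "irred (A \<union> B) r"
    and "\<And>y. y \<in> A \<Longrightarrow> g y \<in> Kz"
  shows "\<exists>h. (\<forall>x\<in>A\<union>B. h x \<in> Kz) \<and> (\<forall>x\<in>A. h x = g x) \<and>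
    (\<forall>i\<in>I. \<forall>b\<in>B. h b i * exit_rate (A \<union> B) r b i = (\<Sum>w\<in>A\<union>B-{b}. r b w i * h w i))"
  using assms(1,3,4)
proof (induction B arbitrary: r rule: finite_induct)
  case empty
  show ?case by (rule exI[of _ g]) (simp add: assms)
next
  case (insert z B)
  let ?V = "A \<union> B"
  have V: "A \<union> insert z B = insert z ?V" by auto
  let ?D = "exit_rate (insert z ?V) r z" and ?r = "elim (insert z ?V) r z"
  have ne: "insert z ?V - {z} = ?V" "?V \<noteq> {}" using insert assms(2) by auto
  have irr: "irred (insert z ?V) r" using insert.prems V by simp
  have D: "?D \<in> K" using irr ne by (intro exit_rate_K) auto
  have "irred ?V ?r" using irred_elim[OF irr, of z] ne by auto
  then obtain h where h: "\<And>x. x \<in> ?V \<Longrightarrow> h x \<in> Kz" "\<And>x. x \<in> A \<Longrightarrow> h x = g x"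
    and sys: "\<And>i b. i \<in> I \<Longrightarrow> b \<in> B \<Longrightarrow>
       h b i * exit_rate ?V ?r b i = (\<Sum>w\<in>?V-{b}. ?r b w i * h w i)"
    using insert.IH[of ?r] insert.prems(1) by (elim meta_impE exE conjE) blast+
  have Kz: "r x y \<in> Kz" if "x \<in> insert z ?V" "y \<in> insert z ?V" "x \<noteq> y" for x y
    using irr that by (rule irred_Kz)
  have fin: "finite ?V" using irr by (simp add: irred_def)
  have znot: "z \<notin> ?V" using insert by auto
  define hz where "hz i = (\<Sum>w\<in>?V. r z w i * h w i) / ?D i" for i
  have "(\<lambda>i. r z w i * h w i) \<in> Kz" if "w \<in> ?V" for w
    using that znot h(1) by (intro Kz_mult Kz) auto
  then have hz: "hz \<in> Kz"
    unfolding hz_def[abs_def] by (intro Kz_divide[OF Kz_sum D])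
  define k where "k = h(z := hz)"
  have kV: "k x = h x" if "x \<in> ?V" for x using that znot by (auto simp: k_def)
  have "k b i * exit_rate (insert z ?V) r b i = (\<Sum>w\<in>insert z ?V-{b}. r b w i * k w i)"
    if i: "i \<in> I" and b: "b \<in> insert z B" for i b
  proof (cases "b = z")
    case True
    have "?D i > 0" using pos D i by auto
    then show ?thesis
      using True ne(1) znot by (auto simp: hz_def k_def intro!: sum.cong)
  next
    case False
    then have b: "b \<in> B" using b by auto
    then have bV: "b \<in> ?V" by auto
    have D0: "?D i \<noteq> 0" using pos[OF D i] by simp
    have split: "insert z ?V - {b} = insert z (?V - {b})" "z \<notin> ?V - {b}"
      using False znot by auto
    define q where "q = ?D i"
    have q: "q = r z b i + (\<Sum>w\<in>?V-{b}. r z w i)" "q \<noteq> 0"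
      using ne(1) bV fin D0 by (auto simp: q_def exit_rate_def sum.remove)
    have A: "(\<Sum>w\<in>?V-{b}. r b w i * h w i)
        + r b z i * (\<Sum>w\<in>?V-{b}. r z w i * h w i) / q
        = h b i * ((\<Sum>w\<in>?V-{b}. r b w i) + r b z i * (q - r z b i) / q)"
      using sys[OF i b] q
      by (simp add: elim_def exit_rate_def[of ?V] q_def[symmetric] sum.distrib ring_distribs
          sum_distrib_left sum_distrib_right sum_divide_distrib mult.assoc)
    have X: "r b z i * (q - r z b i) / q = r b z i - r b z i * r z b i / q"
      using q(2) by (simp add: field_simps)
    have eq: "(\<Sum>w\<in>?V-{b}. r b w i * h w i)
        + r b z i * (\<Sum>w\<in>?V-{b}. r z w i * h w i) / q
        = h b i * ((\<Sum>w\<in>?V-{b}. r b w i) + r b z i) - r b z i * r z b i * h b i / q"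
      unfolding A X by (simp add: ring_distribs mult.assoc)
    have "(\<Sum>w\<in>insert z ?V-{b}. r b w i * k w i)
        = (\<Sum>w\<in>?V-{b}. r b w i * h w i) + r b z i * hz i"
      unfolding split(1) using fin split(2) znot
      by (simp add: k_def) (intro sum.cong refl, auto)
    also have "hz i = (r z b i * h b i + (\<Sum>w\<in>?V-{b}. r z w i * h w i)) / q"
      using bV fin by (simp add: hz_def q_def sum.remove)
    finally have "(\<Sum>w\<in>insert z ?V-{b}. r b w i * k w i)
        = h b i * ((\<Sum>w\<in>?V-{b}. r b w i) + r b z i)"
      using eq by (simp add: add_divide_distrib algebra_simps)
    also have "\<dots> = k b i * exit_rate (insert z ?V) r b i"
      unfolding exit_rate_def split(1) using fin split(2) by (simp add: kV[OF bV])
    finally show ?thesis by simp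
  qed
  moreover have "k x \<in> Kz" if "x \<in> insert z ?V" for x
    using that h hz by (auto simp: k_def)
  moreover have "k x = g x" if "x \<in> A" for x
    using that h kV by auto
  ultimately show ?case unfolding V by blast
qed

end

section \<open>Uniqueness for a fixed rate matrix\<close>

text \<open>Maximum principle. A positive maximum is attained outside \<open>A\<close>; harmonicity
  there forces every out-neighbour to attain it too, so it spreads along a path into
  \<open>A\<close>, where \<open>h\<close> is zero.\<close>

lemma dirichlet_le_0:
  fixes h :: "'v \<Rightarrow> real"
  assumes fin: "finite V" and A: "A \<subseteq> V" "A \<noteq> {}"
    and nonneg: "\<And>x y. x \<in> V \<Longrightarrow> y \<in> V \<Longrightarrow> r x y \<ge> 0"
    and E: "\<And>x y. (x, y) \<in> E \<Longrightarrow> x \<in> V \<and> y \<in> V \<and> r x y > 0"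
    and sc: "\<And>x y. x \<in> V \<Longrightarrow> y \<in> V \<Longrightarrow> (x, y) \<in> E\<^sup>*"
    and bd: "\<And>x. x \<in> A \<Longrightarrow> h x = 0"
    and harm: "\<And>x. x \<in> V - A \<Longrightarrow> h x * (\<Sum>w\<in>V-{x}. r x w) = (\<Sum>w\<in>V-{x}. r x w * h w)"
    and x: "x \<in> V"
  shows "h x \<le> 0"
proof (rule ccontr)
  assume "\<not> h x \<le> 0"
  define m where "m = Max (h ` V)"
  have le: "h y \<le> m" if "y \<in> V" for y using fin that by (simp add: m_def)
  have "m \<in> h ` V" unfolding m_def using fin x by (intro Max_in) auto
  then obtain y where y: "y \<in> V" "h y = m" by auto
  have m: "m > 0" using \<open>\<not> h x \<le> 0\<close> le[OF x] by simp
  obtain a where a: "a \<in> A" using A by auto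
  have "w \<in> V \<and> h w = m" if "(y, w) \<in> E\<^sup>*" for w
    using that
  proof (induction rule: rtrancl_induct)
    case base
    then show ?case using y by simp
  next
    case (step w v)
    then have w: "w \<in> V - A" "h w = m" using bd m by force+
    have v: "v \<in> V" "r w v > 0" using E[OF step(2)] by auto
    show ?case
    proof (cases "v = w")
      case True then show ?thesis using step by simp
    next
      case False
      \<comment> \<open>The gaps \<open>m - h u\<close> are nonnegative and their weighted sum is
        zero, so each gap with positive weight is zero.\<close>
      have "(\<Sum>u\<in>V-{w}. r w u * (m - h u)) = 0"
        using harm[OF w(1)] w(2)
        by (simp add: right_diff_distrib sum_subtractf sum_distrib_left mult.commute)
      then have "r w v * (m - h v) = 0"
        using fin v False w le nonneg
        by (subst (asm) sum_nonneg_eq_0_iff) (auto dest!: bspec[of _ _ v])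
      then show ?thesis using v by simp
    qed
  qed
  then have "h a = m" using sc[of y a] y a A by auto
  then show False using bd[OF a] m by simp
qed

lemma dirichlet_unique:
  fixes h k :: "'v \<Rightarrow> real"
  assumes fin: "finite V" and A: "A \<subseteq> V" "A \<noteq> {}"
    and nonneg: "\<And>x y. x \<in> V \<Longrightarrow> y \<in> V \<Longrightarrow> r x y \<ge> 0"
    and E: "\<And>x y. (x, y) \<in> E \<Longrightarrow> x \<in> V \<and> y \<in> V \<and> r x y > 0"
    and sc: "\<And>x y. x \<in> V \<Longrightarrow> y \<in> V \<Longrightarrow> (x, y) \<in> E\<^sup>*"
    and bd: "\<And>x. x \<in> A \<Longrightarrow> h x = k x"
    and h: "\<And>x. x \<in> V - A \<Longrightarrow> h x * (\<Sum>w\<in>V-{x}. r x w) = (\<Sum>w\<in>V-{x}. r x w * h w)"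
    and k: "\<And>x. x \<in> V - A \<Longrightarrow> k x * (\<Sum>w\<in>V-{x}. r x w) = (\<Sum>w\<in>V-{x}. r x w * k w)"
    and x: "x \<in> V"
  shows "h x = k x"
proof -
  have "h x - k x \<le> 0"
    by (rule dirichlet_le_0[OF fin A nonneg E sc, where h = "\<lambda>x. h x - k x"])
      (use bd h k x in \<open>auto simp: left_diff_distrib right_diff_distrib sum_subtractf\<close>)
  moreover have "k x - h x \<le> 0"
    by (rule dirichlet_le_0[OF fin A nonneg E sc, where h = "\<lambda>x. k x - h x"])
      (use bd h k x in \<open>auto simp: left_diff_distrib right_diff_distrib sum_subtractf\<close>)
  ultimately show ?thesis by simp
qed

text \<open>Subtract from \<open>v\<close> the largest multiple of \<open>u\<close> that leaves it
  nonnegative. The difference \<open>w\<close> is invariant and vanishes at some \<open>a\<close>; a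
  zero at a vertex forces zeros at its in-neighbours, and every vertex leads to
  \<open>a\<close>.\<close>

lemma invariant_unique:
  fixes u v :: "'v \<Rightarrow> real"
  assumes fin: "finite V"
    and E: "\<And>x y. (x, y) \<in> E \<Longrightarrow> x \<in> V \<and> y \<in> V \<and> r x y > 0"
    and nonneg: "\<And>x y. x \<in> V \<Longrightarrow> y \<in> V \<Longrightarrow> r x y \<ge> 0"
    and sc: "\<And>x y. x \<in> V \<Longrightarrow> y \<in> V \<Longrightarrow> (x, y) \<in> E\<^sup>*"
    and u: "\<And>x. x \<in> V \<Longrightarrow> u x > 0" "(\<Sum>x\<in>V. u x) = 1"
      "\<And>y. y \<in> V \<Longrightarrow> (\<Sum>x\<in>V. u x * r x y) = u y * (\<Sum>z\<in>V. r y z)"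
    and v: "(\<Sum>x\<in>V. v x) = 1"
      "\<And>y. y \<in> V \<Longrightarrow> (\<Sum>x\<in>V. v x * r x y) = v y * (\<Sum>z\<in>V. r y z)"
    and x: "x \<in> V"
  shows "v x = u x"
proof -
  define t where "t = Min ((\<lambda>x. v x / u x) ` V)"
  define w where "w y = v y - t * u y" for y
  have "t \<in> (\<lambda>x. v x / u x) ` V"
    unfolding t_def using fin x by (intro Min_in) auto
  then obtain a where a: "a \<in> V" "t = v a / u a" by auto
  have "t \<le> v y / u y" if "y \<in> V" for y
    unfolding t_def using fin that by auto
  then have w0: "w y \<ge> 0" if "y \<in> V" for y
    using u(1)[OF that] pos_le_divide_eq[of "u y" t "v y"] that by (simp add: w_def)
  have wa: "w a = 0" using u(1)[OF a(1)] a by (simp add: w_def)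
  have inv: "(\<Sum>x\<in>V. w x * r x y) = w y * (\<Sum>z\<in>V. r y z)" if "y \<in> V" for y
    using u(3)[OF that] v(2)[OF that]
    by (simp add: w_def left_diff_distrib sum_subtractf mult.assoc flip: sum_distrib_left)
  have "w y = 0" if "(y, a) \<in> E\<^sup>*" for y
    using that
  proof (induction rule: converse_rtrancl_induct)
    case base
    then show ?case by (rule wa)
  next
    case (step y z)
    then have yz: "y \<in> V" "z \<in> V" "r y z > 0" using E by auto
    have "(\<Sum>x\<in>V. w x * r x z) = 0" using inv[OF yz(2)] step by simp
    then have "w y * r y z = 0"
      using yz fin w0 nonneg by (subst (asm) sum_nonneg_eq_0_iff) auto
    then show ?case using yz by simp
  qed
  then have w: "v y = t * u y" if "y \<in> V" for y
    using sc[OF that a(1)] by (simp add: w_def)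
  have "1 = (\<Sum>y\<in>V. t * u y)" using w v(1) by simp
  also have "\<dots> = t" using u(2) by (simp flip: sum_distrib_left)
  finally show ?thesis using w[OF x] by simp
qed

text \<open>Loops are restored here: the diagonal rate of \<open>y\<close> adds the same term to
  both sides. The total mass lies in \<open>K\<close>, so normalisation does not leave the
  class.\<close>

lemma (in pos_class) invariant_prob_exists_K:
  assumes irr: "irred V r" and ne: "V \<noteq> {}"
  shows "\<exists>u. (\<forall>x\<in>V. u x \<in> K) \<and> (\<forall>i\<in>I. (\<Sum>x\<in>V. u x i) = 1 \<and>
    (\<forall>y\<in>V. (\<Sum>x\<in>V. u x i * r x y i) = u y i * (\<Sum>z\<in>V. r y z i)))"
proof -
  obtain u where u: "\<And>x. x \<in> V \<Longrightarrow> u x \<in> K"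
    and inv: "\<And>i y. i \<in> I \<Longrightarrow> y \<in> V \<Longrightarrow>
      (\<Sum>x\<in>V-{y}. u x i * r x y i) = u y i * exit_rate V r y i"
    using invariant_exists_K[OF assms] by blast
  have fin: "finite V" using irr by (simp add: irred_def)
  define s where "s i = (\<Sum>x\<in>V. u x i)" for i
  obtain a where "a \<in> V" using ne by auto
  then have s: "s \<in> K"
    unfolding s_def[abs_def] using fin u by (intro sum_in_K[where a = a and f = u] KzI)
  define v where "v x i = u x i / s i" for x i
  have "v x \<in> K" if "x \<in> V" for x
    unfolding v_def[abs_def] by (rule divide[OF u[OF that] s])
  moreover have "(\<Sum>x\<in>V. v x i) = 1" if "i \<in> I" for i
    using pos[OF s that] by (simp add: v_def s_def flip: sum_divide_distrib)
  moreover have "(\<Sum>x\<in>V. v x i * r x y i) = v y i * (\<Sum>z\<in>V. r y z i)"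
    if "i \<in> I" "y \<in> V" for i y
  proof -
    have "(\<Sum>x\<in>V. u x i * r x y i) = u y i * (\<Sum>z\<in>V. r y z i)"
      using inv[OF that] fin that by (simp add: exit_rate_def sum.remove[of V y] distrib_left)
    then show ?thesis
      by (simp add: v_def flip: sum_divide_distrib)
  qed
  ultimately show ?thesis by blast
qed

section \<open>Perturbation of invariant measures\<close>

text \<open>A pair of functions of \<open>N\<close> is encoded as one function on \<open>real \<times> bool\<close>, so that state
  elimination applies to both members simultaneously.\<close>

definition ratio_class :: "(real \<times> bool \<Rightarrow> real) set" where
  "ratio_class = {f. (\<forall>N>0. \<forall>b. f (N, b) > 0) \<and>
     ((\<lambda>N. f (N, True) / f (N, False)) \<longlongrightarrow> 1) at_top}"

text \<open>The relative error of a sum is at most the sum of the relative errors, because each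
  denominator only grows when the other positive term is added; the two terms may be of different
  orders.\<close>

lemma ratio_add_tendsto:
  fixes a b c d :: "real \<Rightarrow> real"
  assumes "\<And>N. N > 0 \<Longrightarrow> a N > 0 \<and> b N > 0 \<and> c N > 0 \<and> d N > 0"
    and "((\<lambda>N. a N / b N) \<longlongrightarrow> 1) at_top" "((\<lambda>N. c N / d N) \<longlongrightarrow> 1) at_top"
  shows "((\<lambda>N. (a N + c N) / (b N + d N)) \<longlongrightarrow> 1) at_top"
proof -
  have "((\<lambda>N. \<bar>a N / b N - 1\<bar> + \<bar>c N / d N - 1\<bar>) \<longlongrightarrow> \<bar>1 - 1\<bar> + \<bar>1 - 1\<bar>) at_top"
    by (intro tendsto_intros assms)
  then have lim: "((\<lambda>N. \<bar>a N / b N - 1\<bar> + \<bar>c N / d N - 1\<bar>) \<longlongrightarrow> 0) at_top" by simp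
  have "\<bar>(a N + c N) / (b N + d N) - 1\<bar> \<le> \<bar>a N / b N - 1\<bar> + \<bar>c N / d N - 1\<bar>"
    if "N > 0" for N
  proof -
    have p: "a N > 0" "b N > 0" "c N > 0" "d N > 0" using assms(1)[OF that] by auto
    have "b N / (b N + d N) + d N / (b N + d N) = 1"
      using p by (simp flip: add_divide_distrib)
    then have "(a N + c N) / (b N + d N) - 1 = (a N - b N) / (b N + d N) + (c N - d N) / (b N + d N)"
      by (simp add: add_divide_distrib diff_divide_distrib)
    also have "\<bar>\<dots>\<bar> \<le> \<bar>a N - b N\<bar> / (b N + d N) + \<bar>c N - d N\<bar> / (b N + d N)"
      using p by (intro order_trans[OF abs_triangle_ineq]) (simp add: abs_divide)
    also have "\<dots> \<le> \<bar>a N - b N\<bar> / b N + \<bar>c N - d N\<bar> / d N"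
      using p by (intro add_mono divide_left_mono) auto
    also have "\<dots> = \<bar>a N / b N - 1\<bar> + \<bar>c N / d N - 1\<bar>"
    proof -
      have "\<bar>x - y\<bar> / y = \<bar>x / y - 1\<bar>" if "y > 0" for x y :: real
      proof -
        have "\<bar>x / y - 1\<bar> = \<bar>(x - y) / y\<bar>" using that by (simp add: diff_divide_distrib)
        then show ?thesis using that by (simp add: abs_divide)
      qed
      then show ?thesis using p by simp
    qed
    finally show ?thesis .
  qed
  then have "((\<lambda>N. (a N + c N) / (b N + d N) - 1) \<longlongrightarrow> 0) at_top"
    by (intro Lim_null_comparison[OF _ lim])
      (auto intro!: eventually_mono[OF eventually_gt_at_top[of 0]])
  then show ?thesis by (simp add: LIM_zero_iff)
qed

interpretation ratio: pos_class "{0<..} \<times> UNIV" ratio_class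
proof
  fix f g :: "real \<times> bool \<Rightarrow> real"
  assume f: "f \<in> ratio_class"
  show "f i > 0" if "i \<in> {0<..} \<times> UNIV" for i
    using f that by (cases i) (auto simp: ratio_class_def)
  have f': "\<And>N b. N > 0 \<Longrightarrow> f (N, b) > 0" "((\<lambda>N. f (N, True) / f (N, False)) \<longlongrightarrow> 1) at_top"
    using f by (auto simp: ratio_class_def)
  show "g \<in> ratio_class" if "\<And>i. i \<in> {0<..} \<times> UNIV \<Longrightarrow> g i = f i"
  proof -
    have eq: "g (N, b) = f (N, b)" if "N > 0" for N b
      using \<open>\<And>i. i \<in> {0<..} \<times> UNIV \<Longrightarrow> g i = f i\<close> that by simp
    have "((\<lambda>N. g (N, True) / g (N, False)) \<longlongrightarrow> 1) at_top"
      using f'(2) by (rule Lim_transform_eventually)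
        (auto simp: eq intro!: eventually_mono[OF eventually_gt_at_top[of 0]])
    then show ?thesis using f'(1) eq by (simp add: ratio_class_def)
  qed
  assume g: "g \<in> ratio_class"
  then have g': "\<And>N b. N > 0 \<Longrightarrow> g (N, b) > 0" "((\<lambda>N. g (N, True) / g (N, False)) \<longlongrightarrow> 1) at_top"
    by (auto simp: ratio_class_def)
  show "(\<lambda>i. f i + g i) \<in> ratio_class"
    using f' g' ratio_add_tendsto[OF _ f'(2) g'(2)]
    by (auto simp: ratio_class_def add_pos_pos)
  show "(\<lambda>i. f i * g i) \<in> ratio_class"
    using f' g' tendsto_mult[OF f'(2) g'(2)] by (auto simp: ratio_class_def)
  show "(\<lambda>i. f i / g i) \<in> ratio_class"
    using f' g' tendsto_divide[OF f'(2) g'(2)]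
    by (simp add: ratio_class_def mult.commute[of "f (_, False)"])
next
  show "(\<lambda>i. 1) \<in> ratio_class" by (simp add: ratio_class_def)
qed

text \<open>One elimination formula is evaluated at both sets of rates; membership of its value in
  \<open>ratio_class\<close> is the claim, and uniqueness identifies its two slices with
  \<open>u\<close> and \<open>v\<close>. The claim concerns a quotient since the masses themselves
  may tend to 0.\<close>

lemma invariant_perturb:
  fixes r s :: "'v \<Rightarrow> 'v \<Rightarrow> real \<Rightarrow> real"
  assumes fin: "finite V"
    and E: "E \<subseteq> V \<times> V" "\<And>x y. x \<in> V \<Longrightarrow> y \<in> V \<Longrightarrow> (x, y) \<in> E\<^sup>*"
    and nonneg: "\<And>x y N. x \<in> V \<Longrightarrow> y \<in> V \<Longrightarrow> N > 0 \<Longrightarrow> r x y N \<ge> 0 \<and> s x y N \<ge> 0"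
    and pos: "\<And>x y N. (x, y) \<in> E \<Longrightarrow> N > 0 \<Longrightarrow> r x y N > 0 \<and> s x y N > 0"
    and zero: "\<And>x y N. x \<in> V \<Longrightarrow> y \<in> V \<Longrightarrow> x \<noteq> y \<Longrightarrow> (x, y) \<notin> E \<Longrightarrow> N > 0 \<Longrightarrow>
      r x y N = 0 \<and> s x y N = 0"
    and lim: "\<And>x y. (x, y) \<in> E \<Longrightarrow> ((\<lambda>N. r x y N / s x y N) \<longlongrightarrow> 1) at_top"
    and u: "\<And>N. N > 0 \<Longrightarrow> (\<Sum>x\<in>V. u x N) = 1"
      "\<And>N y. N > 0 \<Longrightarrow> y \<in> V \<Longrightarrow> (\<Sum>x\<in>V. u x N * r x y N) = u y N * (\<Sum>z\<in>V. r y z N)"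
    and v: "\<And>N. N > 0 \<Longrightarrow> (\<Sum>x\<in>V. v x N) = 1"
      "\<And>N y. N > 0 \<Longrightarrow> y \<in> V \<Longrightarrow> (\<Sum>x\<in>V. v x N * s x y N) = v y N * (\<Sum>z\<in>V. s y z N)"
    and x: "x \<in> V"
  shows "((\<lambda>N. u x N / v x N) \<longlongrightarrow> 1) at_top"
proof -
  define q where "q x y = (\<lambda>(N, b). if b then r x y N else s x y N)" for x y
  have qK: "q x y \<in> ratio_class" if "(x, y) \<in> E" for x y
    using pos[OF that] lim[OF that] by (simp add: ratio_class_def q_def)
  have qKz: "q x y \<in> ratio.Kz" if "x \<in> V" "y \<in> V" "x \<noteq> y" for x y
    using qK[of x y] zero[OF that] by (cases "(x, y) \<in> E") (auto simp: ratio.Kz_def q_def)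
  have "ratio.irred V q"
    using fin E(1) E(2) qK qKz by (rule ratio.irredI)
  then obtain w where "(\<forall>x\<in>V. w x \<in> ratio_class) \<and>
      (\<forall>i\<in>{0<..} \<times> UNIV. (\<Sum>x\<in>V. w x i) = 1 \<and>
        (\<forall>y\<in>V. (\<Sum>x\<in>V. w x i * q x y i) = w y i * (\<Sum>z\<in>V. q y z i)))"
    using ratio.invariant_prob_exists_K[of V q] x by blast
  then have w: "\<And>x. x \<in> V \<Longrightarrow> w x \<in> ratio_class"
    "\<And>i. i \<in> {0<..} \<times> UNIV \<Longrightarrow> (\<Sum>x\<in>V. w x i) = 1"
    "\<And>i y. i \<in> {0<..} \<times> UNIV \<Longrightarrow> y \<in> V \<Longrightarrow>
      (\<Sum>x\<in>V. w x i * q x y i) = w y i * (\<Sum>z\<in>V. q y z i)"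
    by blast+
  have "u x N = w x (N, True)" if N: "N > 0" for N
    by (rule invariant_unique[where V = V and E = E and r = "\<lambda>x y. r x y N"])
      (use fin E pos nonneg u v x N w(2)[of "(N, True)"] w(3)[of "(N, True)"] ratio.pos[OF w(1), of _ "(N, True)"]
        in \<open>auto simp: q_def\<close>)
  moreover have "v x N = w x (N, False)" if N: "N > 0" for N
    by (rule invariant_unique[where V = V and E = E and r = "\<lambda>x y. s x y N"])
      (use fin E pos nonneg u v x N w(2)[of "(N, False)"] w(3)[of "(N, False)"] ratio.pos[OF w(1), of _ "(N, False)"]
        in \<open>auto simp: q_def\<close>)
  moreover have "((\<lambda>N. w x (N, True) / w x (N, False)) \<longlongrightarrow> 1) at_top"
    using w(1)[OF x] by (simp add: ratio_class_def)
  ultimately show ?thesis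
    by (elim Lim_transform_eventually)
      (auto intro!: eventually_mono[OF eventually_gt_at_top[of 0]])
qed

section \<open>Invariant measures of jump graphs\<close>

text \<open>Weaker than \<^const>\<open>weighted_graph\<close>: the rates off the edges are arbitrary, as they are in
  \<^const>\<open>class_graph\<close>.\<close>

definition jump_graph :: "'v wgraph \<Rightarrow> bool" where
  "jump_graph G \<longleftrightarrow> finite (verts G) \<and> verts G \<noteq> {} \<and> edges G \<subseteq> verts G \<times> verts G \<and>
     (\<forall>x\<in>verts G. \<forall>y\<in>verts G. (x, y) \<in> (edges G)\<^sup>*) \<and>
     (\<forall>N>0. \<forall>(x, y)\<in>edges G. rate G N x y > 0)"

lemma jump_graphD:
  assumes "jump_graph G"
  shows "finite (verts G)" "verts G \<noteq> {}" "edges G \<subseteq> verts G \<times> verts G"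
    "x \<in> verts G \<Longrightarrow> y \<in> verts G \<Longrightarrow> (x, y) \<in> (edges G)\<^sup>*"
    "(x, y) \<in> edges G \<Longrightarrow> N > 0 \<Longrightarrow> rate G N x y > 0"
  using assms unfolding jump_graph_def by blast+

lemma weighted_graph_jump_graph: "weighted_graph G \<Longrightarrow> jump_graph G"
  unfolding weighted_graph_def jump_graph_def
  by (intro conjI; (elim conjE)?) (auto split: if_splits)

text \<open>Lets every balance sum run over the full vertex set, even in \<open>class_graph\<close>,
  where rates off the edges can be nonzero.\<close>

definition edge_rate :: "'v wgraph \<Rightarrow> real \<Rightarrow> 'v \<Rightarrow> 'v \<Rightarrow> real" where
  "edge_rate G N x y = (if (x, y) \<in> edges G then rate G N x y else 0)"

lemma invariant_prob_iff:
  assumes "finite (verts G)" "edges G \<subseteq> verts G \<times> verts G"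
  shows "invariant_prob G N \<mu> \<longleftrightarrow> measure_on (verts G) \<mu> \<and> (\<Sum>x\<in>verts G. \<mu> x) = 1 \<and>
    (\<forall>y\<in>verts G. (\<Sum>x\<in>verts G. \<mu> x * edge_rate G N x y) = \<mu> y * (\<Sum>z\<in>verts G. edge_rate G N y z))"
proof -
  have "(\<Sum>x | (x, y) \<in> edges G. \<mu> x * rate G N x y) = (\<Sum>x\<in>verts G. \<mu> x * edge_rate G N x y)" for y
    using assms by (intro sum.mono_neutral_cong_left) (auto simp: edge_rate_def)
  moreover have "(\<Sum>z | (y, z) \<in> edges G. rate G N y z) = (\<Sum>z\<in>verts G. edge_rate G N y z)" for y
    using assms by (intro sum.mono_neutral_cong_left) (auto simp: edge_rate_def)
  ultimately show ?thesis by (simp add: invariant_prob_def)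
qed

lemma edge_rate_irred:
  assumes K: "pos_class {0<..} K" and G: "jump_graph G"
    and edge: "\<And>x y. (x, y) \<in> edges G \<Longrightarrow> (\<lambda>N. rate G N x y / \<rho> N) \<in> K"
  shows "pos_class.irred {0<..} K (verts G) (\<lambda>x y N. edge_rate G N x y / \<rho> N)"
    and "(\<lambda>N. edge_rate G N x y / \<rho> N) \<in> pos_class.Kz {0<..} K"
proof -
  interpret pos_class "{0<..}" K by fact
  let ?r = "\<lambda>x y N. edge_rate G N x y / \<rho> N"
  have rK: "?r x y \<in> K" if "(x, y) \<in> edges G" for x y
    using edge[OF that] that by (simp add: edge_rate_def)
  show rKz: "?r x y \<in> Kz" for x y
    using rK[of x y] by (cases "(x, y) \<in> edges G") (auto simp: Kz_def edge_rate_def)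
  show "irred (verts G) ?r"
    using jump_graphD(1,3,4)[OF G] rK rKz by (rule irredI)
qed

text \<open>The balance equations are homogeneous in the rates: dividing all rates by
  \<open>\<rho>\<close> keeps the invariant measure and turns the coefficients into members of
  \<open>K\<close>, which the rates themselves need not be.\<close>

lemma inv_measure_K:
  assumes K: "pos_class {0<..} K" and G: "jump_graph G"
    and \<rho>: "\<And>N. N > 0 \<Longrightarrow> \<rho> N > 0"
    and edge: "\<And>x y. (x, y) \<in> edges G \<Longrightarrow> (\<lambda>N. rate G N x y / \<rho> N) \<in> K"
  shows "x \<in> verts G \<Longrightarrow> (\<lambda>N. inv_measure G N x) \<in> K" (is "_ \<Longrightarrow> ?A")
    and "N > 0 \<Longrightarrow> invariant_prob G N (inv_measure G N)" (is "_ \<Longrightarrow> ?B")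
    and "N > 0 \<Longrightarrow> \<exists>!\<mu>. invariant_prob G N \<mu>" (is "_ \<Longrightarrow> ?C")
proof -
  interpret pos_class "{0<..}" K by fact
  let ?V = "verts G"
  have fin: "finite ?V" and E: "edges G \<subseteq> ?V \<times> ?V" and ne: "?V \<noteq> {}"
    and sc: "\<And>x y. x \<in> ?V \<Longrightarrow> y \<in> ?V \<Longrightarrow> (x, y) \<in> (edges G)\<^sup>*"
    and pos_rate: "\<And>N x y. N > 0 \<Longrightarrow> (x, y) \<in> edges G \<Longrightarrow> edge_rate G N x y > 0"
    using G by (auto simp: jump_graph_def edge_rate_def)
  define r where "r x y N = edge_rate G N x y / \<rho> N" for x y N
  have "irred ?V r"
    unfolding r_def[abs_def] by (rule edge_rate_irred(1)[OF K G edge])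
  then obtain u where "(\<forall>x\<in>?V. u x \<in> K) \<and> (\<forall>N\<in>{0<..}. (\<Sum>x\<in>?V. u x N) = 1 \<and>
      (\<forall>y\<in>?V. (\<Sum>x\<in>?V. u x N * r x y N) = u y N * (\<Sum>z\<in>?V. r y z N)))"
    using invariant_prob_exists_K[of ?V r] ne by blast
  then have u: "\<And>x. x \<in> ?V \<Longrightarrow> u x \<in> K"
    "\<And>N. N > 0 \<Longrightarrow> (\<Sum>x\<in>?V. u x N) = 1"
    "\<And>N y. N > 0 \<Longrightarrow> y \<in> ?V \<Longrightarrow> (\<Sum>x\<in>?V. u x N * r x y N) = u y N * (\<Sum>z\<in>?V. r y z N)"
    by auto
  define v where "v N x = (if x \<in> ?V then u x N else 0)" for N x
  have upos: "u x N > 0" if "x \<in> ?V" "N > 0" for x N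
    using pos[OF u(1)] that by simp
  have inv_u: "(\<Sum>x\<in>?V. u x N * edge_rate G N x y) = u y N * (\<Sum>z\<in>?V. edge_rate G N y z)"
    if "N > 0" "y \<in> ?V" for N y
    using u(3)[OF that] \<rho>[OF that(1)] by (simp add: r_def flip: sum_divide_distrib)
  have v: "invariant_prob G N (v N)" if "N > 0" for N
    unfolding invariant_prob_iff[OF fin E] measure_on_def
    using u(2) inv_u upos that by (auto simp: v_def less_imp_le cong: sum.cong)
  have uniq: "\<mu> = v N" if \<mu>: "invariant_prob G N \<mu>" and N: "N > 0" for \<mu> N
  proof
    fix x
    show "\<mu> x = v N x"
    proof (cases "x \<in> ?V")
      case False
      then show ?thesis using \<mu> by (simp add: v_def invariant_prob_iff[OF fin E] measure_on_def)
    next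
      case True
      have "\<mu> x = u x N"
        by (rule invariant_unique[where V = ?V and E = "edges G" and r = "edge_rate G N"])
          (use fin E pos_rate[OF N] sc upos u(2) inv_u \<mu> True N
            in \<open>auto simp: invariant_prob_iff[OF fin E] less_imp_le edge_rate_def\<close>)
      then show ?thesis using True by (simp add: v_def)
    qed
  qed
  have eq: "inv_measure G N = v N" if "N > 0" for N
    unfolding inv_measure_def using v uniq that by (intro the_equality) auto
  show ?A if "x \<in> ?V"
    using cong[OF u(1)[OF that]] that eq by (simp add: v_def)
  show ?B if "N > 0" using v[OF that] eq[OF that] by simp
  show ?C if "N > 0" using v[OF that] uniq that by blast
qed

text \<open>This class imposes no asymptotics, so it gives existence, positivity and uniqueness of
  invariant measures at each N without (A).\<close>

interpretation all_pos: pos_class "{0<..}" "{f. \<forall>N::real>0. (f N :: real) > 0}"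
  by standard (auto intro: add_pos_pos)

lemma inv_measure_jump_graph:
  assumes "jump_graph G" "N > 0"
  shows inv_measure_invariant: "invariant_prob G N (inv_measure G N)"
    and invariant_prob_ex1: "\<exists>!\<mu>. invariant_prob G N \<mu>"
    and inv_measure_pos: "x \<in> verts G \<Longrightarrow> inv_measure G N x > 0"
proof -
  have "(\<lambda>N. rate G N x y / 1) \<in> {f. \<forall>N>0. f N > 0}" if "(x, y) \<in> edges G" for x y
    using assms that by (auto simp: jump_graph_def)
  note * = inv_measure_K[OF all_pos.pos_class_axioms assms(1), where \<rho> = "\<lambda>_. 1", OF zero_less_one this]
  show "invariant_prob G N (inv_measure G N)" "\<exists>!\<mu>. invariant_prob G N \<mu>"
    using *(2,3) assms(2) by auto
  show "inv_measure G N x > 0" if "x \<in> verts G"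
    using *(1)[OF _ that] assms(2) by auto
qed

lemma inv_measure_nonneg:
  assumes "jump_graph G" "N > 0" shows "inv_measure G N x \<ge> 0"
  using inv_measure_invariant[OF assms]
  by (cases "x \<in> verts G") (auto simp: invariant_prob_def measure_on_def)

lemma inv_measure_outside:
  assumes "jump_graph G" "N > 0" "x \<notin> verts G" shows "inv_measure G N x = 0"
  using inv_measure_invariant[OF assms(1,2)] assms(3)
  by (auto simp: invariant_prob_def measure_on_def)

lemma sum_inv_measure:
  assumes "jump_graph G" "N > 0" shows "(\<Sum>x\<in>verts G. inv_measure G N x) = 1"
  using inv_measure_invariant[OF assms] by (auto simp: invariant_prob_def)

lemma inv_measure_le_1:
  assumes "jump_graph G" "N > 0" shows "inv_measure G N x \<le> 1"
proof (cases "x \<in> verts G")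
  case True
  then have "inv_measure G N x \<le> (\<Sum>x\<in>verts G. inv_measure G N x)"
    using assms by (intro member_le_sum inv_measure_nonneg) (auto simp: jump_graph_def)
  then show ?thesis using sum_inv_measure[OF assms] by simp
qed (simp add: inv_measure_outside[OF assms])

lemma inv_measure_balance:
  assumes "jump_graph G" "N > 0" "y \<in> verts G"
  shows "(\<Sum>x\<in>verts G. inv_measure G N x * edge_rate G N x y) =
    inv_measure G N y * (\<Sum>z\<in>verts G. edge_rate G N y z)"
  using inv_measure_invariant[OF assms(1,2)] assms
  by (subst (asm) invariant_prob_iff) (auto simp: jump_graph_def)

section \<open>Functions of the rates under Assumption (A)\<close>

definition monomial :: "'v wgraph \<Rightarrow> ('v \<times> 'v \<Rightarrow> nat) \<Rightarrow> ('v \<times> 'v \<Rightarrow> nat) \<Rightarrow> real \<Rightarrow> real" where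
  "monomial G m n N = (\<Prod>(x, y)\<in>edges G. rate G N x y ^ m (x, y)) /
                      (\<Prod>(x, y)\<in>edges G. rate G N x y ^ n (x, y))"

lemma monomial_pos: "jump_graph G \<Longrightarrow> N > 0 \<Longrightarrow> monomial G m n N > 0"
  unfolding monomial_def by (intro divide_pos_pos prod_pos) (auto simp: jump_graph_def intro!: zero_less_power)

lemma monomial_mult:
  "monomial G m n N * monomial G m' n' N = monomial G (\<lambda>e. m e + m' e) (\<lambda>e. n e + n' e) N"
  by (simp add: monomial_def power_add prod.distrib split_def)

lemma monomial_inverse: "inverse (monomial G m n N) = monomial G n m N"
  by (simp add: monomial_def)

text \<open>Degrees are equal because (A) controls balanced quotients only. A single rate need not
  belong to this class; a quotient of two edge rates does.\<close>

definition monomial_like :: "'v wgraph \<Rightarrow> (real \<Rightarrow> real) set" where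
  "monomial_like G = {f. (\<forall>N>0. f N > 0) \<and> (\<exists>c>0. \<exists>m n.
     (\<Sum>e\<in>edges G. m e) = (\<Sum>e\<in>edges G. n e) \<and>
     ((\<lambda>N. f N / monomial G m n N) \<longlongrightarrow> c) at_top)}"

lemma monomial_likeI:
  assumes "\<And>N. N > 0 \<Longrightarrow> f N > 0" "c > 0" "(\<Sum>e\<in>edges G. m e) = (\<Sum>e\<in>edges G. n e)"
    "((\<lambda>N. f N / monomial G m n N) \<longlongrightarrow> c) at_top"
  shows "f \<in> monomial_like G"
  using assms unfolding monomial_like_def by blast

text \<open>Expresses a limit in [0, \<infinity>] by real filters, so that proofs split into a
  convergent and a divergent case without extended arithmetic.\<close>

definition has_limit :: "(real \<Rightarrow> real) \<Rightarrow> bool" where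
  "has_limit f \<longleftrightarrow> (\<exists>L\<ge>0. (f \<longlongrightarrow> L) at_top) \<or> filterlim f at_top at_top"

lemma has_limit_of_ennreal:
  assumes lim: "((\<lambda>N. ennreal (f N)) \<longlongrightarrow> L) at_top" and pos: "\<And>N. N > 0 \<Longrightarrow> f N > 0"
  shows "has_limit f"
proof (cases "L = \<top>")
  case False
  have "((\<lambda>N. enn2real (ennreal (f N))) \<longlongrightarrow> enn2real L) at_top"
    using lim False by (intro tendsto_enn2real) (auto simp: top.not_eq_extremum)
  then have "(f \<longlongrightarrow> enn2real L) at_top"
    by (rule Lim_transform_eventually)
      (auto simp: pos less_imp_le intro!: eventually_mono[OF eventually_gt_at_top[of 0]])
  then show ?thesis unfolding has_limit_def by (meson enn2real_nonneg)
next
  case True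
  have "filterlim f at_top at_top"
    unfolding filterlim_at_top
  proof
    fix Z :: real
    have "\<forall>\<^sub>F N in at_top. ennreal (f N) > ennreal \<bar>Z\<bar>"
      using lim True by (intro order_tendstoD(1)[of _ L]) auto
    then show "\<forall>\<^sub>F N in at_top. Z \<le> f N"
      by (elim eventually_mono) (meson abs_ge_self ennreal_leI leD leI order_trans less_imp_le)
  qed
  then show ?thesis by (simp add: has_limit_def)
qed

lemma ennreal_limit_of_has_limit:
  assumes "has_limit f" shows "\<exists>L. ((\<lambda>N. ennreal (f N)) \<longlongrightarrow> L) at_top"
  using assms unfolding has_limit_def
proof
  assume "\<exists>L\<ge>0. (f \<longlongrightarrow> L) at_top"
  then show ?thesis by (auto intro: tendsto_ennrealI)
next
  assume "filterlim f at_top at_top"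
  then show ?thesis
    using ennreal_tendsto_top_eq_at_top[of f at_top] by blast
qed

lemma monomial_has_limit:
  assumes "jump_graph G" "assumption_A G" "(\<Sum>e\<in>edges G. m e) = (\<Sum>e\<in>edges G. n e)"
  shows "has_limit (monomial G m n)"
proof -
  obtain L where "((\<lambda>N. ennreal (monomial G m n N)) \<longlongrightarrow> L) at_top"
    using assms(2,3) unfolding assumption_A_def monomial_def by blast
  then show ?thesis
    by (rule has_limit_of_ennreal) (rule monomial_pos[OF assms(1)])
qed

lemma monomial_like_has_limit:
  assumes G: "jump_graph G" "assumption_A G" and f: "f \<in> monomial_like G"
  shows "has_limit f"
proof -
  obtain c m n where c: "c > 0" and mn: "(\<Sum>e\<in>edges G. m e) = (\<Sum>e\<in>edges G. n e)"
    and lim: "((\<lambda>N. f N / monomial G m n N) \<longlongrightarrow> c) at_top"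
    using f by (auto simp: monomial_like_def)
  let ?m = "monomial G m n"
  have eq: "\<forall>\<^sub>F N in at_top. f N / ?m N * ?m N = f N"
    using monomial_pos[OF G(1), of _ m n]
    by (auto intro!: eventually_mono[OF eventually_gt_at_top[of 0]] simp: less_imp_neq[symmetric])
  from monomial_has_limit[OF G mn] show ?thesis
    unfolding has_limit_def
  proof
    assume "\<exists>L\<ge>0. (?m \<longlongrightarrow> L) at_top"
    then obtain L where L: "L \<ge> 0" "(?m \<longlongrightarrow> L) at_top" by auto
    have "(f \<longlongrightarrow> c * L) at_top"
      by (rule Lim_transform_eventually[OF tendsto_mult[OF lim L(2)] eq])
    then show "(\<exists>L\<ge>0. (f \<longlongrightarrow> L) at_top) \<or> filterlim f at_top at_top"
      using c L by (auto intro!: exI[of _ "c * L"])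
  next
    assume "filterlim ?m at_top at_top"
    then have "filterlim (\<lambda>N. f N / ?m N * ?m N) at_top at_top"
      by (rule filterlim_tendsto_pos_mult_at_top[OF lim c])
    then have "filterlim f at_top at_top"
      using eq by (simp cong: filterlim_cong)
    then show "(\<exists>L\<ge>0. (f \<longlongrightarrow> L) at_top) \<or> filterlim f at_top at_top" ..
  qed
qed

text \<open>The second monomial is here at least of the order of the first, so it normalises the
  sum; \<open>f\<close> contributes \<open>c * L\<close>, which is 0 when its order is strictly
  smaller.\<close>

lemma monomial_like_add_aux:
  assumes G: "jump_graph G"
    and f: "((\<lambda>N. f N / monomial G m n N) \<longlongrightarrow> c) at_top" "c > 0"
    and g: "((\<lambda>N. g N / monomial G m' n' N) \<longlongrightarrow> c') at_top" "c' > 0"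
    and L: "((\<lambda>N. monomial G m n N / monomial G m' n' N) \<longlongrightarrow> L) at_top" "L \<ge> 0"
  shows "((\<lambda>N. (f N + g N) / monomial G m' n' N) \<longlongrightarrow> c * L + c') at_top" "c * L + c' > 0"
proof -
  have "((\<lambda>N. f N / monomial G m n N * (monomial G m n N / monomial G m' n' N)
      + g N / monomial G m' n' N) \<longlongrightarrow> c * L + c') at_top"
    by (intro tendsto_intros f g L)
  then show "((\<lambda>N. (f N + g N) / monomial G m' n' N) \<longlongrightarrow> c * L + c') at_top"
    by (rule Lim_transform_eventually)
      (auto intro!: eventually_mono[OF eventually_gt_at_top[of 0]]
        simp: add_divide_distrib monomial_pos[OF G, THEN less_imp_neq, symmetric])
  show "c * L + c' > 0" using f g L by (simp add: add_nonneg_pos)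
qed

text \<open>Addition is the closure property that uses (A): the quotient of the two monomials is
  itself balanced, hence converges or diverges, and this decides which of the two carries the
  sum.\<close>

lemma monomial_like_pos_class:
  assumes G: "jump_graph G" and A: "assumption_A G"
  shows "pos_class {0<..} (monomial_like G)"
proof
  fix f g :: "real \<Rightarrow> real"
  assume f: "f \<in> monomial_like G"
  then obtain c m n where c: "c > 0" and mn: "(\<Sum>e\<in>edges G. m e) = (\<Sum>e\<in>edges G. n e)"
    and lim: "((\<lambda>N. f N / monomial G m n N) \<longlongrightarrow> c) at_top" and f0: "\<And>N. N > 0 \<Longrightarrow> f N > 0"
    by (auto simp: monomial_like_def)
  show "f i > 0" if "i \<in> {0<..}" for i using f0 that by auto
  show "g \<in> monomial_like G" if eq: "\<And>i. i \<in> {0<..} \<Longrightarrow> g i = f i"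
  proof -
    have "((\<lambda>N. g N / monomial G m n N) \<longlongrightarrow> c) at_top"
      using lim by (rule Lim_transform_eventually)
        (auto simp: eq intro!: eventually_mono[OF eventually_gt_at_top[of 0]])
    then show ?thesis using c mn eq f0 by (auto simp: monomial_like_def)
  qed
  assume g: "g \<in> monomial_like G"
  then obtain c' m' n' where c': "c' > 0" and mn': "(\<Sum>e\<in>edges G. m' e) = (\<Sum>e\<in>edges G. n' e)"
    and lim': "((\<lambda>N. g N / monomial G m' n' N) \<longlongrightarrow> c') at_top" and g0: "\<And>N. N > 0 \<Longrightarrow> g N > 0"
    by (auto simp: monomial_like_def)
  have ratio: "monomial G m n N / monomial G m' n' N = monomial G (\<lambda>e. m e + n' e) (\<lambda>e. n e + m' e) N"
    "monomial G m' n' N / monomial G m n N = monomial G (\<lambda>e. m' e + n e) (\<lambda>e. n' e + m e) N" for N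
    by (simp_all add: divide_inverse monomial_inverse monomial_mult)
  have "(\<lambda>N. f N * g N / monomial G (\<lambda>e. m e + m' e) (\<lambda>e. n e + n' e) N) =
      (\<lambda>N. (f N / monomial G m n N) * (g N / monomial G m' n' N))"
    by (simp flip: monomial_mult)
  then have "((\<lambda>N. f N * g N / monomial G (\<lambda>e. m e + m' e) (\<lambda>e. n e + n' e) N) \<longlongrightarrow> c * c') at_top"
    using tendsto_mult[OF lim lim'] by simp
  then show "(\<lambda>N. f N * g N) \<in> monomial_like G"
    using c c' mn mn' f0 g0 by (intro monomial_likeI[of _ "c * c'"]) (simp_all add: sum.distrib)
  have "(\<lambda>N. f N / g N / monomial G (\<lambda>e. m e + n' e) (\<lambda>e. n e + m' e) N) =
      (\<lambda>N. (f N / monomial G m n N) / (g N / monomial G m' n' N))"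
    by (simp add: mult.commute flip: ratio)
  then have "((\<lambda>N. f N / g N / monomial G (\<lambda>e. m e + n' e) (\<lambda>e. n e + m' e) N) \<longlongrightarrow> c / c') at_top"
    using tendsto_divide[OF lim lim'] c' by simp
  then show "(\<lambda>N. f N / g N) \<in> monomial_like G"
    using c c' mn mn' f0 g0 by (intro monomial_likeI[of _ "c / c'"]) (simp_all add: sum.distrib)
  have "has_limit (monomial G (\<lambda>e. m e + n' e) (\<lambda>e. n e + m' e))"
    using mn mn' by (intro monomial_has_limit G A) (simp add: sum.distrib)
  then consider L where "L \<ge> 0" "((\<lambda>N. monomial G m n N / monomial G m' n' N) \<longlongrightarrow> L) at_top"
    | "filterlim (\<lambda>N. monomial G m n N / monomial G m' n' N) at_top at_top"
    by (auto simp: has_limit_def ratio)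
  then show "(\<lambda>N. f N + g N) \<in> monomial_like G"
  proof cases
    case 1
    note aux = monomial_like_add_aux[OF G lim c lim' c' 1(2,1)]
    show ?thesis
      using f0 g0 by (intro monomial_likeI[OF _ aux(2) mn' aux(1)]) (simp add: add_pos_pos)
  next
    case 2
    \<comment> \<open>The first monomial dominates, so \<open>f\<close> and \<open>g\<close>
      exchange roles and the quotient has limit 0.\<close>
    have "((\<lambda>N. inverse (monomial G m n N / monomial G m' n' N)) \<longlongrightarrow> 0) at_top"
      by (rule filterlim_compose[OF tendsto_inverse_0_at_top[OF filterlim_ident] 2])
    then have "((\<lambda>N. monomial G m' n' N / monomial G m n N) \<longlongrightarrow> 0) at_top" by simp
    note aux = monomial_like_add_aux[OF G lim' c' lim c this order.refl]
    have "(\<lambda>N. g N + f N) \<in> monomial_like G"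
      using f0 g0 by (intro monomial_likeI[OF _ aux(2) mn aux(1)]) (simp add: add_pos_pos)
    then show ?thesis by (simp add: add.commute)
  qed
next
  have "((\<lambda>N. 1 / monomial G (\<lambda>_. 0) (\<lambda>_. 0) N) \<longlongrightarrow> 1) at_top"
    by (simp add: monomial_def)
  then show "(\<lambda>i. 1) \<in> monomial_like G"
    by (intro monomial_likeI[of _ 1]) simp_all
qed

lemma rate_ratio_monomial_like:
  assumes G: "jump_graph G" and e: "(x, y) \<in> edges G" "(a, b) \<in> edges G"
  shows "(\<lambda>N. rate G N x y / rate G N a b) \<in> monomial_like G"
proof -
  have fin: "finite (edges G)"
    using G by (auto simp: jump_graph_def intro: finite_subset)
  have prod: "(\<Prod>(x', y')\<in>edges G. rate G N x' y' ^ (if (x', y') = e then 1 else 0)) = rate G N (fst e) (snd e)"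
    if "e \<in> edges G" for e N
  proof -
    have "(\<Prod>(x', y')\<in>edges G. rate G N x' y' ^ (if (x', y') = e then 1 else 0))
        = (\<Prod>e'\<in>edges G. if e' = e then rate G N (fst e) (snd e) else 1)"
      by (intro prod.cong) auto
    also have "\<dots> = rate G N (fst e) (snd e)"
      using fin that by simp
    finally show ?thesis .
  qed
  have sum: "(\<Sum>e'\<in>edges G. if e' = e then 1 else 0) = (1::nat)" if "e \<in> edges G" for e
    using fin that by simp
  let ?m = "\<lambda>e e'. if e' = e then 1 else (0::nat)"
  have "monomial G (?m (x, y)) (?m (a, b)) = (\<lambda>N. rate G N x y / rate G N a b)"
    using prod[OF e(1)] prod[OF e(2)] by (simp add: monomial_def fun_eq_iff)
  moreover have pos: "rate G N x y / rate G N a b > 0" if "N > 0" for N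
    using G e that unfolding jump_graph_def by (intro divide_pos_pos) blast+
  moreover have "((\<lambda>N. f N / f N) \<longlongrightarrow> 1) at_top" if "\<And>N. N > 0 \<Longrightarrow> f N > 0" for f :: "real \<Rightarrow> real"
    using that by (intro tendsto_eventually eventually_mono[OF eventually_gt_at_top[of 0]]) (simp add: less_imp_neq[symmetric])
  ultimately have lim: "((\<lambda>N. rate G N x y / rate G N a b / monomial G (?m (x, y)) (?m (a, b)) N) \<longlongrightarrow> 1) at_top"
    by presburger
  show ?thesis
    by (rule monomial_likeI[OF pos zero_less_one _ lim]) (simp_all only: sum e)
qed

text \<open>A bound excludes the divergent branch of \<open>has_limit\<close>. This is how (A)
  yields real limits of probabilities.\<close>

lemma bounded_monomial_like_tendsto:
  assumes G: "jump_graph G" "assumption_A G" and f: "f \<in> monomial_like G"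
    and bd: "\<And>N. N > 0 \<Longrightarrow> f N \<le> B"
  shows "\<exists>L\<ge>0. (f \<longlongrightarrow> L) at_top"
proof -
  have "\<not> filterlim f at_top at_top"
  proof
    assume "filterlim f at_top at_top"
    then have "\<forall>\<^sub>F N in at_top. f N > B" by (simp add: filterlim_at_top_dense)
    then have "\<forall>\<^sub>F N in at_top. f N > B \<and> N > (0::real)"
      using eventually_gt_at_top eventually_conj by blast
    then have "\<exists>N. f N > B \<and> N > 0" by (rule eventually_happens'[rotated]) simp
    then show False using bd by force
  qed
  with monomial_like_has_limit[OF G f] show ?thesis by (simp add: has_limit_def)
qed

section \<open>First-entry probabilities\<close>

lemma measure_bind_pmf_finite:
  assumes "finite A" "\<And>x. x \<notin> A \<Longrightarrow> pmf p x = 0"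
  shows "measure_pmf.prob (bind_pmf p f) X = (\<Sum>x\<in>A. pmf p x * measure_pmf.prob (f x) X)"
proof -
  have "ennreal (measure_pmf.prob (bind_pmf p f) X) = (\<integral>\<^sup>+x. emeasure (f x) X \<partial>p)"
    by (simp flip: measure_pmf.emeasure_eq_measure)
  also have "\<dots> = (\<Sum>x\<in>A. emeasure (f x) X * pmf p x)"
    using assms by (intro nn_integral_measure_pmf_support) (auto simp: set_pmf_iff)
  also have "\<dots> = ennreal (\<Sum>x\<in>A. pmf p x * measure_pmf.prob (f x) X)"
    by (simp add: measure_pmf.emeasure_eq_measure ennreal_mult' mult.commute flip: sum_ennreal)
  finally show ?thesis
    by (subst (asm) ennreal_inj) (auto intro!: sum_nonneg)
qed

definition out_rate :: "'v wgraph \<Rightarrow> real \<Rightarrow> 'v \<Rightarrow> real" where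
  "out_rate G N z = (\<Sum>w\<in>verts G - {z}. edge_rate G N z w)"

lemma edge_rate_nonneg: "jump_graph G \<Longrightarrow> N > 0 \<Longrightarrow> edge_rate G N x y \<ge> 0"
  using jump_graphD(5)[of G x y N] by (simp add: edge_rate_def less_imp_le)

lemma edge_rate_pos_iff: "jump_graph G \<Longrightarrow> N > 0 \<Longrightarrow> edge_rate G N x y > 0 \<longleftrightarrow> (x, y) \<in> edges G"
  by (auto simp: edge_rate_def jump_graph_def)

lemma out_rate_pos:
  assumes G: "jump_graph G" "N > 0" and z: "z \<in> verts G" "y \<in> verts G" "y \<noteq> z"
  shows "out_rate G N z > 0"
proof -
  have "(z, y) \<in> (edges G - Id)\<^sup>*"
    using G z by (simp add: jump_graph_def rtrancl_r_diff_Id)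
  then obtain w where w: "(z, w) \<in> edges G" "w \<noteq> z"
    using z(3) by (auto elim: converse_rtranclE)
  then have "w \<in> verts G - {z}" using G by (auto simp: jump_graph_def)
  then show ?thesis
    unfolding out_rate_def using G w(1)
    by (intro sum_pos2[of _ w]) (auto simp: edge_rate_nonneg edge_rate_pos_iff jump_graph_def)
qed

text \<open>\<open>embed_pmf\<close> is meaningful only for weights of total mass 1, which is where
  the positive exit rate enters; the vertex of a one-vertex graph has exit rate 0.\<close>

lemma pmf_jump_pmf:
  assumes G: "jump_graph G" "N > 0" and z: "out_rate G N z > 0"
  shows "pmf (jump_pmf G N z) w = (if w \<in> verts G - {z} then edge_rate G N z w / out_rate G N z else 0)"
proof -
  let ?f = "\<lambda>w. if w \<in> verts G - {z} then edge_rate G N z w / out_rate G N z else 0"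
  have fin: "finite (verts G)" using G by (simp add: jump_graph_def)
  have "(\<Sum>w | (z, w) \<in> edges G \<and> w \<noteq> z. rate G N z w) = out_rate G N z"
    unfolding out_rate_def using G
    by (intro sum.mono_neutral_cong_left) (auto simp: edge_rate_def jump_graph_def)
  then have eq: "jump_pmf G N z = embed_pmf ?f"
    unfolding jump_pmf_def using G
    by (intro arg_cong[where f = embed_pmf]) (auto simp: fun_eq_iff edge_rate_def jump_graph_def)
  have "(\<integral>\<^sup>+w. ennreal (?f w) \<partial>count_space UNIV) = (\<Sum>w\<in>verts G - {z}. ennreal (?f w))"
    using fin by (intro nn_integral_count_space') auto
  also have "\<dots> = ennreal (\<Sum>w\<in>verts G - {z}. edge_rate G N z w / out_rate G N z)"
    using z G by (subst sum_ennreal[symmetric]) (auto intro!: sum.cong simp: edge_rate_nonneg)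
  also have "(\<Sum>w\<in>verts G - {z}. edge_rate G N z w / out_rate G N z) = 1"
    using z by (simp add: out_rate_def flip: sum_divide_distrib)
  finally have "(\<integral>\<^sup>+w. ennreal (?f w) \<partial>count_space UNIV) = 1" by simp
  then show ?thesis
    unfolding eq using z G by (subst pmf_embed_pmf) (auto simp: edge_rate_nonneg)
qed

text \<open>Named so that first-step analysis can be done on the summands of
  \<open>first_entry_prob\<close> before the series is known to converge.\<close>

definition entry_at :: "'v wgraph \<Rightarrow> real \<Rightarrow> 'v set \<Rightarrow> 'v \<Rightarrow> nat \<Rightarrow> 'v \<Rightarrow> real" where
  "entry_at G N A y n z = measure_pmf.prob (trajectory G N n z)
     {xs. (\<forall>i<n. xs ! i \<notin> A) \<and> xs ! n \<in> A \<and> xs ! n = y}"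

lemma entry_at_0: "entry_at G N A y 0 z = (if z \<in> A \<and> z = y then 1 else 0)"
  by (auto simp: entry_at_def indicator_def)

lemma entry_at_Suc:
  assumes G: "jump_graph G" "N > 0" and z: "out_rate G N z > 0"
  shows "entry_at G N A y (Suc n) z = (if z \<in> A then 0 else
    (\<Sum>w\<in>verts G - {z}. edge_rate G N z w * entry_at G N A y n w) / out_rate G N z)"
proof -
  let ?X = "\<lambda>n. {xs. (\<forall>i<n. xs ! i \<notin> A) \<and> xs ! n \<in> A \<and> xs ! n = y}"
  \<comment> \<open>Prepending \<open>z\<close> shifts all positions by one, and position 0 then
    tests \<open>z\<close> itself, so the event becomes empty for \<open>z\<close> in
    \<open>A\<close>.\<close>
  have X: "(#) z -` ?X (Suc n) = (if z \<in> A then {} else ?X n)"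
    by (auto simp: less_Suc_eq_0_disj all_conj_distrib)
  have "entry_at G N A y (Suc n) z = (\<Sum>w\<in>verts G - {z}.
      edge_rate G N z w / out_rate G N z * measure_pmf.prob (map_pmf ((#) z) (trajectory G N n w)) (?X (Suc n)))"
    unfolding entry_at_def trajectory.simps
    using G by (subst measure_bind_pmf_finite[where A = "verts G - {z}"])
      (auto simp: pmf_jump_pmf[OF G z] jump_graph_def intro!: sum.cong)
  also have "\<dots> = (if z \<in> A then 0 else
    (\<Sum>w\<in>verts G - {z}. edge_rate G N z w * entry_at G N A y n w) / out_rate G N z)"
    unfolding measure_map_pmf X by (simp add: entry_at_def sum_divide_distrib)
  finally show ?thesis .
qed

text \<open>First-step analysis turns the series into a Dirichlet problem whose boundary values are
  the indicator of \<open>y\<close>; elimination and uniqueness apply to it.\<close>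

lemma first_entry_prob_system:
  assumes G: "jump_graph G" "N > 0" and A: "A \<subseteq> verts G" "A \<noteq> {}"
  shows first_entry_prob_nonneg: "z \<in> verts G \<Longrightarrow> first_entry_prob G N A z y \<ge> 0"
    and first_entry_prob_base: "z \<in> A \<Longrightarrow> first_entry_prob G N A z y = (if z = y then 1 else 0)"
    and first_entry_prob_step: "z \<in> verts G - A \<Longrightarrow>
      first_entry_prob G N A z y * out_rate G N z =
      (\<Sum>w\<in>verts G - {z}. edge_rate G N z w * first_entry_prob G N A w y)"
proof -
  let ?V = "verts G"
  let ?q = "entry_at G N A y"
  \<comment> \<open>A vertex outside the nonempty set \<open>A\<close> is not the only vertex, so
    its exit rate is positive.\<close>
  have D: "out_rate G N z > 0" if "z \<in> ?V" "z \<notin> A" for z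
    using A that out_rate_pos[OF G that(1)] by (metis all_not_in_conv subsetD)
  \<comment> \<open>Read off from the support of the trajectory, which starts at \<open>z\<close>:
    \<open>entry_at_Suc\<close> needs a positive exit rate, and that of a vertex of \<open>A\<close>
    may be 0.\<close>
  have in_A: "?q (Suc n) z = 0" if "z \<in> A" for n z
  proof -
    have "{xs. (\<forall>i<Suc n. xs ! i \<notin> A) \<and> xs ! Suc n \<in> A \<and> xs ! Suc n = y} \<inter>
        set_pmf (trajectory G N (Suc n) z) = {}"
      using that by (auto simp: set_bind_pmf)
    then show ?thesis
      unfolding entry_at_def by (metis (no_types, lifting) measure_Int_set_pmf measure_empty)
  qed
  have step: "?q (Suc n) z = (\<Sum>w\<in>?V - {z}. edge_rate G N z w * ?q n w) / out_rate G N z"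
    if "z \<in> ?V" "z \<notin> A" for z n
    using entry_at_Suc[OF G D[OF that]] that by simp
  have nonneg: "?q n z \<ge> 0" for n z by (simp add: entry_at_def)
  \<comment> \<open>The bound that gives convergence comes from the same recursion: a partial sum is
    an average, over one jump, of shorter partial sums.\<close>
  have partial: "(\<Sum>i<n. ?q i z) \<le> 1" if "z \<in> ?V" for n z
    using that
  proof (induction n arbitrary: z)
    case 0
    then show ?case by simp
  next
    case (Suc n)
    show ?case
    proof (cases "z \<in> A")
      case True
      then show ?thesis
        by (simp only: sum.lessThan_Suc_shift in_A[OF True]) (simp add: entry_at_0)
    next
      case False
      have "(\<Sum>i<Suc n. ?q i z) = (\<Sum>i<n. (\<Sum>w\<in>?V - {z}. edge_rate G N z w * ?q i w)) / out_rate G N z"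
        using False Suc.prems step
        by (simp add: sum.lessThan_Suc_shift entry_at_0 sum_divide_distrib del: sum.lessThan_Suc)
      also have "\<dots> = (\<Sum>w\<in>?V - {z}. edge_rate G N z w * (\<Sum>i<n. ?q i w)) / out_rate G N z"
        by (subst sum.swap) (simp add: sum_distrib_left)
      also have "\<dots> \<le> (\<Sum>w\<in>?V - {z}. edge_rate G N z w * 1) / out_rate G N z"
        using D[OF Suc.prems False] G
        by (intro divide_right_mono sum_mono mult_left_mono Suc.IH) (auto simp: edge_rate_nonneg)
      also have "\<dots> = 1" using D[OF Suc.prems False] by (simp add: out_rate_def)
      finally show ?thesis .
    qed
  qed
  have summable: "summable (\<lambda>n. ?q n z)" if "z \<in> ?V" for z
    by (rule summableI_nonneg_bounded[OF nonneg partial[OF that]])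
  have F: "first_entry_prob G N A z y = (\<Sum>n. ?q n z)" for z
    by (simp add: first_entry_prob_def entry_at_def)
  show "first_entry_prob G N A z y \<ge> 0" if "z \<in> ?V"
    unfolding F by (rule suminf_nonneg[OF summable[OF that] nonneg])
  have split: "(\<Sum>n. ?q n z) = ?q 0 z + (\<Sum>n. ?q (Suc n) z)" if "z \<in> ?V" for z
    using suminf_split_head[OF summable[OF that]] by simp
  show "first_entry_prob G N A z y = (if z = y then 1 else 0)" if "z \<in> A"
    using split[of z] A that in_A by (auto simp: F entry_at_0)
  show "first_entry_prob G N A z y * out_rate G N z =
      (\<Sum>w\<in>verts G - {z}. edge_rate G N z w * first_entry_prob G N A w y)" if z: "z \<in> ?V - A"
  proof -
    have "(\<lambda>n. edge_rate G N z w * ?q n w) sums (edge_rate G N z w * (\<Sum>n. ?q n w))" if "w \<in> ?V" for w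
      by (intro sums_mult summable_sums summable that)
    then have "(\<lambda>n. (\<Sum>w\<in>?V - {z}. edge_rate G N z w * ?q n w) / out_rate G N z) sums
        ((\<Sum>w\<in>?V - {z}. edge_rate G N z w * (\<Sum>n. ?q n w)) / out_rate G N z)"
      by (intro sums_divide sums_sum) auto
    then have "(\<Sum>n. ?q (Suc n) z) = (\<Sum>w\<in>?V - {z}. edge_rate G N z w * (\<Sum>n. ?q n w)) / out_rate G N z"
      using z by (simp add: step sums_unique[symmetric])
    then show ?thesis
      using split[of z] z D[of z] by (simp add: F entry_at_0)
  qed
qed

text \<open>Entry into \<open>A\<close> is almost sure because the total entry probability and the
  constant 1 solve the same Dirichlet problem.\<close>

lemma sum_first_entry_prob:
  assumes G: "jump_graph G" "N > 0" and A: "A \<subseteq> verts G" "A \<noteq> {}" and z: "z \<in> verts G"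
  shows "(\<Sum>y\<in>A. first_entry_prob G N A z y) = 1"
proof (rule dirichlet_unique[where V = "verts G" and A = A and r = "edge_rate G N" and E = "edges G"
      and k = "\<lambda>_. 1" and h = "\<lambda>z. \<Sum>y\<in>A. first_entry_prob G N A z y"])
  have "finite A" using A G by (auto simp: jump_graph_def intro: finite_subset)
  then show "(\<Sum>y\<in>A. first_entry_prob G N A x y) = 1" if "x \<in> A" for x
    using that by (simp add: first_entry_prob_base[OF G A])
  show "(\<Sum>y\<in>A. first_entry_prob G N A x y) * (\<Sum>w\<in>verts G - {x}. edge_rate G N x w) =
      (\<Sum>w\<in>verts G - {x}. edge_rate G N x w * (\<Sum>y\<in>A. first_entry_prob G N A w y))"
    if "x \<in> verts G - A" for x
  proof -
    have "(\<Sum>y\<in>A. first_entry_prob G N A x y) * (\<Sum>w\<in>verts G - {x}. edge_rate G N x w) =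
        (\<Sum>y\<in>A. \<Sum>w\<in>verts G - {x}. edge_rate G N x w * first_entry_prob G N A w y)"
      using first_entry_prob_step[OF G A that] by (simp add: sum_distrib_right out_rate_def)
    also have "\<dots> = (\<Sum>w\<in>verts G - {x}. edge_rate G N x w * (\<Sum>y\<in>A. first_entry_prob G N A w y))"
      by (subst sum.swap) (simp add: sum_distrib_left)
    finally show ?thesis .
  qed
qed (use G A z jump_graphD[OF G(1)] in \<open>auto simp: edge_rate_nonneg edge_rate_pos_iff\<close>)

lemma first_entry_prob_le_1:
  assumes G: "jump_graph G" "N > 0" and A: "A \<subseteq> verts G" "A \<noteq> {}" and z: "z \<in> verts G" "y \<in> A"
  shows "first_entry_prob G N A z y \<le> 1"
proof -
  have "finite A" using A G by (auto simp: jump_graph_def intro: finite_subset)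
  then have "first_entry_prob G N A z y \<le> (\<Sum>y\<in>A. first_entry_prob G N A z y)"
    using z first_entry_prob_nonneg[OF G A] by (intro member_le_sum) auto
  then show ?thesis using sum_first_entry_prob[OF assms(1-5)] by simp
qed

text \<open>By uniqueness the infinite series equals the solution found by elimination, which is a
  subtraction-free expression in the rates. The scale \<open>\<rho>\<close> cancels from the
  harmonic equation.\<close>

lemma first_entry_prob_Kz:
  assumes K: "pos_class {0<..} K" and G: "jump_graph G"
    and \<rho>: "\<And>N. N > 0 \<Longrightarrow> \<rho> N > 0"
    and edge: "\<And>x y. (x, y) \<in> edges G \<Longrightarrow> (\<lambda>N. rate G N x y / \<rho> N) \<in> K"
    and A: "A \<subseteq> verts G" "A \<noteq> {}" and z: "z \<in> verts G"
  shows "(\<lambda>N. first_entry_prob G N A z y) \<in> pos_class.Kz {0<..} K"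
proof -
  interpret pos_class "{0<..}" K by fact
  let ?V = "verts G" and ?r = "\<lambda>x y N. edge_rate G N x y / \<rho> N"
  have V: "A \<union> (?V - A) = ?V" using A by auto
  have g: "(\<lambda>N. if x = y then 1 else 0) \<in> Kz" for x
    by (cases "x = y") (auto intro: KzI one)
  have "finite (?V - A)" using jump_graphD(1)[OF G] by simp
  moreover have "irred (A \<union> (?V - A)) ?r"
    unfolding V by (rule edge_rate_irred(1)[OF K G edge])
  ultimately have "\<exists>h. (\<forall>x\<in>A \<union> (?V - A). h x \<in> Kz) \<and> (\<forall>x\<in>A. h x = (\<lambda>N. if x = y then 1 else 0)) \<and>
      (\<forall>N\<in>{0<..}. \<forall>b\<in>?V - A. h b N * exit_rate (A \<union> (?V - A)) ?r b N =
        (\<Sum>w\<in>A \<union> (?V - A)-{b}. ?r b w N * h w N))"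
    using A(2) g by (intro dirichlet_exists_Kz) auto
  then obtain h where "(\<forall>x\<in>?V. h x \<in> Kz) \<and> (\<forall>x\<in>A. h x = (\<lambda>N. if x = y then 1 else 0)) \<and>
      (\<forall>N\<in>{0<..}. \<forall>b\<in>?V - A. h b N * exit_rate ?V ?r b N = (\<Sum>w\<in>?V-{b}. ?r b w N * h w N))"
    unfolding V ..
  then have h: "x \<in> ?V \<Longrightarrow> h x \<in> Kz" "x \<in> A \<Longrightarrow> h x = (\<lambda>N. if x = y then 1 else 0)"
    "N > 0 \<Longrightarrow> x \<in> ?V - A \<Longrightarrow>
      h x N * exit_rate ?V ?r x N = (\<Sum>w\<in>?V-{x}. ?r x w N * h w N)" for x N
    unfolding Ball_def greaterThan_iff by blast+
  have "first_entry_prob G N A z y = h z N" if N: "N > 0" for N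
  proof (rule dirichlet_unique[where V = ?V and A = A and r = "edge_rate G N" and E = "edges G"])
    show "first_entry_prob G N A x y = h x N" if "x \<in> A" for x
      using first_entry_prob_base[OF G N A that] h(2)[OF that] by simp
    show "first_entry_prob G N A x y * (\<Sum>w\<in>?V - {x}. edge_rate G N x w) =
      (\<Sum>w\<in>?V - {x}. edge_rate G N x w * first_entry_prob G N A w y)" if "x \<in> ?V - A" for x
      using first_entry_prob_step[OF G N A that] by (simp add: out_rate_def)
    show "h x N * (\<Sum>w\<in>?V - {x}. edge_rate G N x w) = (\<Sum>w\<in>?V - {x}. edge_rate G N x w * h w N)"
      if "x \<in> ?V - A" for x
      using h(3)[OF N that] \<rho>[OF N] by (simp add: exit_rate_def flip: sum_divide_distrib)
  qed (use G N A z jump_graphD[OF G] in \<open>auto simp: edge_rate_nonneg edge_rate_pos_iff\<close>)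
  then show ?thesis using Kz_cong[OF h(1)[OF z]] by simp
qed

section \<open>Minimal fast classes\<close>

text \<open>Serves the limiting fast chain, whose rates no longer depend on N: a fixed rate matrix
  is read as a constant function in \<open>all_pos\<close>.\<close>

lemma stationary_ex1:
  fixes r :: "'v \<Rightarrow> 'v \<Rightarrow> real"
  assumes fin: "finite V" "V \<noteq> {}"
    and E: "\<And>x y. (x, y) \<in> E \<Longrightarrow> x \<in> V \<and> y \<in> V \<and> r x y > 0"
    and nonneg: "\<And>x y. x \<in> V \<Longrightarrow> y \<in> V \<Longrightarrow> r x y \<ge> 0"
    and sc: "\<And>x y. x \<in> V \<Longrightarrow> y \<in> V \<Longrightarrow> (x, y) \<in> E\<^sup>*"
  obtains u where "\<And>x. x \<in> V \<Longrightarrow> u x > 0"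
    "\<And>v x. (\<Sum>x\<in>V. v x) = 1 \<Longrightarrow>
      (\<And>y. y \<in> V \<Longrightarrow> (\<Sum>x\<in>V. v x * r x y) = v y * (\<Sum>z\<in>V. r y z)) \<Longrightarrow> x \<in> V \<Longrightarrow> v x = u x"
proof -
  let ?r = "\<lambda>x y (N::real). r x y"
  have "?r x y \<in> all_pos.Kz" if "x \<in> V" "y \<in> V" for x y
    using nonneg[OF that] by (auto simp: all_pos.Kz_def order.order_iff_strict)
  then have "all_pos.irred V ?r"
    using fin E sc by (intro all_pos.irredI[of V E]) auto
  then have "\<exists>u. (\<forall>x\<in>V. u x \<in> {f. \<forall>N::real>0. (f N :: real) > 0}) \<and> (\<forall>i\<in>{0<..}. (\<Sum>x\<in>V. u x i) = 1 \<and>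
    (\<forall>y\<in>V. (\<Sum>x\<in>V. u x i * ?r x y i) = u y i * (\<Sum>z\<in>V. ?r y z i)))"
    using fin(2) by (rule all_pos.invariant_prob_exists_K)
  then obtain u where "(\<forall>x\<in>V. u x \<in> {f. \<forall>N::real>0. (f N :: real) > 0}) \<and>
    (\<forall>i\<in>{0<..}. (\<Sum>x\<in>V. u x i) = 1 \<and>
      (\<forall>y\<in>V. (\<Sum>x\<in>V. u x i * ?r x y i) = u y i * (\<Sum>z\<in>V. ?r y z i)))" ..
  \<comment> \<open>The index is a dummy; 1 stands for any positive value.\<close>
  then have u: "\<And>x. x \<in> V \<Longrightarrow> u x 1 > 0" "(\<Sum>x\<in>V. u x 1) = 1"
    "\<And>y. y \<in> V \<Longrightarrow> (\<Sum>x\<in>V. u x 1 * r x y) = u y 1 * (\<Sum>z\<in>V. r y z)"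
    by auto
  show ?thesis
    by (rule that[of "\<lambda>x. u x 1"], rule u(1), assumption,
        rule invariant_unique[where V = V and E = E and r = r and u = "\<lambda>x. u x 1"])
      (use fin E nonneg sc u in blast)+
qed

lemma fast_edges_subset: "fast_edges G \<subseteq> edges G"
  by (auto simp: fast_edges_def)

lemma fast_class_eq:
  assumes "M \<in> fast_classes G" "x \<in> M"
  shows "M = {y \<in> verts G. (x, y) \<in> (fast_edges G)\<^sup>* \<and> (y, x) \<in> (fast_edges G)\<^sup>*}"
  using assms unfolding fast_classes_def quotient_def by (auto intro: rtrancl_trans)

lemma fast_class_of:
  assumes "x \<in> verts G"
  shows "{y \<in> verts G. (x, y) \<in> (fast_edges G)\<^sup>* \<and> (y, x) \<in> (fast_edges G)\<^sup>*} \<in> fast_classes G"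
proof -
  have "{y \<in> verts G. (x, y) \<in> (fast_edges G)\<^sup>* \<and> (y, x) \<in> (fast_edges G)\<^sup>*} =
    {(x, y) \<in> verts G \<times> verts G. (x, y) \<in> (fast_edges G)\<^sup>* \<and> (y, x) \<in> (fast_edges G)\<^sup>*} `` {x}"
    using assms by auto
  then show ?thesis unfolding fast_classes_def using assms by (simp only: quotientI)
qed

lemma fast_class_subset: "M \<in> fast_classes G \<Longrightarrow> M \<subseteq> verts G"
  unfolding fast_classes_def quotient_def by auto

lemma fast_class_nonempty: "M \<in> fast_classes G \<Longrightarrow> M \<noteq> {}"
  unfolding fast_classes_def quotient_def by auto

lemma fast_class_disjoint:
  "M \<in> fast_classes G \<Longrightarrow> M' \<in> fast_classes G \<Longrightarrow> x \<in> M \<Longrightarrow> x \<in> M' \<Longrightarrow> M = M'"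
  using fast_class_eq[of M G x] fast_class_eq[of M' G x] by simp

lemma minimal_classD:
  assumes "M \<in> minimal_classes G"
  shows "M \<in> fast_classes G" "M \<subseteq> verts G" "M \<noteq> {}"
  using assms fast_class_subset[of M G] fast_class_nonempty[of M G] by (auto simp: minimal_classes_def)

lemma minimal_class_disjoint:
  "M \<in> minimal_classes G \<Longrightarrow> M' \<in> minimal_classes G \<Longrightarrow> x \<in> M \<Longrightarrow> x \<in> M' \<Longrightarrow> M = M'"
  using fast_class_disjoint minimal_classD(1) by metis

lemma hat_verts_subset: "hat_verts G \<subseteq> verts G"
  using minimal_classD(2) by (auto simp: hat_verts_def)

lemma minimal_class_closed:
  assumes "jump_graph G" "M \<in> minimal_classes G" "x \<in> M" "(x, y) \<in> fast_edges G"
  shows "y \<in> M"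
  using assms jump_graphD(3)[of G] fast_edges_subset[of G] by (auto simp: minimal_classes_def)

lemma hat_verts_closed:
  "jump_graph G \<Longrightarrow> x \<in> hat_verts G \<Longrightarrow> (x, y) \<in> fast_edges G \<Longrightarrow> y \<in> hat_verts G"
  using minimal_class_closed by (fastforce simp: hat_verts_def)

text \<open>Mutual reachability is defined by paths in the whole graph; minimality keeps such paths
  inside \<open>M\<close>, so the chain on \<open>M\<close> alone is irreducible.\<close>

lemma minimal_class_path:
  assumes "jump_graph G" "M \<in> minimal_classes G" "x \<in> M" "y \<in> M"
  shows "(x, y) \<in> (fast_edges G \<inter> M \<times> M)\<^sup>*"
proof -
  have "(x, y) \<in> (fast_edges G)\<^sup>*"
    using fast_class_eq[OF minimal_classD(1)[OF assms(2)] assms(3)] assms(4) by auto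
  then have "y \<in> M \<and> (x, y) \<in> (fast_edges G \<inter> M \<times> M)\<^sup>*"
  proof (induction rule: rtrancl_induct)
    case base
    then show ?case using assms by simp
  next
    case (step y z)
    then have "z \<in> M" using minimal_class_closed[OF assms(1,2)] by auto
    then show ?case using step by (auto intro: rtrancl.rtrancl_into_rtrancl)
  qed
  then show ?thesis ..
qed

text \<open>Among the vertices reachable from \<open>x\<close>, one with the fewest reachable vertices lies in
  a minimal class.\<close>

lemma reaches_minimal_class:
  assumes G: "jump_graph G" and x: "x \<in> verts G"
  obtains y where "(x, y) \<in> (fast_edges G)\<^sup>*" "y \<in> hat_verts G"
proof -
  let ?F = "fast_edges G"
  have V: "z \<in> verts G" if "(y, z) \<in> ?F\<^sup>*" "y \<in> verts G" for y z
    using that jump_graphD(3)[OF G] fast_edges_subset[of G] by (induction rule: rtrancl_induct) auto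
  define R where "R y = {z. (y, z) \<in> ?F\<^sup>*}" for y
  have fin: "finite (R y)" if "y \<in> verts G" for y
    using V that jump_graphD(1)[OF G] by (auto simp: R_def intro: finite_subset[of _ "verts G"])
  obtain y where y: "y \<in> R x" "\<And>z. z \<in> R x \<Longrightarrow> card (R y) \<le> card (R z)"
    using ex_has_least_nat[of "\<lambda>y. y \<in> R x" x "\<lambda>y. card (R y)"] by (auto simp: R_def)
  have yV: "y \<in> verts G" using y(1) V x by (auto simp: R_def)
  have returns: "(z, y) \<in> ?F\<^sup>*" if "(y, z) \<in> ?F\<^sup>*" for z
  proof -
    have sub: "R z \<subseteq> R y" using that by (auto simp: R_def)
    have "z \<in> R x" using y(1) that by (auto simp: R_def)
    then have "R z = R y"
      using card_seteq[OF fin[OF yV] sub] y(2) by simp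
    then show ?thesis by (auto simp: R_def)
  qed
  let ?M = "{z \<in> verts G. (y, z) \<in> ?F\<^sup>* \<and> (z, y) \<in> ?F\<^sup>*}"
  have "?M \<in> minimal_classes G"
    unfolding minimal_classes_def
    using fast_class_of[OF yV] returns by (auto intro: rtrancl.rtrancl_into_rtrancl)
  moreover have "y \<in> ?M" using yV by simp
  ultimately have "y \<in> hat_verts G" unfolding hat_verts_def by (rule UnionI)
  then show ?thesis using that[of y] y(1) by (simp add: R_def)
qed

lemma hat_verts_nonempty:
  assumes "jump_graph G" shows "hat_verts G \<noteq> {}"
  using reaches_minimal_class[OF assms] jump_graphD(2)[OF assms] by blast

lemma class_graph_jump_graph:
  assumes "jump_graph G" "M \<in> minimal_classes G"
  shows "jump_graph (class_graph G M)"
proof -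
  have "finite M" using minimal_classD(2)[OF assms(2)] jump_graphD(1)[OF assms(1)] finite_subset by blast
  moreover have "rate G N x y > 0" if "N > 0" "(x, y) \<in> fast_edges G" for N x y
    using jump_graphD(5)[OF assms(1)] fast_edges_subset[of G] that by auto
  ultimately show ?thesis
    using minimal_classD(3)[OF assms(2)] minimal_class_path[OF assms]
    by (auto simp: jump_graph_def class_graph_def)
qed

section \<open>The fast time scale\<close>

text \<open>\<open>\<rho>\<close> plays the part of a fastest rate. It is a function and not a
  chosen edge so that a single vertex without edges is covered too.\<close>

locale scaled_graph =
  fixes G :: "'v wgraph" and \<rho> :: "real \<Rightarrow> real"
  assumes weighted: "weighted_graph G" and A: "assumption_A G"
    and \<rho>_pos: "\<And>N. N > 0 \<Longrightarrow> \<rho> N > 0"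
    and edge_K: "\<And>x y. (x, y) \<in> edges G \<Longrightarrow> (\<lambda>N. rate G N x y / \<rho> N) \<in> monomial_like G"
    and edge_lim: "\<And>x y. (x, y) \<in> edges G \<Longrightarrow> \<exists>L\<ge>0. ((\<lambda>N. rate G N x y / \<rho> N) \<longlongrightarrow> L) at_top \<and>
      (L > 0 \<longleftrightarrow> (x, y) \<in> fast_edges G)"

text \<open>By (A) the growth orders of the rates form a total preorder: if a quotient of two rates
  diverges, its inverse tends to 0. A finite nonempty set of edges has a greatest element for
  it.\<close>

lemma fastest_edge_exists:
  assumes G: "jump_graph G" "assumption_A G" and "edges G \<noteq> {}"
  obtains a b where "(a, b) \<in> edges G"
    "\<And>x y. (x, y) \<in> edges G \<Longrightarrow> \<exists>L\<ge>0. ((\<lambda>N. rate G N x y / rate G N a b) \<longlongrightarrow> L) at_top"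
proof -
  let ?le = "\<lambda>e f. \<exists>L\<ge>0. ((\<lambda>N. rate G N (fst e) (snd e) / rate G N (fst f) (snd f)) \<longlongrightarrow> L) at_top"
  have pos: "rate G N (fst e) (snd e) > 0" if "e \<in> edges G" "N > 0" for e N
    using jump_graphD(5)[OF G(1), of "fst e" "snd e"] that by simp
  have total: "?le e f \<or> (?le f e \<and> ((\<lambda>N. rate G N (fst f) (snd f) / rate G N (fst e) (snd e)) \<longlongrightarrow> 0) at_top)"
    if "e \<in> edges G" "f \<in> edges G" for e f
  proof -
    have "has_limit (\<lambda>N. rate G N (fst e) (snd e) / rate G N (fst f) (snd f))"
      using that by (intro monomial_like_has_limit[OF G] rate_ratio_monomial_like[OF G(1)]) auto
    then show ?thesis
    proof (unfold has_limit_def, elim disjE)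
      assume "filterlim (\<lambda>N. rate G N (fst e) (snd e) / rate G N (fst f) (snd f)) at_top at_top"
      then have "((\<lambda>N. inverse (rate G N (fst e) (snd e) / rate G N (fst f) (snd f))) \<longlongrightarrow> 0) at_top"
        by (rule filterlim_compose[OF tendsto_inverse_0_at_top[OF filterlim_ident]])
      then show ?thesis by auto
    qed auto
  qed
  have trans: "?le d f" if "?le d e" "?le e f" "e \<in> edges G" for d e f
  proof -
    obtain L L' where L: "L \<ge> 0" "((\<lambda>N. rate G N (fst d) (snd d) / rate G N (fst e) (snd e)) \<longlongrightarrow> L) at_top"
      "L' \<ge> 0" "((\<lambda>N. rate G N (fst e) (snd e) / rate G N (fst f) (snd f)) \<longlongrightarrow> L') at_top"
      using \<open>?le d e\<close> \<open>?le e f\<close> by auto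
    have "((\<lambda>N. rate G N (fst d) (snd d) / rate G N (fst f) (snd f)) \<longlongrightarrow> L * L') at_top"
      using tendsto_mult[OF L(2,4)]
      by (rule Lim_transform_eventually)
        (use pos[OF \<open>e \<in> edges G\<close>] in \<open>auto intro!: eventually_mono[OF eventually_gt_at_top[of 0]] simp: less_imp_neq[symmetric]\<close>)
    then show ?thesis using L by (auto intro!: exI[of _ "L * L'"])
  qed
  have refl: "?le e e" if "e \<in> edges G" for e using total[OF that that] by auto
  have fin: "finite (edges G)" using finite_subset[OF jump_graphD(3)[OF G(1)]] jump_graphD(1)[OF G(1)] by blast
  have "\<exists>f\<in>S. \<forall>e\<in>S. ?le e f" if "S \<subseteq> edges G" "S \<noteq> {}" "finite S" for S
    using that(3,2,1)
  proof (induction S rule: finite_ne_induct)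
    case (singleton e)
    then show ?case using refl by auto
  next
    case (insert e S)
    then obtain f where f: "f \<in> S" "\<forall>e\<in>S. ?le e f" by auto
    show ?case
    proof (cases "?le e f")
      case True
      then show ?thesis using f by blast
    next
      case False
      then have "?le f e" using total[of e f] insert f by auto
      then have "\<forall>d\<in>insert e S. ?le d e" using f insert trans refl by blast
      then show ?thesis by blast
    qed
  qed
  from this[OF order.refl assms(3)] fin
  obtain f where "f \<in> edges G" "\<forall>e\<in>edges G. ?le e f" by blast
  then show ?thesis using that[of "fst f" "snd f"] by force
qed

lemma scaled_graph_exists:
  assumes "weighted_graph G" "assumption_A G"
  shows "\<exists>\<rho>. scaled_graph G \<rho>"
proof (cases "edges G = {}")
  case True
  then have "scaled_graph G (\<lambda>_. 1)" using assms by unfold_locales auto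
  then show ?thesis by blast
next
  case False
  note G = weighted_graph_jump_graph[OF assms(1)] assms(2)
  obtain a b where ab: "(a, b) \<in> edges G"
    and fastest: "\<And>x y. (x, y) \<in> edges G \<Longrightarrow> \<exists>L\<ge>0. ((\<lambda>N. rate G N x y / rate G N a b) \<longlongrightarrow> L) at_top"
    using fastest_edge_exists[OF G False] by blast
  have pos: "rate G N x y > 0" if "(x, y) \<in> edges G" "N > 0" for N x y
    using jump_graphD(5)[OF G(1) that] .
  have ev: "\<forall>\<^sub>F N in at_top. rate G N x y \<noteq> 0" if "(x, y) \<in> edges G" for x y
    by (rule eventually_mono[OF eventually_gt_at_top[of 0]]) (use pos[OF that] in force)
  have "\<exists>L\<ge>0. ((\<lambda>N. rate G N x y / rate G N a b) \<longlongrightarrow> L) at_top \<and> (L > 0 \<longleftrightarrow> (x, y) \<in> fast_edges G)"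
    if xy: "(x, y) \<in> edges G" for x y
  proof -
    obtain L where L: "L \<ge> 0" "((\<lambda>N. rate G N x y / rate G N a b) \<longlongrightarrow> L) at_top"
      using fastest[OF xy] by blast
    have "(x, y) \<in> fast_edges G" if "L > 0"
    proof -
      have "\<exists>K. ((\<lambda>N. rate G N x' y' / rate G N x y) \<longlongrightarrow> K) at_top" if xy': "(x', y') \<in> edges G" for x' y'
      proof -
        obtain L' where L': "((\<lambda>N. rate G N x' y' / rate G N a b) \<longlongrightarrow> L') at_top"
          using fastest[OF xy'] by blast
        have "((\<lambda>N. rate G N x' y' / rate G N x y) \<longlongrightarrow> L' / L) at_top"
          by (rule Lim_transform_eventually[OF tendsto_divide[OF L' L(2)]])
            (use \<open>L > 0\<close> ev[OF ab] in \<open>auto elim: eventually_mono\<close>)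
        then show ?thesis by blast
      qed
      then show ?thesis using xy by (auto simp: fast_edges_def)
    qed
    moreover have "L > 0" if fast: "(x, y) \<in> fast_edges G"
    proof (rule ccontr)
      assume "\<not> L > 0"
      then have "((\<lambda>N. rate G N x y / rate G N a b) \<longlongrightarrow> 0) at_top" using L by simp
      moreover obtain K where "((\<lambda>N. rate G N a b / rate G N x y) \<longlongrightarrow> K) at_top"
        using fast ab by (auto simp: fast_edges_def)
      \<comment> \<open>The product of the two quotients is eventually 1, while its limit would be
        \<open>0 * K\<close>.\<close>
      ultimately have "((\<lambda>N. rate G N x y / rate G N a b * (rate G N a b / rate G N x y)) \<longlongrightarrow> 0 * K) at_top"
        by (rule tendsto_mult)
      moreover have "((\<lambda>N. rate G N x y / rate G N a b * (rate G N a b / rate G N x y)) \<longlongrightarrow> 1) at_top"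
        by (rule tendsto_eventually) (use eventually_conj[OF ev[OF ab] ev[OF xy]] in \<open>auto elim!: eventually_mono\<close>)
      ultimately have "0 * K = 1" by (rule tendsto_unique[OF trivial_limit_at_top_linorder])
      then show False by simp
    qed
    ultimately show ?thesis using L by blast
  qed
  then have "scaled_graph G (\<lambda>N. rate G N a b)"
    using assms pos[OF ab] rate_ratio_monomial_like[OF G(1) _ ab] by unfold_locales
  then show ?thesis by blast
qed

section \<open>One step of the construction\<close>

context scaled_graph
begin

abbreviation "V \<equiv> verts G"
abbreviation "H \<equiv> hat_verts G"
abbreviation "\<M> \<equiv> minimal_classes G"

lemma jump: "jump_graph G"
  using weighted by (rule weighted_graph_jump_graph)

sublocale K: pos_class "{0<..}" "monomial_like G"
  by (rule monomial_like_pos_class[OF jump A])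

lemma finV: "finite V"
  by (rule jump_graphD(1)[OF jump])

lemma finH: "finite H"
  using hat_verts_subset finV by (rule finite_subset)

lemma finM: "M \<in> \<M> \<Longrightarrow> finite M"
  using minimal_classD(2) finV finite_subset by blast

lemma M_subset_H: "M \<in> \<M> \<Longrightarrow> M \<subseteq> H"
  by (auto simp: hat_verts_def)

lemma fin_classes: "finite \<M>"
  using minimal_classD(2) finV by (intro finite_subset[of \<M> "Pow V"]) auto

lemma eventually_posI: "(\<And>N. N > 0 \<Longrightarrow> P N) \<Longrightarrow> \<forall>\<^sub>F N::real in at_top. P N"
  by (rule eventually_mono[OF eventually_gt_at_top[of 0]])

lemma tendsto_cong_pos:
  fixes f g :: "real \<Rightarrow> real"
  assumes "(f \<longlongrightarrow> L) at_top" "\<And>N. N > 0 \<Longrightarrow> f N = g N"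
  shows "(g \<longlongrightarrow> L) at_top"
  using assms(1) by (rule Lim_transform_eventually) (rule eventually_posI, rule assms(2))

lemma lim_unique:
  fixes f g :: "real \<Rightarrow> real"
  assumes "(f \<longlongrightarrow> a) at_top" "(g \<longlongrightarrow> b) at_top" "\<And>N. N > 0 \<Longrightarrow> f N = g N"
  shows "a = b"
  using tendsto_cong_pos[OF assms(1,3)] assms(2) by (rule tendsto_unique[OF trivial_limit_at_top_linorder])

lemma bounded_K_tendsto:
  assumes "f \<in> monomial_like G" "\<And>N. N > 0 \<Longrightarrow> f N \<le> B"
  obtains L where "L \<ge> 0" "(f \<longlongrightarrow> L) at_top"
  using bounded_monomial_like_tendsto[OF jump A assms] by blast

lemma rate_eq_edge_rate: "N > 0 \<Longrightarrow> x \<in> V \<Longrightarrow> y \<in> V \<Longrightarrow> rate G N x y = edge_rate G N x y"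
  using weighted by (auto simp: weighted_graph_def edge_rate_def)

section \<open>Limit rates and limit measures of the classes\<close>

definition lim_rate :: "'v \<Rightarrow> 'v \<Rightarrow> real" where
  "lim_rate x y = Lim at_top (\<lambda>N. edge_rate G N x y / \<rho> N)"

lemma lim_rate_aux:
  "((\<lambda>N. edge_rate G N x y / \<rho> N) \<longlongrightarrow> lim_rate x y) at_top \<and> lim_rate x y \<ge> 0 \<and>
    (lim_rate x y > 0 \<longleftrightarrow> (x, y) \<in> fast_edges G)"
proof -
  have "\<exists>L\<ge>0. ((\<lambda>N. edge_rate G N x y / \<rho> N) \<longlongrightarrow> L) at_top \<and> (L > 0 \<longleftrightarrow> (x, y) \<in> fast_edges G)"
  proof (cases "(x, y) \<in> edges G")
    case True
    then show ?thesis using edge_lim[OF True] by (simp add: edge_rate_def)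
  next
    case False
    then show ?thesis using fast_edges_subset[of G] by (auto simp: edge_rate_def)
  qed
  then obtain L where L: "L \<ge> 0" "((\<lambda>N. edge_rate G N x y / \<rho> N) \<longlongrightarrow> L) at_top"
    "L > 0 \<longleftrightarrow> (x, y) \<in> fast_edges G" by blast
  moreover have "lim_rate x y = L"
    unfolding lim_rate_def using L(2) by (rule tendsto_Lim[OF trivial_limit_at_top_linorder])
  ultimately show ?thesis by simp
qed

lemma tendsto_lim_rate: "((\<lambda>N. edge_rate G N x y / \<rho> N) \<longlongrightarrow> lim_rate x y) at_top"
  and lim_rate_nonneg: "lim_rate x y \<ge> 0"
  and lim_rate_pos_iff: "lim_rate x y > 0 \<longleftrightarrow> (x, y) \<in> fast_edges G"
  using lim_rate_aux by auto

lemma lim_rate_zero: "(x, y) \<notin> fast_edges G \<Longrightarrow> lim_rate x y = 0"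
  using lim_rate_nonneg[of x y] lim_rate_pos_iff[of x y] by linarith

lemma lim_rate_leaving_class:
  "M \<in> \<M> \<Longrightarrow> x \<in> M \<Longrightarrow> y \<notin> M \<Longrightarrow> lim_rate x y = 0"
  using minimal_class_closed[OF jump] by (intro lim_rate_zero) blast

lemma class_measure_facts:
  assumes M: "M \<in> \<M>"
  shows class_measure_K: "x \<in> M \<Longrightarrow> (\<lambda>N. class_measure G N M x) \<in> monomial_like G"
    and sum_class_measure: "N > 0 \<Longrightarrow> (\<Sum>x\<in>M. class_measure G N M x) = 1"
    and class_measure_outside: "N > 0 \<Longrightarrow> x \<notin> M \<Longrightarrow> class_measure G N M x = 0"
    and class_measure_le_1: "N > 0 \<Longrightarrow> class_measure G N M x \<le> 1"
    and class_measure_pos: "N > 0 \<Longrightarrow> x \<in> M \<Longrightarrow> class_measure G N M x > 0"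
    and class_measure_balance: "N > 0 \<Longrightarrow> y \<in> M \<Longrightarrow>
      (\<Sum>x\<in>M. class_measure G N M x * edge_rate (class_graph G M) N x y) =
      class_measure G N M y * (\<Sum>z\<in>M. edge_rate (class_graph G M) N y z)"
proof -
  note J = class_graph_jump_graph[OF jump M]
  have V: "verts (class_graph G M) = M" by (simp add: class_graph_def)
  have "(\<lambda>N. rate (class_graph G M) N x y / \<rho> N) \<in> monomial_like G"
    if "(x, y) \<in> edges (class_graph G M)" for x y
    using edge_K[of x y] fast_edges_subset[of G] that by (auto simp: class_graph_def)
  from inv_measure_K(1)[OF K.pos_class_axioms J \<rho>_pos this]
  show "x \<in> M \<Longrightarrow> (\<lambda>N. class_measure G N M x) \<in> monomial_like G"
    unfolding class_measure_def V by blast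
  show "N > 0 \<Longrightarrow> (\<Sum>x\<in>M. class_measure G N M x) = 1"
    using sum_inv_measure[OF J] by (simp add: V class_measure_def)
  show "N > 0 \<Longrightarrow> x \<notin> M \<Longrightarrow> class_measure G N M x = 0"
    using inv_measure_outside[OF J] by (simp add: V class_measure_def)
  show "N > 0 \<Longrightarrow> class_measure G N M x \<le> 1"
    using inv_measure_le_1[OF J] by (simp add: class_measure_def)
  show "N > 0 \<Longrightarrow> x \<in> M \<Longrightarrow> class_measure G N M x > 0"
    using inv_measure_pos[OF J] by (simp add: V class_measure_def)
  show "N > 0 \<Longrightarrow> y \<in> M \<Longrightarrow>
      (\<Sum>x\<in>M. class_measure G N M x * edge_rate (class_graph G M) N x y) =
      class_measure G N M y * (\<Sum>z\<in>M. edge_rate (class_graph G M) N y z)"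
    using inv_measure_balance[OF J] by (simp add: V class_measure_def)
qed

text \<open>\<open>limit_measure\<close> is given by \<open>Lim\<close>, which says nothing unless a
  limit exists; the bound 1 and (A) supply it.\<close>

lemma tendsto_limit_measure:
  assumes M: "M \<in> \<M>"
  shows "((\<lambda>N. class_measure G N M x) \<longlongrightarrow> limit_measure G M x) at_top"
proof -
  have "\<exists>L. ((\<lambda>N. class_measure G N M x) \<longlongrightarrow> L) at_top"
  proof (cases "x \<in> M")
    case True
    then show ?thesis
      using bounded_K_tendsto[OF class_measure_K[OF M True] class_measure_le_1[OF M]] by blast
  next
    case False
    have "((\<lambda>N. class_measure G N M x) \<longlongrightarrow> 0) at_top"
      by (rule tendsto_cong_pos[of "\<lambda>_. 0"]) (simp_all add: class_measure_outside[OF M _ False])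
    then show ?thesis by blast
  qed
  then obtain L where L: "((\<lambda>N. class_measure G N M x) \<longlongrightarrow> L) at_top" by blast
  moreover have "limit_measure G M x = L"
    unfolding limit_measure_def using L by (rule tendsto_Lim[OF trivial_limit_at_top_linorder])
  ultimately show ?thesis by simp
qed

lemma limit_measure_outside:
  assumes "M \<in> \<M>" "x \<notin> M" shows "limit_measure G M x = 0"
  by (rule lim_unique[OF tendsto_limit_measure[OF assms(1)] tendsto_const])
    (rule class_measure_outside[OF assms(1) _ assms(2)])

lemma sum_limit_measure:
  assumes "M \<in> \<M>" shows "(\<Sum>x\<in>M. limit_measure G M x) = 1"
  by (rule lim_unique[OF tendsto_sum[OF tendsto_limit_measure[OF assms]] tendsto_const])
    (rule sum_class_measure[OF assms])

lemma limit_measure_balance: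
  assumes M: "M \<in> \<M>" and y: "y \<in> M"
  shows "(\<Sum>x\<in>M. limit_measure G M x * lim_rate x y) = limit_measure G M y * (\<Sum>z\<in>M. lim_rate y z)"
proof (rule lim_unique)
  have lim: "((\<lambda>N. edge_rate (class_graph G M) N x y / \<rho> N) \<longlongrightarrow> lim_rate x y) at_top"
    if "x \<in> M" "y \<in> M" for x y
  proof (cases "(x, y) \<in> fast_edges G")
    case True
    then have "edge_rate (class_graph G M) N x y = edge_rate G N x y" for N
      using that fast_edges_subset[of G] by (auto simp: edge_rate_def class_graph_def)
    then show ?thesis using tendsto_lim_rate by simp
  next
    case False
    then show ?thesis using lim_rate_zero by (simp add: edge_rate_def class_graph_def)
  qed
  show "((\<lambda>N. \<Sum>x\<in>M. class_measure G N M x * (edge_rate (class_graph G M) N x y / \<rho> N)) \<longlongrightarrow>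
      (\<Sum>x\<in>M. limit_measure G M x * lim_rate x y)) at_top"
    by (intro tendsto_sum tendsto_mult tendsto_limit_measure M lim y)
  show "((\<lambda>N. class_measure G N M y * (\<Sum>z\<in>M. edge_rate (class_graph G M) N y z / \<rho> N)) \<longlongrightarrow>
      limit_measure G M y * (\<Sum>z\<in>M. lim_rate y z)) at_top"
    by (intro tendsto_sum tendsto_mult tendsto_limit_measure M lim y)
  show "(\<Sum>x\<in>M. class_measure G N M x * (edge_rate (class_graph G M) N x y / \<rho> N)) =
      class_measure G N M y * (\<Sum>z\<in>M. edge_rate (class_graph G M) N y z / \<rho> N)" if "N > 0" for N
    using class_measure_balance[OF M that y] by (simp flip: sum_divide_distrib)
qed

text \<open>The limit rates on \<open>M\<close> form an irreducible chain, so stationarity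
  determines a law and makes it positive. The second part will identify the limit of the conditioned
  measure; positivity permits division by \<open>limit_measure\<close>.\<close>

lemma stationary_on_class:
  assumes M: "M \<in> \<M>" and x: "x \<in> M"
  shows limit_measure_pos: "limit_measure G M x > 0"
    and "(\<Sum>x\<in>M. v x) = 1 \<Longrightarrow>
      (\<And>y. y \<in> M \<Longrightarrow> (\<Sum>x\<in>M. v x * lim_rate x y) = v y * (\<Sum>z\<in>M. lim_rate y z)) \<Longrightarrow>
      v x = limit_measure G M x"
proof -
  obtain u where u: "\<And>x. x \<in> M \<Longrightarrow> u x > 0"
    "\<And>v x. (\<Sum>x\<in>M. v x) = 1 \<Longrightarrow>
      (\<And>y. y \<in> M \<Longrightarrow> (\<Sum>x\<in>M. v x * lim_rate x y) = v y * (\<Sum>z\<in>M. lim_rate y z)) \<Longrightarrow> x \<in> M \<Longrightarrow> v x = u x"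
  proof (rule stationary_ex1[of M "fast_edges G \<inter> M \<times> M" lim_rate])
    show "\<And>x y. x \<in> M \<Longrightarrow> y \<in> M \<Longrightarrow> (x, y) \<in> (fast_edges G \<inter> M \<times> M)\<^sup>*"
      using minimal_class_path[OF jump M] .
  qed (use finM[OF M] minimal_classD(3)[OF M] lim_rate_nonneg in \<open>auto simp: lim_rate_pos_iff\<close>)
  have eq: "limit_measure G M x = u x"
    using u(2) sum_limit_measure[OF M] limit_measure_balance[OF M] x by blast
  then show "limit_measure G M x > 0" using u(1) x by simp
  show "v x = limit_measure G M x" if "(\<Sum>x\<in>M. v x) = 1"
      "\<And>y. y \<in> M \<Longrightarrow> (\<Sum>x\<in>M. v x * lim_rate x y) = v y * (\<Sum>z\<in>M. lim_rate y z)"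
    unfolding eq using that x by (rule u(2))
qed

section \<open>The trace of the chain on the minimal classes\<close>

abbreviation "hit N z y \<equiv> first_entry_prob G N H z y"
abbreviation "rr N x y \<equiv> reduced_rate G N x y"

lemmas H_facts = hat_verts_subset[of G] hat_verts_nonempty[OF jump]

lemma reduced_rate_eq:
  assumes "N > 0" "x \<in> V" "y \<in> V"
  shows "rr N x y = edge_rate G N x y + (\<Sum>z\<in>V - H. edge_rate G N x z * hit N z y)"
  unfolding reduced_rate_def using assms by (auto simp: rate_eq_edge_rate intro!: sum.cong)

lemma reduced_rate_Kz:
  assumes "x \<in> V" "y \<in> V"
  shows "(\<lambda>N. rr N x y / \<rho> N) \<in> K.Kz"
proof -
  note edge = edge_rate_irred(2)[OF K.pos_class_axioms jump edge_K]
  have "(\<lambda>N. hit N z y) \<in> K.Kz" if "z \<in> V - H" for z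
    using that by (intro first_entry_prob_Kz[OF K.pos_class_axioms jump \<rho>_pos edge_K H_facts]) auto
  then have "(\<lambda>N. edge_rate G N x y / \<rho> N + (\<Sum>z\<in>V - H. edge_rate G N x z / \<rho> N * hit N z y)) \<in> K.Kz"
    by (intro K.Kz_add K.Kz_sum K.Kz_mult edge) auto
  then show ?thesis
    by (rule K.Kz_cong) (use assms in \<open>simp add: reduced_rate_eq add_divide_distrib sum_divide_distrib\<close>)
qed

lemma reduced_rate_nonneg: "N > 0 \<Longrightarrow> x \<in> V \<Longrightarrow> y \<in> V \<Longrightarrow> rr N x y \<ge> 0"
  using K.Kz_nonneg[OF reduced_rate_Kz[of x y], of N] \<rho>_pos[of N] by (auto simp: zero_le_divide_iff)

text \<open>A detour through the complement of \<open>H\<close> starts with an edge that leaves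
  \<open>H\<close>, which is never fast; entry probabilities are at most 1, so detours vanish at the
  fast scale.\<close>

lemma tendsto_reduced_rate:
  assumes x: "x \<in> H" and y: "y \<in> H"
  shows "((\<lambda>N. rr N x y / \<rho> N) \<longlongrightarrow> lim_rate x y) at_top"
proof -
  have V: "x \<in> V" "y \<in> V" using assms H_facts by auto
  have detour: "((\<lambda>N. edge_rate G N x z / \<rho> N * hit N z y) \<longlongrightarrow> 0) at_top" if z: "z \<in> V - H" for z
  proof (rule Lim_null_comparison)
    have "(x, z) \<notin> fast_edges G" using hat_verts_closed[OF jump x] z by auto
    then show "((\<lambda>N. edge_rate G N x z / \<rho> N) \<longlongrightarrow> 0) at_top"
      using tendsto_lim_rate[of x z] lim_rate_zero by simp
    show "\<forall>\<^sub>F N in at_top. norm (edge_rate G N x z / \<rho> N * hit N z y) \<le> edge_rate G N x z / \<rho> N"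
    proof (rule eventually_posI)
      fix N :: real assume N: "N > 0"
      have "0 \<le> hit N z y" "hit N z y \<le> 1"
        using first_entry_prob_nonneg[OF jump N H_facts] first_entry_prob_le_1[OF jump N H_facts _ y] z by auto
      moreover have "edge_rate G N x z / \<rho> N \<ge> 0"
        using edge_rate_nonneg[OF jump N] \<rho>_pos[OF N] by simp
      ultimately show "norm (edge_rate G N x z / \<rho> N * hit N z y) \<le> edge_rate G N x z / \<rho> N"
        by (simp only: real_norm_def abs_mult abs_of_nonneg mult_left_le)
    qed
  qed
  have "((\<lambda>N. edge_rate G N x y / \<rho> N + (\<Sum>z\<in>V - H. edge_rate G N x z / \<rho> N * hit N z y)) \<longlongrightarrow>
      lim_rate x y + (\<Sum>z\<in>V - H. 0)) at_top"
    by (intro tendsto_add tendsto_sum tendsto_lim_rate detour)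
  then have "((\<lambda>N. edge_rate G N x y / \<rho> N + (\<Sum>z\<in>V - H. edge_rate G N x z / \<rho> N * hit N z y)) \<longlongrightarrow>
      lim_rate x y) at_top" by simp
  then show ?thesis
    by (rule tendsto_cong_pos) (simp add: reduced_rate_eq V add_divide_distrib sum_divide_distrib)
qed

abbreviation "\<pi> N x \<equiv> inv_measure G N x"

lemma edge_sums:
  assumes N: "N > 0" and b: "b \<in> V"
  shows "(\<Sum>w\<in>V. edge_rate G N b w) = edge_rate G N b b + out_rate G N b"
  using b finV by (simp add: out_rate_def sum.remove)

text \<open>The balance equation at each exterior \<open>b\<close> is multiplied by
  \<open>hit N b y\<close> and combined with the one at \<open>y\<close>; harmonicity of
  \<open>hit\<close> turns the sum into the balance for the reduced rates.\<close>

lemma trace_balance: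
  assumes N: "N > 0" and y: "y \<in> H"
  shows "(\<Sum>x\<in>H. \<pi> N x * rr N x y) = \<pi> N y * (\<Sum>w\<in>H. rr N y w)"
proof -
  have HV: "H \<subseteq> V" by (rule H_facts)
  have yV: "y \<in> V" using y HV by auto
  have splitV: "(\<Sum>x\<in>V. f x) = (\<Sum>x\<in>H. f x) + (\<Sum>x\<in>V - H. f x)" for f :: "'v \<Rightarrow> real"
    using sum.subset_diff[OF HV finV, of f] by simp
  let ?e = "edge_rate G N"
  \<comment> \<open>The flow from \<open>H\<close> into \<open>b\<close> that later enters
    \<open>H\<close> at \<open>y\<close>, rewritten by the balance and the harmonic equation at
    \<open>b\<close>; a loop at \<open>b\<close> adds the same to both.\<close>
  have inflow: "(\<Sum>x\<in>H. \<pi> N x * ?e x b) * hit N b y =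
      \<pi> N b * ?e b y + (\<Sum>w\<in>V - H. \<pi> N b * ?e b w * hit N w y) - (\<Sum>w\<in>V - H. \<pi> N w * ?e w b) * hit N b y"
    if b: "b \<in> V - H" for b
  proof -
    have "(\<Sum>x\<in>H. \<pi> N x * ?e x b) + (\<Sum>w\<in>V - H. \<pi> N w * ?e w b) = \<pi> N b * (?e b b + out_rate G N b)"
      using inv_measure_balance[OF jump N, of b] b by (simp add: splitV[symmetric] edge_sums[OF N])
    then have "(\<Sum>x\<in>H. \<pi> N x * ?e x b) * hit N b y + (\<Sum>w\<in>V - H. \<pi> N w * ?e w b) * hit N b y =
        \<pi> N b * (?e b b * hit N b y + hit N b y * out_rate G N b)"
      by (simp flip: distrib_right) (simp add: algebra_simps)
    also have "?e b b * hit N b y + hit N b y * out_rate G N b = (\<Sum>w\<in>V. ?e b w * hit N w y)"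
      using first_entry_prob_step[OF jump N H_facts b] b finV by (simp add: sum.remove[of V b])
    also have "\<dots> = ?e b y + (\<Sum>w\<in>V - H. ?e b w * hit N w y)"
    proof -
      have "(\<Sum>w\<in>H. ?e b w * hit N w y) = (\<Sum>w\<in>H. if w = y then ?e b w else 0)"
        by (intro sum.cong refl) (simp add: first_entry_prob_base[OF jump N H_facts])
      then show ?thesis using y finH by (simp add: splitV)
    qed
    finally show ?thesis by (simp add: distrib_left sum_distrib_left mult.assoc)
  qed
  have "(\<Sum>x\<in>H. \<pi> N x * rr N x y) =
      (\<Sum>x\<in>H. \<pi> N x * ?e x y) + (\<Sum>x\<in>H. \<Sum>b\<in>V - H. \<pi> N x * ?e x b * hit N b y)"
    using HV yV N by (simp add: reduced_rate_eq subset_iff distrib_left sum.distrib sum_distrib_left mult.assoc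
        cong: sum.cong)
  also have "(\<Sum>x\<in>H. \<Sum>b\<in>V - H. \<pi> N x * ?e x b * hit N b y) =
      (\<Sum>b\<in>V - H. (\<Sum>x\<in>H. \<pi> N x * ?e x b) * hit N b y)"
    by (subst sum.swap) (simp add: sum_distrib_right)
  also have "\<dots> = (\<Sum>b\<in>V - H. \<pi> N b * ?e b y) + (\<Sum>b\<in>V - H. \<Sum>w\<in>V - H. \<pi> N b * ?e b w * hit N w y)
      - (\<Sum>b\<in>V - H. \<Sum>w\<in>V - H. \<pi> N w * ?e w b * hit N b y)"
  proof -
    have "(\<Sum>b\<in>V - H. (\<Sum>x\<in>H. \<pi> N x * ?e x b) * hit N b y) = (\<Sum>b\<in>V - H. \<pi> N b * ?e b y +
        (\<Sum>w\<in>V - H. \<pi> N b * ?e b w * hit N w y) - (\<Sum>w\<in>V - H. \<pi> N w * ?e w b) * hit N b y)"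
      by (intro sum.cong refl inflow)
    then show ?thesis by (simp add: sum.distrib sum_subtractf sum_distrib_right)
  qed
  \<comment> \<open>Passages between exterior vertices occur once as outflow and once as inflow, and
    cancel.\<close>
  also have "(\<Sum>b\<in>V - H. \<Sum>w\<in>V - H. \<pi> N w * ?e w b * hit N b y) =
      (\<Sum>b\<in>V - H. \<Sum>w\<in>V - H. \<pi> N b * ?e b w * hit N w y)"
    by (rule sum.swap)
  finally have "(\<Sum>x\<in>H. \<pi> N x * rr N x y) = (\<Sum>x\<in>V. \<pi> N x * ?e x y)"
    by (simp add: splitV)
  also have "\<dots> = \<pi> N y * (\<Sum>w\<in>V. ?e y w)"
    by (rule inv_measure_balance[OF jump N yV])
  \<comment> \<open>Every exterior vertex enters \<open>H\<close> with total probability 1, so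
    redirecting the rates out of \<open>y\<close> keeps their sum.\<close>
  also have "(\<Sum>w\<in>V. ?e y w) = (\<Sum>w\<in>H. ?e y w) + (\<Sum>b\<in>V - H. ?e y b * (\<Sum>w\<in>H. hit N b w))"
    using sum_first_entry_prob[OF jump N H_facts] by (simp add: splitV)
  also have "\<dots> = (\<Sum>w\<in>H. rr N y w)"
    using HV yV N by (simp add: reduced_rate_eq subset_iff sum.distrib sum_distrib_left cong: sum.cong)
      (rule sum.swap)
  finally show ?thesis .
qed

subsection \<open>Conditioning on a minimal class\<close>

definition mass :: "real \<Rightarrow> 'v set \<Rightarrow> real" where
  "mass N M = (\<Sum>x\<in>M. \<pi> N x)"

lemma pi_K: "x \<in> V \<Longrightarrow> (\<lambda>N. \<pi> N x) \<in> monomial_like G"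
  by (rule inv_measure_K(1)[OF K.pos_class_axioms jump \<rho>_pos edge_K])

lemma pi_pos: "N > 0 \<Longrightarrow> x \<in> V \<Longrightarrow> \<pi> N x > 0"
  by (rule inv_measure_pos[OF jump])

lemma mass_K:
  assumes "M \<subseteq> V" "M \<noteq> {}" shows "(\<lambda>N. mass N M) \<in> monomial_like G"
proof -
  obtain a where "a \<in> M" using assms by blast
  then show ?thesis
    unfolding mass_def using assms finite_subset[OF assms(1) finV]
    by (intro K.sum_in_K[where a = a and f = "\<lambda>x N. \<pi> N x"] pi_K K.KzI) auto
qed

lemma mass_pos: "N > 0 \<Longrightarrow> M \<in> \<M> \<Longrightarrow> mass N M > 0"
  using K.pos[OF mass_K[OF minimal_classD(2,3)], of M G N] by simp

lemma pi_le_mass: "N > 0 \<Longrightarrow> M \<in> \<M> \<Longrightarrow> x \<in> M \<Longrightarrow> \<pi> N x \<le> mass N M"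
  unfolding mass_def by (intro member_le_sum finM inv_measure_nonneg[OF jump]) auto

text \<open>Sum the trace balance over \<open>M\<close>; transitions inside \<open>M\<close> occur
  on both sides. This trades the inflow, which depends on masses elsewhere, for the outflow, which
  depends on masses in \<open>M\<close> alone.\<close>

lemma flow_balance:
  assumes N: "N > 0" and M: "M \<in> \<M>"
  shows "(\<Sum>y\<in>M. \<Sum>x\<in>H - M. \<pi> N x * rr N x y) = (\<Sum>y\<in>M. \<Sum>w\<in>H - M. \<pi> N y * rr N y w)"
proof -
  have split: "(\<Sum>x\<in>H. f x) = (\<Sum>x\<in>M. f x) + (\<Sum>x\<in>H - M. f x)" for f :: "'v \<Rightarrow> real"
    using sum.subset_diff[OF M_subset_H[OF M] finH, of f] by simp
  have "(\<Sum>y\<in>M. \<Sum>x\<in>H. \<pi> N x * rr N x y) = (\<Sum>y\<in>M. \<Sum>w\<in>H. \<pi> N y * rr N y w)"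
    using M_subset_H[OF M] by (intro sum.cong[OF refl, of M]) (auto simp: trace_balance[OF N] simp flip: sum_distrib_left)
  moreover have "(\<Sum>y\<in>M. \<Sum>x\<in>M. \<pi> N x * rr N x y) = (\<Sum>y\<in>M. \<Sum>w\<in>M. \<pi> N y * rr N y w)"
    by (rule sum.swap)
  ultimately show ?thesis by (simp add: split sum.distrib)
qed

text \<open>Limits of the conditioned weights exist by (A) and boundedness; stationarity for the
  limit rates then identifies them.\<close>

lemma tendsto_conditional:
  assumes M: "M \<in> \<M>" and x: "x \<in> M"
  shows "((\<lambda>N. \<pi> N x / mass N M) \<longlongrightarrow> limit_measure G M x) at_top"
proof -
  note MV = minimal_classD(2,3)[OF M]
  have "\<exists>L. ((\<lambda>N. \<pi> N x / mass N M) \<longlongrightarrow> L) at_top" if "x \<in> M" for x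
  proof -
    have "(\<lambda>N. \<pi> N x / mass N M) \<in> monomial_like G"
      using that MV by (intro K.divide pi_K mass_K) auto
    moreover have "\<pi> N x / mass N M \<le> 1" if "N > 0" for N
      using pi_le_mass[OF that M \<open>x \<in> M\<close>] mass_pos[OF that M] by simp
    ultimately show ?thesis using bounded_K_tendsto by blast
  qed
  then obtain p where p: "\<And>x. x \<in> M \<Longrightarrow> ((\<lambda>N. \<pi> N x / mass N M) \<longlongrightarrow> p x) at_top"
    by metis
  have "p x = limit_measure G M x"
  proof (rule stationary_on_class(2)[OF M x])
    show "(\<Sum>x\<in>M. p x) = 1"
    proof (rule lim_unique)
      show "((\<lambda>N. \<Sum>x\<in>M. \<pi> N x / mass N M) \<longlongrightarrow> (\<Sum>x\<in>M. p x)) at_top"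
        by (intro tendsto_sum p)
      show "(\<Sum>x\<in>M. \<pi> N x / mass N M) = 1" if "N > 0" for N
        using mass_pos[OF that M] by (simp add: mass_def flip: sum_divide_distrib)
    qed (rule tendsto_const)
    fix y assume y: "y \<in> M"
    have yH: "y \<in> H" using M_subset_H[OF M] y by auto
    have split: "(\<Sum>x\<in>H. f x) = (\<Sum>x\<in>M. f x) + (\<Sum>x\<in>H - M. f x)" for f :: "'v \<Rightarrow> real"
      using sum.subset_diff[OF M_subset_H[OF M] finH, of f] by simp
    define inflow where "inflow N = (\<Sum>x\<in>H - M. \<pi> N x * rr N x y) / (mass N M * \<rho> N)" for N
    have red: "((\<lambda>N. rr N x y / \<rho> N) \<longlongrightarrow> lim_rate x y) at_top" if "x \<in> H" "y \<in> H" for x y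
      by (rule tendsto_reduced_rate[OF that])
    \<comment> \<open>Inflow terms cannot be estimated directly: \<open>\<pi> N x / mass N M\<close>
      may be unbounded for \<open>x\<close> in another class. The total inflow equals the outflow, a
      sum of convergent weights times rates that vanish at the fast scale.\<close>
    have inflow: "(inflow \<longlongrightarrow> 0) at_top"
    proof (rule Lim_null_comparison)
      have "((\<lambda>N. \<Sum>x\<in>M. \<Sum>w\<in>H - M. \<pi> N x / mass N M * (rr N x w / \<rho> N)) \<longlongrightarrow>
          (\<Sum>x\<in>M. \<Sum>w\<in>H - M. p x * lim_rate x w)) at_top"
        using M_subset_H[OF M] by (intro tendsto_sum tendsto_mult p red) auto
      moreover have "(\<Sum>x\<in>M. \<Sum>w\<in>H - M. p x * lim_rate x w) = 0"
        using lim_rate_leaving_class[OF M] by simp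
      ultimately show "((\<lambda>N. \<Sum>x\<in>M. \<Sum>w\<in>H - M. \<pi> N x / mass N M * (rr N x w / \<rho> N)) \<longlongrightarrow> 0) at_top"
        by simp
      show "\<forall>\<^sub>F N in at_top. norm (inflow N) \<le> (\<Sum>x\<in>M. \<Sum>w\<in>H - M. \<pi> N x / mass N M * (rr N x w / \<rho> N))"
      proof (rule eventually_posI)
        fix N :: real assume N: "N > 0"
        have nn: "\<pi> N x * rr N x z \<ge> 0" if "x \<in> H" "z \<in> H" for x z
          using that hat_verts_subset[of G]
          by (intro mult_nonneg_nonneg reduced_rate_nonneg[OF N] inv_measure_nonneg[OF jump N]) auto
        have D: "mass N M * \<rho> N > 0" using mass_pos[OF N M] \<rho>_pos[OF N] by simp
        have "(\<Sum>x\<in>H - M. \<pi> N x * rr N x y) \<le> (\<Sum>y\<in>M. \<Sum>x\<in>H - M. \<pi> N x * rr N x y)"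
          using M_subset_H[OF M] finM[OF M] y nn
          by (intro member_le_sum[of y M "\<lambda>y. \<Sum>x\<in>H - M. \<pi> N x * rr N x y"] sum_nonneg) auto
        also have "\<dots> = (\<Sum>x\<in>M. \<Sum>w\<in>H - M. \<pi> N x * rr N x w)" by (rule flow_balance[OF N M])
        finally have "inflow N \<le> (\<Sum>x\<in>M. \<Sum>w\<in>H - M. \<pi> N x * rr N x w) / (mass N M * \<rho> N)"
          unfolding inflow_def using D by (intro divide_right_mono) auto
        moreover have "inflow N \<ge> 0"
          unfolding inflow_def using D nn yH by (intro divide_nonneg_pos sum_nonneg) auto
        ultimately show "norm (inflow N) \<le> (\<Sum>x\<in>M. \<Sum>w\<in>H - M. \<pi> N x / mass N M * (rr N x w / \<rho> N))"
          by (simp add: sum_divide_distrib)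
      qed
    qed
    show "(\<Sum>x\<in>M. p x * lim_rate x y) = p y * (\<Sum>z\<in>M. lim_rate y z)"
    proof (rule lim_unique)
      have "((\<lambda>N. (\<Sum>x\<in>M. \<pi> N x / mass N M * (rr N x y / \<rho> N)) + inflow N) \<longlongrightarrow>
          (\<Sum>x\<in>M. p x * lim_rate x y) + 0) at_top"
        using M_subset_H[OF M] by (intro tendsto_add inflow tendsto_sum tendsto_mult p red yH) auto
      then show "((\<lambda>N. (\<Sum>x\<in>M. \<pi> N x / mass N M * (rr N x y / \<rho> N)) + inflow N) \<longlongrightarrow>
          (\<Sum>x\<in>M. p x * lim_rate x y)) at_top" by simp
      have "((\<lambda>N. \<pi> N y / mass N M * (\<Sum>w\<in>H. rr N y w / \<rho> N)) \<longlongrightarrow> p y * (\<Sum>w\<in>H. lim_rate y w)) at_top"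
        using y yH by (intro tendsto_mult tendsto_sum p red) auto
      moreover have "(\<Sum>w\<in>H. lim_rate y w) = (\<Sum>w\<in>M. lim_rate y w)"
        using lim_rate_leaving_class[OF M y] by (simp add: split)
      ultimately show "((\<lambda>N. \<pi> N y / mass N M * (\<Sum>w\<in>H. rr N y w / \<rho> N)) \<longlongrightarrow> p y * (\<Sum>z\<in>M. lim_rate y z)) at_top"
        by simp
      show "(\<Sum>x\<in>M. \<pi> N x / mass N M * (rr N x y / \<rho> N)) + inflow N =
          \<pi> N y / mass N M * (\<Sum>w\<in>H. rr N y w / \<rho> N)" if N: "N > 0" for N
      proof -
        have "(\<Sum>x\<in>M. \<pi> N x / mass N M * (rr N x y / \<rho> N)) + inflow N =
            (\<Sum>x\<in>H. \<pi> N x * rr N x y) / (mass N M * \<rho> N)"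
          by (simp add: split inflow_def add_divide_distrib sum_divide_distrib)
        also have "\<dots> = \<pi> N y / mass N M * (\<Sum>w\<in>H. rr N y w / \<rho> N)"
          by (simp add: trace_balance[OF N yH] flip: sum_divide_distrib)
        finally show ?thesis .
      qed
    qed
  qed
  then show ?thesis using p[OF x] by simp
qed

text \<open>The limit of \<open>\<pi>\<close> is stationary for the limit rates, which never lead
  out of \<open>H\<close>. Balance over \<open>H\<close> then permits no inflow, so a vertex outside
  \<open>H\<close> with a fast edge into \<open>H\<close> has limit mass 0, and so, inductively, has
  every exterior vertex on a fast path to \<open>H\<close>.\<close>

lemma tendsto_off_hat:
  assumes z: "z \<in> V - H"
  shows "((\<lambda>N. \<pi> N z) \<longlongrightarrow> 0) at_top"
proof -
  have "\<exists>L\<ge>0. ((\<lambda>N. \<pi> N x) \<longlongrightarrow> L) at_top" if "x \<in> V" for x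
    using bounded_K_tendsto[OF pi_K[OF that], of 1] inv_measure_le_1[OF jump] by blast
  then obtain p where p: "\<And>x. x \<in> V \<Longrightarrow> p x \<ge> 0" "\<And>x. x \<in> V \<Longrightarrow> ((\<lambda>N. \<pi> N x) \<longlongrightarrow> p x) at_top"
    by metis
  have bal: "(\<Sum>x\<in>V. p x * lim_rate x y) = p y * (\<Sum>w\<in>V. lim_rate y w)" if y: "y \<in> V" for y
  proof (rule lim_unique)
    show "((\<lambda>N. \<Sum>x\<in>V. \<pi> N x * (edge_rate G N x y / \<rho> N)) \<longlongrightarrow> (\<Sum>x\<in>V. p x * lim_rate x y)) at_top"
      by (intro tendsto_sum tendsto_mult p tendsto_lim_rate)
    show "((\<lambda>N. \<pi> N y * (\<Sum>w\<in>V. edge_rate G N y w / \<rho> N)) \<longlongrightarrow> p y * (\<Sum>w\<in>V. lim_rate y w)) at_top"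
      by (intro tendsto_sum tendsto_mult p tendsto_lim_rate y)
    show "(\<Sum>x\<in>V. \<pi> N x * (edge_rate G N x y / \<rho> N)) = \<pi> N y * (\<Sum>w\<in>V. edge_rate G N y w / \<rho> N)" if "N > 0" for N
      using inv_measure_balance[OF jump that y] by (simp flip: sum_divide_distrib)
  qed
  have HV: "H \<subseteq> V" by (rule hat_verts_subset)
  have splitV: "(\<Sum>x\<in>V. f x) = (\<Sum>x\<in>H. f x) + (\<Sum>x\<in>V - H. f x)" for f :: "'v \<Rightarrow> real"
    using sum.subset_diff[OF HV finV, of f] by simp
  have leave: "lim_rate y w = 0" if "y \<in> H" "w \<in> V - H" for y w
    using hat_verts_closed[OF jump that(1)] that(2) by (intro lim_rate_zero) auto
  have "(\<Sum>y\<in>H. \<Sum>x\<in>V. p x * lim_rate x y) = (\<Sum>y\<in>H. p y * (\<Sum>w\<in>V. lim_rate y w))"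
    using HV by (intro sum.cong refl bal) auto
  also have "\<dots> = (\<Sum>y\<in>H. \<Sum>w\<in>H. p y * lim_rate y w)"
    using leave by (simp add: splitV sum_distrib_left)
  also have "\<dots> = (\<Sum>y\<in>H. \<Sum>x\<in>H. p x * lim_rate x y)" by (rule sum.swap)
  finally have cross: "(\<Sum>y\<in>H. \<Sum>x\<in>V - H. p x * lim_rate x y) = 0"
    by (simp add: splitV sum.distrib)
  then have into: "p x * lim_rate x y = 0" if "y \<in> H" "x \<in> V - H" for x y
  proof -
    have nn: "p x * lim_rate x y \<ge> 0" if "x \<in> V" for x y
      using p(1)[OF that] lim_rate_nonneg by simp
    have "\<forall>y\<in>H. (\<Sum>x\<in>V - H. p x * lim_rate x y) = 0"
      using cross finH nn
      by (subst (asm) sum_nonneg_eq_0_iff) (auto intro!: sum_nonneg)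
    then have "(\<Sum>x\<in>V - H. p x * lim_rate x y) = 0" using that(1) by blast
    then show ?thesis
      using finV nn that(2) by (subst (asm) sum_nonneg_eq_0_iff) auto
  qed
  obtain y where y: "(z, y) \<in> (fast_edges G)\<^sup>*" "y \<in> H"
    using reaches_minimal_class[OF jump] z by blast
  have "z \<in> H \<or> p z = 0"
    using y
  proof (induction rule: converse_rtrancl_induct)
    case base
    then show ?case by simp
  next
    case (step z w)
    have V: "z \<in> V" "w \<in> V" using step(1) fast_edges_subset[of G] jump_graphD(3)[OF jump] by auto
    have r: "lim_rate z w > 0" using step(1) by (simp add: lim_rate_pos_iff)
    show ?case
    proof (cases "w \<in> H")
      case True
      then show ?thesis using into[OF True, of z] V r by auto
    next
      case False
      then have "p w = 0" using step by simp
      \<comment> \<open>With no limit mass at \<open>w\<close>, stationarity leaves no inflow into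
        \<open>w\<close>, in particular none from \<open>z\<close>.\<close>
      then have "p z * lim_rate z w = 0"
        using bal[OF V(2)] V finV p(1) lim_rate_nonneg by (simp add: sum_nonneg_eq_0_iff)
      then show ?thesis using r by simp
    qed
  qed
  then show ?thesis using z p(2)[of z] by auto
qed

subsection \<open>The effective graph\<close>

lemma effective_rate_Kz: "(\<lambda>N. effective_rate G N M1 M2 / \<rho> N) \<in> K.Kz"
proof (cases "M1 \<in> \<M> \<and> M2 \<in> \<M> \<and> M1 \<noteq> M2")
  case True
  have "(\<lambda>N. \<Sum>y1\<in>M1. \<Sum>y2\<in>M2. class_measure G N M1 y1 * (rr N y1 y2 / \<rho> N)) \<in> K.Kz"
    using True minimal_classD(2)
    by (intro K.Kz_sum K.Kz_mult reduced_rate_Kz K.KzI[OF class_measure_K]) auto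
  then show ?thesis
    by (rule K.Kz_cong) (use True in \<open>simp add: effective_rate_def sum_divide_distrib\<close>)
next
  case False
  then have "effective_rate G N M1 M2 = 0" for N by (auto simp: effective_rate_def)
  then show ?thesis by simp
qed

lemma effective_rate_nonneg: "N > 0 \<Longrightarrow> effective_rate G N M1 M2 \<ge> 0"
  using K.Kz_nonneg[OF effective_rate_Kz, of N M1 M2] \<rho>_pos[of N] by (simp add: zero_le_divide_iff)

text \<open>By the dichotomy of \<open>Kz\<close>, positivity at one N gives it at all. Hence the
  quantifier in \<open>effective_graph\<close> loses no edges, and connectivity can be checked at N
  = 1.\<close>

lemma effective_edge_iff:
  assumes "N > 0"
  shows "(M1, M2) \<in> edges (effective_graph G) \<longleftrightarrow> effective_rate G N M1 M2 > 0"
proof -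
  have "effective_rate G N M1 M2 > 0 \<longleftrightarrow> (\<lambda>N. effective_rate G N M1 M2 / \<rho> N) \<in> monomial_like G"
    if "N > 0" for N
    using K.Kz_pos_iff[OF effective_rate_Kz, of N M1 M2] \<rho>_pos[OF that] that
    by (simp add: zero_less_divide_iff)
  then show ?thesis
    using assms by (auto simp: effective_graph_def)
qed

lemma effective_edge_K:
  "(M1, M2) \<in> edges (effective_graph G) \<Longrightarrow> (\<lambda>N. effective_rate G N M1 M2 / \<rho> N) \<in> monomial_like G"
  using K.Kz_pos_iff[OF effective_rate_Kz, of 1 M1 M2] effective_edge_iff[of 1] \<rho>_pos[of 1] by simp

lemma effective_edgeD:
  "(M1, M2) \<in> edges (effective_graph G) \<Longrightarrow> M1 \<in> \<M> \<and> M2 \<in> \<M> \<and> M1 \<noteq> M2"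
  using effective_edge_iff[of 1 M1 M2] by (auto simp: effective_rate_def split: if_splits)

lemma effective_edgeI:
  assumes M: "M1 \<in> \<M>" "M2 \<in> \<M>" "M1 \<noteq> M2" and y: "y1 \<in> M1" "y2 \<in> M2" "rr 1 y1 y2 > 0"
  shows "(M1, M2) \<in> edges (effective_graph G)"
proof -
  have V: "M1 \<subseteq> V" "M2 \<subseteq> V" using minimal_classD(2) M by auto
  have nn: "class_measure G 1 M1 x1 * rr 1 x1 x2 \<ge> 0" if "x1 \<in> M1" "x2 \<in> M2" for x1 x2
    using that V by (intro mult_nonneg_nonneg less_imp_le[OF class_measure_pos[OF M(1)]] reduced_rate_nonneg) auto
  have "0 < (\<Sum>x2\<in>M2. class_measure G 1 M1 y1 * rr 1 y1 x2)"
    using y finM[OF M(2)] class_measure_pos[OF M(1), of 1] nn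
    by (intro sum_pos2[of M2 y2]) auto
  then have "0 < (\<Sum>x1\<in>M1. \<Sum>x2\<in>M2. class_measure G 1 M1 x1 * rr 1 x1 x2)"
    using y finM[OF M(1)] nn by (intro sum_pos2[of M1 y1]) (auto intro!: sum_nonneg)
  then show ?thesis using M effective_edge_iff[of 1] by (simp add: effective_rate_def)
qed

text \<open>Induction from the end of the path. Since vertices on the path may lie in no minimal
  class, the claim speaks of a point \<open>y'\<close> at which the chain from \<open>x\<close> can
  first enter \<open>H\<close>.\<close>

lemma effective_path:
  assumes "(x, y) \<in> (edges G)\<^sup>*" and x: "x \<in> V" and y: "y \<in> M2" "M2 \<in> \<M>"
  shows "\<exists>y'\<in>H. hit 1 x y' > 0 \<and> (\<forall>M\<in>\<M>. y' \<in> M \<longrightarrow> (M, M2) \<in> (edges (effective_graph G))\<^sup>*)"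
  using assms(1,2)
proof (induction rule: converse_rtrancl_induct)
  case base
  have "y \<in> H" using y M_subset_H by auto
  moreover have "hit 1 y y > 0" using \<open>y \<in> H\<close> by (simp add: first_entry_prob_base[OF jump _ H_facts])
  moreover have "M = M2" if "M \<in> \<M>" "y \<in> M" for M
    using minimal_class_disjoint[OF that(1) y(2) that(2) y(1)] .
  ultimately show ?case by blast
next
  case (step x w)
  have w: "w \<in> V" "x \<in> V" using step(1) jump_graphD(3)[OF jump] by auto
  have e: "edge_rate G 1 x w > 0" using edge_rate_pos_iff[OF jump, of 1] step(1) by simp
  obtain y' where y': "y' \<in> H" "hit 1 w y' > 0"
    "\<forall>M\<in>\<M>. y' \<in> M \<longrightarrow> (M, M2) \<in> (edges (effective_graph G))\<^sup>*"
    using step w by blast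
  have hit_nn: "hit 1 u v \<ge> 0" if "u \<in> V" for u v
    using first_entry_prob_nonneg[OF jump _ H_facts that] by simp
  have e_nn: "edge_rate G 1 u v \<ge> 0" for u v by (rule edge_rate_nonneg[OF jump]) simp
  show ?case
  proof (cases "x \<in> H")
    case False
    then have xVH: "x \<in> V - H" using w by simp
    have "hit 1 x y' > 0"
    proof (cases "w = x")
      case True
      then show ?thesis using y' by simp
    next
      case False
      have "0 < (\<Sum>v\<in>V - {x}. edge_rate G 1 x v * hit 1 v y')"
        using w False e y'(2) finV hit_nn e_nn by (intro sum_pos2[of _ w]) auto
      then have "hit 1 x y' * out_rate G 1 x > 0"
        using first_entry_prob_step[OF jump _ H_facts xVH, of 1 y'] by simp
      then show ?thesis using hit_nn[OF w(2), of y'] by (simp add: zero_less_mult_iff)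
    qed
    then show ?thesis using y' by blast
  next
    case True
    \<comment> \<open>From \<open>x\<close> in \<open>H\<close> entry is immediate, so the new
      witness is \<open>x\<close> itself; it leads to the old \<open>y'\<close> by a reduced jump of
      positive rate.\<close>
    have hx: "hit 1 x x > 0" using True by (simp add: first_entry_prob_base[OF jump _ H_facts])
    have y'V: "y' \<in> V" using y'(1) H_facts by auto
    have "rr 1 x y' > 0"
    proof (cases "w \<in> H")
      case True
      then have "w = y'"
        using y'(2) by (simp add: first_entry_prob_base[OF jump _ H_facts] split: if_splits)
      moreover have "(\<Sum>z\<in>V - H. edge_rate G 1 x z * hit 1 z y') \<ge> 0"
        using hit_nn e_nn by (intro sum_nonneg mult_nonneg_nonneg) auto
      ultimately show ?thesis using e w by (simp add: reduced_rate_eq)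
    next
      case False
      have "0 < (\<Sum>z\<in>V - H. edge_rate G 1 x z * hit 1 z y')"
        using w False e y'(2) finV hit_nn e_nn by (intro sum_pos2[of _ w]) auto
      then show ?thesis using e_nn w y'V
        by (simp add: reduced_rate_eq add_nonneg_pos)
    qed
    then have "(M, M2) \<in> (edges (effective_graph G))\<^sup>*" if M: "M \<in> \<M>" "x \<in> M" for M
    proof -
      obtain M' where M': "M' \<in> \<M>" "y' \<in> M'" using y'(1) by (auto simp: hat_verts_def)
      have "(M', M2) \<in> (edges (effective_graph G))\<^sup>*" using y'(3) M' by blast
      moreover have "M = M' \<or> (M, M') \<in> edges (effective_graph G)"
        using effective_edgeI[OF M(1) M'(1) _ M(2) M'(2) \<open>rr 1 x y' > 0\<close>] by blast
      ultimately show ?thesis by (auto intro: converse_rtrancl_into_rtrancl)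
    qed
    then show ?thesis using True hx by blast
  qed
qed

lemma effective_connected:
  assumes M: "M1 \<in> \<M>" "M2 \<in> \<M>"
  shows "(M1, M2) \<in> (edges (effective_graph G))\<^sup>*"
proof -
  obtain x y where xy: "x \<in> M1" "y \<in> M2" using minimal_classD(3) M by blast
  have V: "x \<in> V" "y \<in> V" using xy M minimal_classD(2) by auto
  obtain y' where y': "y' \<in> H" "hit 1 x y' > 0"
    "\<forall>M\<in>\<M>. y' \<in> M \<longrightarrow> (M, M2) \<in> (edges (effective_graph G))\<^sup>*"
    using effective_path[OF jump_graphD(4)[OF jump V] V(1) xy(2) M(2)] by blast
  have "x \<in> H" using xy M_subset_H[OF M(1)] by auto
  then have "y' = x" using y'(2) by (simp add: first_entry_prob_base[OF jump _ H_facts] split: if_splits)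
  then show ?thesis using y'(3) xy M by blast
qed

lemma weighted_effective_graph: "weighted_graph (effective_graph G)"
  unfolding weighted_graph_def
proof (intro conjI ballI allI impI)
  have verts: "verts (effective_graph G) = \<M>" by (simp add: effective_graph_def)
  have rate: "rate (effective_graph G) = effective_rate G" by (simp add: effective_graph_def)
  show "finite (verts (effective_graph G))" by (simp add: verts fin_classes)
  show "verts (effective_graph G) \<noteq> {}" using hat_verts_nonempty[OF jump] by (auto simp: verts hat_verts_def)
  show "edges (effective_graph G) \<subseteq> verts (effective_graph G) \<times> verts (effective_graph G)"
    using effective_edgeD by (auto simp: verts)
  show "(M1, M2) \<in> (edges (effective_graph G))\<^sup>*"
    if "M1 \<in> verts (effective_graph G)" "M2 \<in> verts (effective_graph G)" for M1 M2
    using that effective_connected by (simp add: verts)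
  show "if (M1, M2) \<in> edges (effective_graph G) then rate (effective_graph G) N M1 M2 > 0
      else rate (effective_graph G) N M1 M2 = 0" if "N > 0" for N M1 M2
    using effective_edge_iff[OF that, of M1 M2] effective_rate_nonneg[OF that, of M1 M2] by (simp add: rate)
qed

text \<open>Effective rates divided by \<open>\<rho>\<close> lie in \<open>monomial_like G\<close>,
  hence so do quotients of their products; equal total exponents make the powers of
  \<open>\<rho>\<close> cancel.\<close>

lemma assumption_A_effective_graph: "assumption_A (effective_graph G)"
  unfolding assumption_A_def
proof (intro allI impI)
  let ?E = "edges (effective_graph G)" and ?r = "\<lambda>N e. effective_rate G N (fst e) (snd e)"
  fix m n :: "'v set \<times> 'v set \<Rightarrow> nat"
  assume mn: "(\<Sum>e\<in>?E. m e) = (\<Sum>e\<in>?E. n e)"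
  define q where "q m N = (\<Prod>e\<in>?E. (?r N e / \<rho> N) ^ m e)" for m N
  have q: "q m \<in> monomial_like G" for m
    unfolding q_def[abs_def] by (intro K.prod_K K.power_K effective_edge_K) auto
  have q_eq: "q m N = (\<Prod>e\<in>?E. ?r N e ^ m e) / \<rho> N ^ (\<Sum>e\<in>?E. m e)" for m N
    by (simp add: q_def power_divide prod_dividef power_sum)
  have "has_limit (\<lambda>N. q m N / q n N)"
    by (intro monomial_like_has_limit[OF jump A] K.divide q)
  from ennreal_limit_of_has_limit[OF this]
  obtain L where "((\<lambda>N. ennreal (q m N / q n N)) \<longlongrightarrow> L) at_top" by blast
  then have "((\<lambda>N. ennreal ((\<Prod>e\<in>?E. ?r N e ^ m e) / (\<Prod>e\<in>?E. ?r N e ^ n e))) \<longlongrightarrow> L) at_top"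
  proof (rule Lim_transform_eventually)
    show "\<forall>\<^sub>F N in at_top. ennreal (q m N / q n N) = ennreal ((\<Prod>e\<in>?E. ?r N e ^ m e) / (\<Prod>e\<in>?E. ?r N e ^ n e))"
    proof (rule eventually_posI)
      fix N :: real assume "N > 0"
      then have "\<rho> N ^ k \<noteq> 0" for k using \<rho>_pos[of N] by simp
      then show "ennreal (q m N / q n N) = ennreal ((\<Prod>e\<in>?E. ?r N e ^ m e) / (\<Prod>e\<in>?E. ?r N e ^ n e))"
        using mn by (simp add: q_eq)
    qed
  qed
  then show "\<exists>L. ((\<lambda>N. ennreal ((\<Prod>(x, y)\<in>?E. rate (effective_graph G) N x y ^ m (x, y)) /
      (\<Prod>(x, y)\<in>?E. rate (effective_graph G) N x y ^ n (x, y)))) \<longlongrightarrow> L) at_top"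
    by (auto simp: split_def effective_graph_def)
qed

section \<open>Masses of the classes\<close>

lemma sum_over_classes:
  fixes f :: "'v \<Rightarrow> real"
  assumes "\<C> \<subseteq> \<M>" shows "(\<Sum>x\<in>\<Union>\<C>. f x) = (\<Sum>M\<in>\<C>. \<Sum>x\<in>M. f x)"
proof -
  have "sum f (\<Union>\<C>) = (sum \<circ> sum) f \<C>"
  proof (rule sum.Union_disjoint)
    show "\<forall>M\<in>\<C>. finite M" using assms finM by blast
    show "\<forall>M\<in>\<C>. \<forall>M'\<in>\<C>. M \<noteq> M' \<longrightarrow> M \<inter> M' = {}"
    proof (intro ballI impI)
      fix M M' assume "M \<in> \<C>" "M' \<in> \<C>" "M \<noteq> M'"
      then show "M \<inter> M' = {}" using assms minimal_class_disjoint[of M G M'] by blast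
    qed
  qed
  then show ?thesis by simp
qed

text \<open>A quotient is compared because the effective mass of a class may tend to 0. The rates
  \<open>r\<close> and the effective rates share the factors \<open>rr\<close>; only the weights
  inside the source class differ.\<close>

lemma tendsto_mass_ratio:
  assumes M: "M \<in> \<M>"
  shows "((\<lambda>N. mass N M / mass N H / inv_measure (effective_graph G) N M) \<longlongrightarrow> 1) at_top"
proof -
  let ?E = "edges (effective_graph G)" and ?s = "\<lambda>M1 M2 N. effective_rate G N M1 M2"
  have J: "jump_graph (effective_graph G)"
    by (rule weighted_graph_jump_graph[OF weighted_effective_graph])
  have verts: "verts (effective_graph G) = \<M>" by (simp add: effective_graph_def)
  define r where "r M1 M2 N = (if M1 \<noteq> M2 then
    \<Sum>y1\<in>M1. \<Sum>y2\<in>M2. \<pi> N y1 / mass N M1 * rr N y1 y2 else 0)" for M1 M2 N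
  define q where "q M1 M2 = (\<lambda>(N, b). if b then r M1 M2 N else ?s M1 M2 N)" for M1 M2
  have qKz: "q M1 M2 \<in> ratio.Kz" if M12: "M1 \<in> \<M>" "M2 \<in> \<M>" "M1 \<noteq> M2" for M1 M2
  proof -
    \<comment> \<open>The two weights on \<open>M1\<close> form one pair. Their common limit is
      positive, which puts \<open>c y\<close> in \<open>ratio_class\<close>; the reduced rates
      \<open>d\<close> are the same in both members.\<close>
    define c where "c y = (\<lambda>(N, b). if b then \<pi> N y / mass N M1 else class_measure G N M1 y)" for y
    define d where "d y1 y2 = (\<lambda>(N, b :: bool). rr N y1 y2)" for y1 y2
    have c: "c y \<in> ratio_class" if y: "y \<in> M1" for y
    proof -
      have "((\<lambda>N. (\<pi> N y / mass N M1) / class_measure G N M1 y) \<longlongrightarrow>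
          limit_measure G M1 y / limit_measure G M1 y) at_top"
        using limit_measure_pos[OF M12(1) y]
        by (intro tendsto_divide tendsto_conditional tendsto_limit_measure M12 y) auto
      then show ?thesis
        using limit_measure_pos[OF M12(1) y] pi_pos[of _ y] mass_pos[OF _ M12(1)] class_measure_pos[OF M12(1) _ y]
          subsetD[OF minimal_classD(2)[OF M12(1)] y] y
        by (simp add: ratio_class_def c_def)
    qed
    have d: "d y1 y2 \<in> ratio.Kz" if y: "y1 \<in> M1" "y2 \<in> M2" for y1 y2
    proof -
      have Kz: "(\<lambda>N. rr N y1 y2 / \<rho> N) \<in> K.Kz"
        using y M12 minimal_classD(2) by (intro reduced_rate_Kz) auto
      show ?thesis
      proof (cases "(\<lambda>N. rr N y1 y2 / \<rho> N) \<in> monomial_like G")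
        case True
        then have rr_pos: "rr N y1 y2 > 0" if "N > 0" for N
          using K.pos[OF True, of N] \<rho>_pos[OF that] that by (simp add: zero_less_divide_iff)
        have "((\<lambda>N. rr N y1 y2 / rr N y1 y2) \<longlongrightarrow> 1) at_top"
        proof (rule tendsto_cong_pos[OF tendsto_const])
          show "1 = rr N y1 y2 / rr N y1 y2" if "N > 0" for N using rr_pos[OF that] by simp
        qed
        with rr_pos show ?thesis unfolding d_def by (intro ratio.KzI) (simp only: ratio_class_def mem_Collect_eq case_prod_conv, blast)
      next
        case False
        then have "rr N y1 y2 = 0" if "N > 0" for N
          using Kz that \<rho>_pos[OF that] by (auto simp: K.Kz_def)
        then show ?thesis by (auto simp: ratio.Kz_def d_def)
      qed
    qed
    have "(\<lambda>i. \<Sum>y1\<in>M1. \<Sum>y2\<in>M2. c y1 i * d y1 y2 i) \<in> ratio.Kz"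
      by (intro ratio.Kz_sum ratio.Kz_mult[OF ratio.KzI[OF c] d])
    then show ?thesis
      by (rule ratio.Kz_cong) (use M12 in \<open>simp add: q_def r_def c_def d_def effective_rate_def split: prod.split\<close>)
  qed
  have qK: "q M1 M2 \<in> ratio_class" if "(M1, M2) \<in> ?E" for M1 M2
    using ratio.Kz_pos_iff[OF qKz, of M1 M2 "(1, False)"] effective_edgeD[OF that] effective_edge_iff[of 1 M1 M2] that
    by (simp add: q_def)
  have nonneg: "r M1 M2 N \<ge> 0" if "M1 \<in> \<M>" "M2 \<in> \<M>" "N > 0" for M1 M2 N
    using ratio.Kz_nonneg[OF qKz[OF that(1,2)], of "(N, True)"] that by (cases "M1 = M2") (auto simp: q_def r_def)
  have zero: "r M1 M2 N = 0 \<and> ?s M1 M2 N = 0"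
    if M12: "M1 \<in> \<M>" "M2 \<in> \<M>" "M1 \<noteq> M2" and E: "(M1, M2) \<notin> ?E" and N: "N > 0" for M1 M2 N
  proof -
    have s0: "?s M1 M2 N = 0" using effective_edge_iff[OF N, of M1 M2] effective_rate_nonneg[OF N, of M1 M2] E by simp
    then have "q M1 M2 \<notin> ratio_class" using ratio.pos[of "q M1 M2" "(N, False)"] N by (auto simp: q_def)
    \<comment> \<open>A pair is positive in both members or zero in both, so a missing effective
      edge makes \<open>r\<close> vanish as well.\<close>
    then have "q M1 M2 (N, True) = 0" using qKz[OF M12] N by (auto simp: ratio.Kz_def)
    then show ?thesis using s0 by (simp add: q_def)
  qed
  have edge_rate_eff: "edge_rate (effective_graph G) N M1 M2 = ?s M1 M2 N"
    if "M1 \<in> \<M>" "M2 \<in> \<M>" "N > 0" for M1 M2 N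
    using effective_edge_iff[OF that(3), of M1 M2] effective_rate_nonneg[OF that(3), of M1 M2]
    by (auto simp: edge_rate_def effective_graph_def)
  have massH: "mass N H = (\<Sum>M\<in>\<M>. mass N M)" for N
    unfolding mass_def hat_verts_def by (rule sum_over_classes) simp
  have massH_pos: "mass N H > 0" if "N > 0" for N
    using K.pos[OF mass_K[OF H_facts]] that by simp
  have flow: "(\<Sum>M1\<in>\<M>. mass N M1 * r M1 M N) = mass N M * (\<Sum>M2\<in>\<M>. r M M2 N)"
    if N: "N > 0" and M: "M \<in> \<M>" for N M
  proof -
    have HM: "H - M = \<Union>(\<M> - {M})"
      using minimal_class_disjoint[OF _ M] M by (auto simp: hat_verts_def)
    have r_mass: "mass N M1 * r M1 M2 N = (\<Sum>y1\<in>M1. \<Sum>y2\<in>M2. \<pi> N y1 * rr N y1 y2)"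
      if "M1 \<in> \<M>" "M1 \<noteq> M2" for M1 M2
      using mass_pos[OF N that(1)] that by (simp add: r_def sum_distrib_left)
    have "(\<Sum>M1\<in>\<M>. mass N M1 * r M1 M N) = (\<Sum>M1\<in>\<M> - {M}. mass N M1 * r M1 M N)"
      using fin_classes M by (simp add: sum.remove[of \<M> M] r_def)
    also have "\<dots> = (\<Sum>M1\<in>\<M> - {M}. \<Sum>y1\<in>M1. \<Sum>y2\<in>M. \<pi> N y1 * rr N y1 y2)"
      by (intro sum.cong refl r_mass) auto
    also have "\<dots> = (\<Sum>x\<in>H - M. \<Sum>y\<in>M. \<pi> N x * rr N x y)"
      unfolding HM by (rule sum_over_classes[symmetric]) auto
    also have "\<dots> = (\<Sum>y\<in>M. \<Sum>w\<in>H - M. \<pi> N y * rr N y w)"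
      by (subst sum.swap) (rule flow_balance[OF N M])
    also have "\<dots> = (\<Sum>y\<in>M. \<Sum>M2\<in>\<M> - {M}. \<Sum>w\<in>M2. \<pi> N y * rr N y w)"
      unfolding HM by (intro sum.cong refl sum_over_classes) auto
    also have "\<dots> = (\<Sum>M2\<in>\<M> - {M}. mass N M * r M M2 N)"
      by (subst sum.swap) (intro sum.cong refl r_mass[symmetric] M, auto)
    also have "\<dots> = mass N M * (\<Sum>M2\<in>\<M>. r M M2 N)"
      using fin_classes M by (simp add: sum.remove[of \<M> M] r_def sum_distrib_left)
    finally show ?thesis .
  qed
  show ?thesis
  proof (rule invariant_perturb[where V = \<M> and E = ?E and r = r and s = ?s])
    show "?E \<subseteq> \<M> \<times> \<M>" using effective_edgeD by auto
    show "r M1 M2 N > 0 \<and> ?s M1 M2 N > 0" if "(M1, M2) \<in> ?E" "N > 0" for M1 M2 N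
      using ratio.pos[OF qK[OF that(1)], of "(N, True)"] ratio.pos[OF qK[OF that(1)], of "(N, False)"] that
      by (simp add: q_def)
    show "((\<lambda>N. r M1 M2 N / ?s M1 M2 N) \<longlongrightarrow> 1) at_top" if "(M1, M2) \<in> ?E" for M1 M2
      using qK[OF that] by (simp add: ratio_class_def q_def)
    show "(\<Sum>M\<in>\<M>. mass N M / mass N H) = 1" if "N > 0" for N
      using massH_pos[OF that] by (simp add: massH flip: sum_divide_distrib)
    show "(\<Sum>M1\<in>\<M>. mass N M1 / mass N H * r M1 M N) = mass N M / mass N H * (\<Sum>M2\<in>\<M>. r M M2 N)"
      if "N > 0" "M \<in> \<M>" for N M
      using flow[OF that] by (simp flip: sum_divide_distrib)
    show "(\<Sum>M\<in>\<M>. inv_measure (effective_graph G) N M) = 1" if "N > 0" for N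
      using sum_inv_measure[OF J that] by (simp add: verts)
    show "(\<Sum>M1\<in>\<M>. inv_measure (effective_graph G) N M1 * ?s M1 M N) =
        inv_measure (effective_graph G) N M * (\<Sum>M2\<in>\<M>. ?s M M2 N)" if "N > 0" "M \<in> \<M>" for N M
      using inv_measure_balance[OF J that(1), of M] that by (simp add: verts edge_rate_eff)
    show "finite \<M>" "M \<in> \<M>" by (fact fin_classes M)+
    show "(M1, M2) \<in> ?E\<^sup>*" if "M1 \<in> \<M>" "M2 \<in> \<M>" for M1 M2
      using that by (rule effective_connected)
    show "r M1 M2 N \<ge> 0 \<and> ?s M1 M2 N \<ge> 0" if "M1 \<in> \<M>" "M2 \<in> \<M>" "N > 0" for M1 M2 N
      using nonneg[OF that] effective_rate_nonneg[OF that(3)] by blast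
    show "r M1 M2 N = 0 \<and> ?s M1 M2 N = 0"
      if "M1 \<in> \<M>" "M2 \<in> \<M>" "M1 \<noteq> M2" "(M1, M2) \<notin> ?E" "N > 0" for M1 M2 N
      using that by (rule zero)
  qed
qed

lemma tendsto_mass_hat: "((\<lambda>N. mass N H) \<longlongrightarrow> 1) at_top"
proof -
  have "((\<lambda>N. 1 - (\<Sum>z\<in>V - H. \<pi> N z)) \<longlongrightarrow> 1 - (\<Sum>z\<in>V - H. 0)) at_top"
    by (intro tendsto_diff tendsto_const tendsto_sum tendsto_off_hat)
  then have "((\<lambda>N. 1 - (\<Sum>z\<in>V - H. \<pi> N z)) \<longlongrightarrow> 1) at_top" by simp
  then show ?thesis
  proof (rule tendsto_cong_pos)
    fix N :: real assume "N > 0"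
    then show "1 - (\<Sum>z\<in>V - H. \<pi> N z) = mass N H"
      using sum.subset_diff[OF hat_verts_subset finV, of "\<pi> N"] sum_inv_measure[OF jump]
      by (simp add: mass_def)
  qed
qed

text \<open>For \<open>x\<close> in \<open>H\<close>, \<open>\<pi> N x\<close> splits into the mass
  quotient of its class, the effective measure, the mass of \<open>H\<close> and the conditioned
  weight, each with a known limit. For \<open>x\<close> outside \<open>H\<close> both sides are 0 in
  the limit.\<close>

lemma one_step:
  assumes lim: "\<And>M. M \<in> \<M> \<Longrightarrow> ((\<lambda>N. inv_measure (effective_graph G) N M) \<longlongrightarrow> b M) at_top"
    and x: "x \<in> V"
  shows "((\<lambda>N. inv_measure G N x) \<longlongrightarrow> (\<Sum>M\<in>\<M>. b M * limit_measure G M x)) at_top"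
proof (cases "x \<in> H")
  case False
  then have "limit_measure G M x = 0" if "M \<in> \<M>" for M
    using that by (intro limit_measure_outside) (auto simp: hat_verts_def)
  then show ?thesis using tendsto_off_hat[of x] False x by simp
next
  case True
  then obtain M where M: "M \<in> \<M>" "x \<in> M" by (auto simp: hat_verts_def)
  have "limit_measure G M' x = 0" if "M' \<in> \<M> - {M}" for M'
    using that M minimal_class_disjoint[of M G M' x] by (intro limit_measure_outside) auto
  then have eq: "(\<Sum>M\<in>\<M>. b M * limit_measure G M x) = b M * limit_measure G M x"
    using M fin_classes by (simp add: sum.remove[of \<M> M])
  have J: "jump_graph (effective_graph G)"
    by (rule weighted_graph_jump_graph[OF weighted_effective_graph])
  have "((\<lambda>N. mass N M / mass N H / inv_measure (effective_graph G) N M *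
      inv_measure (effective_graph G) N M * mass N H * (\<pi> N x / mass N M)) \<longlongrightarrow>
      1 * b M * 1 * limit_measure G M x) at_top"
    by (intro tendsto_mult tendsto_mass_ratio lim tendsto_mass_hat tendsto_conditional M)
  then have "((\<lambda>N. mass N M / mass N H / inv_measure (effective_graph G) N M *
      inv_measure (effective_graph G) N M * mass N H * (\<pi> N x / mass N M)) \<longlongrightarrow> b M * limit_measure G M x) at_top"
    by simp
  then show ?thesis
    unfolding eq
  proof (rule tendsto_cong_pos)
    fix N :: real assume N: "N > 0"
    have "inv_measure (effective_graph G) N M > 0"
      using inv_measure_pos[OF J N] M by (simp add: effective_graph_def)
    then show "mass N M / mass N H / inv_measure (effective_graph G) N M *
      inv_measure (effective_graph G) N M * mass N H * (\<pi> N x / mass N M) = \<pi> N x"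
      using mass_pos[OF N M(1)] K.pos[OF mass_K[OF H_facts], of N] N by simp
  qed
qed

lemma inv_measure_converges:
  assumes "x \<in> V" shows "\<exists>L\<ge>0. ((\<lambda>N. inv_measure G N x) \<longlongrightarrow> L) at_top"
  using bounded_K_tendsto[OF pi_K[OF assms], of 1] inv_measure_le_1[OF jump] by blast

text \<open>If \<open>a\<close> is the source of a fast edge that is not a loop, every minimal class is the class of some
  vertex other than \<open>a\<close>.\<close>

lemma card_minimal_classes_less:
  assumes "card V \<noteq> 1" and loopless: "\<And>x. (x, x) \<notin> edges G"
  shows "card \<M> < card V"
proof -
  have V: "card V \<noteq> 0" using finV jump_graphD(2)[OF jump] by simp
  then obtain x y where xy: "x \<in> V" "y \<in> V" "x \<noteq> y"
    using assms(1) jump_graphD(2)[OF jump] is_singletonI'[of V] is_singleton_altdef[of V] by blast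
  have "edges G \<noteq> {}"
    using jump_graphD(4)[OF jump xy(1,2)] xy(3) by (auto elim: converse_rtranclE)
  from fastest_edge_exists[OF jump A this] obtain a b where e: "(a, b) \<in> edges G"
    and fastest: "\<And>x y. (x, y) \<in> edges G \<Longrightarrow> \<exists>L\<ge>0. ((\<lambda>N. rate G N x y / rate G N a b) \<longlongrightarrow> L) at_top"
    by blast
  have "\<exists>L. ((\<lambda>N. rate G N x y / rate G N a b) \<longlongrightarrow> L) at_top" if "(x, y) \<in> edges G" for x y
    using fastest[OF that] by blast
  then have ab: "(a, b) \<in> fast_edges G"
    using e by (simp add: fast_edges_def split_def)
  have abV: "(a, b) \<in> edges G" "a \<in> V" "b \<in> V" "a \<noteq> b"
    using ab fast_edges_subset[of G] jump_graphD(3)[OF jump] loopless by auto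
  define cls where "cls x = {y \<in> V. (x, y) \<in> (fast_edges G)\<^sup>* \<and> (y, x) \<in> (fast_edges G)\<^sup>*}" for x
  have "\<M> \<subseteq> cls ` (V - {a})"
  proof
    fix M assume M: "M \<in> \<M>"
    obtain c where "c \<in> M" "c \<noteq> a"
      using minimal_class_closed[OF jump M _ ab] minimal_classD(3)[OF M] abV by blast
    then show "M \<in> cls ` (V - {a})"
      using fast_class_eq[OF minimal_classD(1)[OF M]] minimal_classD(2)[OF M] by (auto simp: cls_def)
  qed
  then have "card \<M> \<le> card (V - {a})"
    using finV by (intro surj_card_le) auto
  also have "\<dots> < card V" by (rule card_Diff1_less[OF finV abV(2)])
  finally show ?thesis .
qed

end

section \<open>The hierarchy of levels\<close>

context
  fixes G :: "'v wgraph" and f :: "'v \<Rightarrow> 'w" and g :: "'w \<Rightarrow> 'v"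
  assumes G: "weighted_graph G" and gf: "\<And>x. x \<in> verts G \<Longrightarrow> g (f x) = x"
begin

lemma map_wgraph_sel:
  "verts (map_wgraph f g G) = f ` verts G" "edges (map_wgraph f g G) = map_prod f f ` edges G"
  "rate (map_wgraph f g G) N a b = rate G N (g a) (g b)"
  by (simp_all add: map_wgraph_def)

lemma map_wgraph_inj: "inj_on f (verts G)"
  using gf by (rule inj_on_inverseI)

lemma map_wgraph_edges_subset: "edges G \<subseteq> verts G \<times> verts G"
  by (rule jump_graphD(3)[OF weighted_graph_jump_graph[OF G]])

lemma map_wgraph_edge_iff:
  "x \<in> verts G \<Longrightarrow> y \<in> verts G \<Longrightarrow> (f x, f y) \<in> edges (map_wgraph f g G) \<longleftrightarrow> (x, y) \<in> edges G"
proof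
  assume xy: "x \<in> verts G" "y \<in> verts G" and "(f x, f y) \<in> edges (map_wgraph f g G)"
  then obtain x' y' where e: "(x', y') \<in> edges G" "f x = f x'" "f y = f y'"
    by (auto simp: map_wgraph_sel)
  then have "x' \<in> verts G" "y' \<in> verts G" using map_wgraph_edges_subset by auto
  then show "(x, y) \<in> edges G" using e xy inj_onD[OF map_wgraph_inj] by metis
next
  assume "(x, y) \<in> edges G"
  then have "map_prod f f (x, y) \<in> map_prod f f ` edges G" by (rule imageI)
  then show "(f x, f y) \<in> edges (map_wgraph f g G)" by (simp add: map_wgraph_sel)
qed

lemma weighted_graph_map_wgraph: "weighted_graph (map_wgraph f g G)"
  unfolding weighted_graph_def
proof (intro conjI ballI allI impI)
  show "finite (verts (map_wgraph f g G))" "verts (map_wgraph f g G) \<noteq> {}"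
    using G by (auto simp: map_wgraph_sel weighted_graph_def)
  show "edges (map_wgraph f g G) \<subseteq> verts (map_wgraph f g G) \<times> verts (map_wgraph f g G)"
    using map_wgraph_edges_subset by (auto simp: map_wgraph_sel)
  fix a b assume "a \<in> verts (map_wgraph f g G)" "b \<in> verts (map_wgraph f g G)"
  then obtain x y where xy: "a = f x" "b = f y" "x \<in> verts G" "y \<in> verts G"
    by (auto simp: map_wgraph_sel)
  have "(x, y) \<in> (edges G)\<^sup>*" using G xy by (simp add: weighted_graph_def)
  then have "(f x, f y) \<in> (edges (map_wgraph f g G))\<^sup>*"
    by (induction rule: rtrancl_induct) (auto simp: map_wgraph_sel intro: rtrancl.rtrancl_into_rtrancl)
  then show "(a, b) \<in> (edges (map_wgraph f g G))\<^sup>*" using xy by simp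
  show "if (a, b) \<in> edges (map_wgraph f g G) then rate (map_wgraph f g G) N a b > 0
      else rate (map_wgraph f g G) N a b = 0" if "N > 0" for N
    using G xy that by (simp add: map_wgraph_edge_iff map_wgraph_sel(3) gf weighted_graph_def)
qed

lemma assumption_A_map_wgraph:
  assumes A: "assumption_A G" shows "assumption_A (map_wgraph f g G)"
  unfolding assumption_A_def
proof (intro allI impI)
  fix m n :: "'w \<times> 'w \<Rightarrow> nat"
  let ?h = "map_prod f f"
  assume mn: "(\<Sum>e\<in>edges (map_wgraph f g G). m e) = (\<Sum>e\<in>edges (map_wgraph f g G). n e)"
  have inj: "inj_on ?h (edges G)"
    using map_prod_inj_on[OF map_wgraph_inj map_wgraph_inj] map_wgraph_edges_subset by (rule inj_on_subset)
  have sum: "(\<Sum>e\<in>edges (map_wgraph f g G). m e) = (\<Sum>e\<in>edges G. (m \<circ> ?h) e)" for m :: "'w \<times> 'w \<Rightarrow> nat"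
    by (simp add: map_wgraph_sel sum.reindex[OF inj])
  have prod: "(\<Prod>(x, y)\<in>edges (map_wgraph f g G). rate (map_wgraph f g G) N x y ^ m (x, y)) =
      (\<Prod>(x, y)\<in>edges G. rate G N x y ^ (m \<circ> ?h) (x, y))" for m :: "'w \<times> 'w \<Rightarrow> nat" and N
    unfolding map_wgraph_sel(2) prod.reindex[OF inj]
    using map_wgraph_edges_subset gf by (intro prod.cong) (auto simp: map_wgraph_sel)
  show "\<exists>L. ((\<lambda>N. ennreal ((\<Prod>(x, y)\<in>edges (map_wgraph f g G). rate (map_wgraph f g G) N x y ^ m (x, y)) /
      (\<Prod>(x, y)\<in>edges (map_wgraph f g G). rate (map_wgraph f g G) N x y ^ n (x, y)))) \<longlongrightarrow> L) at_top"
    using A[unfolded assumption_A_def] mn[unfolded sum] unfolding prod by blast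
qed

text \<open>The transported measure satisfies the balance equations of the renamed graph, so
  uniqueness makes it the one chosen by \<open>THE\<close>.\<close>

lemma inv_measure_map_wgraph:
  assumes N: "N > 0" and x: "x \<in> verts G"
  shows "inv_measure (map_wgraph f g G) N (f x) = inv_measure G N x"
proof -
  let ?W = "map_wgraph f g G"
  have J: "jump_graph G" "jump_graph ?W"
    using G weighted_graph_map_wgraph by (auto intro: weighted_graph_jump_graph)
  define \<mu> where "\<mu> a = (if a \<in> verts ?W then inv_measure G N (g a) else 0)" for a
  have \<mu>f: "\<mu> (f x) = inv_measure G N x" if "x \<in> verts G" for x
    using that gf by (simp add: \<mu>_def map_wgraph_sel)
  have e: "edge_rate ?W N (f x) (f y) = edge_rate G N x y" if "x \<in> verts G" "y \<in> verts G" for x y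
    using that gf by (simp add: edge_rate_def map_wgraph_edge_iff map_wgraph_sel(3))
  have "invariant_prob ?W N \<mu>"
    unfolding invariant_prob_iff[OF jump_graphD(1,3)[OF J(2)]]
  proof (intro conjI ballI)
    show "measure_on (verts ?W) \<mu>"
      using inv_measure_nonneg[OF J(1) N] by (simp add: measure_on_def \<mu>_def)
    show "(\<Sum>a\<in>verts ?W. \<mu> a) = 1"
      using sum_inv_measure[OF J(1) N] by (simp add: map_wgraph_sel(1) sum.reindex[OF map_wgraph_inj] \<mu>f)
    fix b assume "b \<in> verts ?W"
    then obtain y where y: "b = f y" "y \<in> verts G" by (auto simp: map_wgraph_sel)
    show "(\<Sum>a\<in>verts ?W. \<mu> a * edge_rate ?W N a b) = \<mu> b * (\<Sum>c\<in>verts ?W. edge_rate ?W N b c)"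
      using inv_measure_balance[OF J(1) N y(2)] y
      by (simp add: map_wgraph_sel(1) sum.reindex[OF map_wgraph_inj] \<mu>f e)
  qed
  then have "inv_measure ?W N = \<mu>"
    using invariant_prob_ex1[OF J(2) N] inv_measure_invariant[OF J(2) N] by blast
  then show ?thesis using \<mu>f[OF x] by simp
qed

end

lemma elems_Cls: "finite M \<Longrightarrow> elems (Cls (Abs_fset M)) = M"
  by (simp add: elems_def Abs_fset_inverse)

declare level_graph.simps(2) [simp del]

section \<open>Limit laws along the levels\<close>

locale hierarchy =
  fixes G :: "'a wgraph"
  assumes weighted: "weighted_graph G" and A: "assumption_A G"
begin

abbreviation "L \<equiv> level_graph G"

lemma level_scaled_step:
  assumes "scaled_graph (L i) \<rho>"
  shows "weighted_graph (L (Suc i)) \<and> assumption_A (L (Suc i)) \<and>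
    (\<forall>N>0. \<forall>M\<in>minimal_classes (L i). inv_measure (L (Suc i)) N (Cls (Abs_fset M)) = inv_measure (effective_graph (L i)) N M)"
proof -
  interpret scaled_graph "L i" \<rho> by fact
  \<comment> \<open>\<open>Abs_fset\<close> can be inverted on finite sets only; finiteness of the
    classes makes the encoding faithful.\<close>
  have "elems (Cls (Abs_fset M)) = M" if "M \<in> verts (effective_graph (L i))" for M
    using that finM by (intro elems_Cls) (simp add: effective_graph_def)
  note * = this
  let ?f = "\<lambda>M. Cls (Abs_fset M)"
  have "weighted_graph (L (Suc i))"
    unfolding level_graph.simps by (rule weighted_graph_map_wgraph[where f = ?f, OF weighted_effective_graph *])
  moreover have "assumption_A (L (Suc i))"
    unfolding level_graph.simps
    by (rule assumption_A_map_wgraph[where f = ?f, OF weighted_effective_graph * assumption_A_effective_graph])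
  moreover have "inv_measure (L (Suc i)) N (?f M) = inv_measure (effective_graph (L i)) N M"
    if "N > 0" "M \<in> minimal_classes (L i)" for N M
    unfolding level_graph.simps
    by (rule inv_measure_map_wgraph[where f = ?f, OF weighted_effective_graph * that(1)])
      (use that in \<open>simp_all add: effective_graph_def\<close>)
  ultimately show ?thesis by blast
qed

lemma level_weighted_A: "weighted_graph (L i) \<and> assumption_A (L i)"
proof (induction i)
  case 0
  have *: "\<And>x. x \<in> verts G \<Longrightarrow> the_vtx (Vtx x) = x" by simp
  show ?case
    using weighted_graph_map_wgraph[where f = Vtx, OF weighted *] assumption_A_map_wgraph[where f = Vtx, OF weighted * A]
    by simp
next
  case (Suc i)
  then show ?case using scaled_graph_exists level_scaled_step by blast
qed

lemma level_scaled: "\<exists>\<rho>. scaled_graph (L i) \<rho>"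
  using level_weighted_A scaled_graph_exists by blast

lemma level_jump: "jump_graph (L i)"
  using level_weighted_A weighted_graph_jump_graph by blast

lemma finite_minimal_class: "M \<in> minimal_classes (L i) \<Longrightarrow> finite M"
  using minimal_classD(2) jump_graphD(1)[OF level_jump] finite_subset by blast

lemma level_Suc: "level G (Suc i) = (\<lambda>M. Cls (Abs_fset M)) ` minimal_classes (L i)"
  by (simp add: level_def level_graph.simps map_wgraph_def effective_graph_def)

lemma level_0: "level G 0 = Vtx ` verts G"
  by (simp add: level_def map_wgraph_def)

lemma level_SucD:
  assumes "c \<in> level G (Suc i)"
  shows "elems c \<in> minimal_classes (L i)" "c = Cls (Abs_fset (elems c))" "elems c \<subseteq> level G i"
proof -
  obtain M where "M \<in> minimal_classes (L i)" "c = Cls (Abs_fset M)"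
    using assms by (auto simp: level_Suc)
  moreover from this have "elems c = M" by (simp add: elems_Cls finite_minimal_class)
  ultimately show "elems c \<in> minimal_classes (L i)" "c = Cls (Abs_fset (elems c))" "elems c \<subseteq> level G i"
    using minimal_classD(2)[of M "L i"] by (auto simp: level_def)
qed

lemma elems_disjoint:
  assumes "c \<in> level G (Suc i)" "c' \<in> level G (Suc i)" "y \<in> elems c" "y \<in> elems c'"
  shows "c = c'"
  using minimal_class_disjoint[OF level_SucD(1)[OF assms(1)] level_SucD(1)[OF assms(2)] assms(3,4)]
    level_SucD(2)[OF assms(1)] level_SucD(2)[OF assms(2)] by simp

lemma finite_level: "finite (level G i)"
  using jump_graphD(1)[OF level_jump] by (simp add: level_def)

lemma inj_on_Cls: "inj_on (\<lambda>M. Cls (Abs_fset M)) (minimal_classes (L i))"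
  by (rule inj_on_inverseI[of _ elems]) (simp add: elems_Cls finite_minimal_class)

lemma level_converges:
  assumes "y \<in> level G i"
  shows "\<exists>p\<ge>0. ((\<lambda>N. inv_measure (L i) N y) \<longlongrightarrow> p) at_top"
proof -
  obtain \<rho> where "scaled_graph (L i) \<rho>" using level_scaled by blast
  then show ?thesis using assms unfolding level_def by (rule scaled_graph.inv_measure_converges)
qed

text \<open>The candidate solution of the recursion: the limit law at every level, not only at the
  bottom. The value 0 off the level makes it a measure in the sense of
  \<open>measure_on\<close>.\<close>

definition lim_measure :: "nat \<Rightarrow> 'a hvert \<Rightarrow> real" where
  "lim_measure i y = (if y \<in> level G i then Lim at_top (\<lambda>N. inv_measure (L i) N y) else 0)"

lemma lim_measure_aux:
  assumes "y \<in> level G i"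
  shows tendsto_lim_measure: "((\<lambda>N. inv_measure (L i) N y) \<longlongrightarrow> lim_measure i y) at_top"
    and lim_measure_nonneg: "lim_measure i y \<ge> 0"
proof -
  obtain p where p: "p \<ge> 0" "((\<lambda>N. inv_measure (L i) N y) \<longlongrightarrow> p) at_top"
    using level_converges[OF assms] by blast
  have "lim_measure i y = p"
    using assms tendsto_Lim[OF trivial_limit_at_top_linorder p(2)] by (simp add: lim_measure_def)
  then show "((\<lambda>N. inv_measure (L i) N y) \<longlongrightarrow> lim_measure i y) at_top" "lim_measure i y \<ge> 0"
    using p by simp_all
qed

lemma lim_measure_step:
  assumes y: "y \<in> level G i"
  shows "lim_measure i y = (\<Sum>c\<in>level G (Suc i). lim_measure (Suc i) c * level_measure G i c y)"
proof -
  obtain \<rho> where \<rho>: "scaled_graph (L i) \<rho>" using level_scaled by blast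
  have "((\<lambda>N. inv_measure (effective_graph (L i)) N M) \<longlongrightarrow> lim_measure (Suc i) (Cls (Abs_fset M))) at_top"
    if M: "M \<in> minimal_classes (L i)" for M
  proof -
    have "((\<lambda>N. inv_measure (L (Suc i)) N (Cls (Abs_fset M))) \<longlongrightarrow> lim_measure (Suc i) (Cls (Abs_fset M))) at_top"
      using M by (intro tendsto_lim_measure) (simp add: level_Suc)
    then show ?thesis
      by (rule scaled_graph.tendsto_cong_pos[OF \<rho>]) (use level_scaled_step[OF \<rho>] M in simp)
  qed
  from scaled_graph.one_step[OF \<rho> this] y
  have "((\<lambda>N. inv_measure (L i) N y) \<longlongrightarrow>
      (\<Sum>M\<in>minimal_classes (L i). lim_measure (Suc i) (Cls (Abs_fset M)) * limit_measure (L i) M y)) at_top"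
    by (simp add: level_def)
  then have "lim_measure i y =
      (\<Sum>M\<in>minimal_classes (L i). lim_measure (Suc i) (Cls (Abs_fset M)) * limit_measure (L i) M y)"
    using tendsto_lim_measure[OF y] tendsto_unique[OF trivial_limit_at_top_linorder] by blast
  also have "\<dots> = (\<Sum>c\<in>level G (Suc i). lim_measure (Suc i) c * level_measure G i c y)"
    by (simp add: level_Suc sum.reindex[OF inj_on_Cls] level_measure_def elems_Cls finite_minimal_class)
  finally show ?thesis .
qed

lemma level_measure_outside:
  assumes c: "c \<in> level G (Suc i)" and y: "y \<notin> elems c"
  shows "level_measure G i c y = 0"
proof -
  obtain \<rho> where "scaled_graph (L i) \<rho>" using level_scaled by blast
  then show ?thesis
    unfolding level_measure_def by (rule scaled_graph.limit_measure_outside[OF _ level_SucD(1)[OF c] y])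
qed

text \<open>The decrease is claimed from level 1 on. The given graph may have loops, and if all fast
  edges are loops, every vertex is a minimal class of its own and the next level is no smaller.
  Effective graphs have no loops.\<close>

lemma card_level_less:
  assumes "card (level G (Suc i)) \<noteq> 1"
  shows "card (level G (Suc (Suc i))) < card (level G (Suc i))"
proof -
  obtain \<rho> where \<rho>: "scaled_graph (L (Suc i)) \<rho>" using level_scaled by blast
  obtain \<rho>' where \<rho>': "scaled_graph (L i) \<rho>'" using level_scaled by blast
  have "(c, c) \<notin> edges (L (Suc i))" for c
  proof
    assume "(c, c) \<in> edges (L (Suc i))"
    then obtain M M' where M: "(M, M') \<in> edges (effective_graph (L i))"
      "Cls (Abs_fset M) = Cls (Abs_fset M')"
      by (auto simp: level_graph.simps map_wgraph_def)
    have "M \<in> minimal_classes (L i)" "M' \<in> minimal_classes (L i)" "M \<noteq> M'"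
      using scaled_graph.effective_edgeD[OF \<rho>' M(1)] by auto
    then show False using M(2) inj_onD[OF inj_on_Cls] by blast
  qed
  from scaled_graph.card_minimal_classes_less[OF \<rho> _ this] assms
  have "card (minimal_classes (L (Suc i))) < card (level G (Suc i))" by (simp add: level_def)
  then show ?thesis by (simp add: level_Suc[of "Suc i"] card_image[OF inj_on_Cls])
qed

lemma card_top_level: "card (level G (top_level G)) = 1"
proof -
  have "\<exists>i. card (level G i) = 1"
  proof (rule ccontr)
    assume none: "\<nexists>i. card (level G i) = 1"
    \<comment> \<open>Each step loses at least one element, so more steps than elements are
      absurd.\<close>
    have "card (level G (Suc i)) + i \<le> card (level G 1)" for i
    proof (induction i)
      case (Suc i)
      then show ?case using card_level_less[of i] none by fastforce
    qed simp
    from this[of "Suc (card (level G 1))"] show False by simp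
  qed
  then show ?thesis unfolding top_level_def by (rule LeastI_ex)
qed

lemma level_top: "level G (top_level G) = {root_class G}"
  using card_top_level by (metis card_1_singletonE root_class_def the_elem_eq)

lemma lim_measure_root: "lim_measure (top_level G) (root_class G) = 1"
proof -
  have "inv_measure (L (top_level G)) N (root_class G) = 1" if "N > 0" for N
    using sum_inv_measure[OF level_jump[of "top_level G"] that] level_top by (simp add: level_def)
  then have "((\<lambda>N. inv_measure (L (top_level G)) N (root_class G)) \<longlongrightarrow> 1) at_top"
    by (intro tendsto_eventually eventually_mono[OF eventually_gt_at_top[of 0]]) auto
  moreover have "((\<lambda>N. inv_measure (L (top_level G)) N (root_class G)) \<longlongrightarrow>
      lim_measure (top_level G) (root_class G)) at_top"
    by (rule tendsto_lim_measure) (simp add: level_top)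
  ultimately show ?thesis using tendsto_unique[OF trivial_limit_at_top_linorder] by blast
qed

section \<open>The recursion and its unique solution\<close>

lemma lim_measure_solves: "solves_recursion G lim_measure"
  unfolding solves_recursion_def
proof (intro conjI allI impI ballI)
  show "measure_on (level G i) (lim_measure i)" for i
    using lim_measure_nonneg by (simp add: measure_on_def lim_measure_def)
  show "lim_measure (i - 1) y = (\<Sum>c\<in>level G i. lim_measure i c * level_measure G (i - 1) c y)"
    if "i \<in> {1..top_level G}" "y \<in> level G (i - 1)" for i y
    using lim_measure_step[OF that(2)] that(1) by simp
qed (rule lim_measure_root)

text \<open>Downward induction, since level \<open>i\<close> is determined by level
  \<open>Suc i\<close>. Off the levels both solutions vanish by \<open>measure_on\<close>, so they
  agree as functions.\<close>

lemma solution_unique: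
  assumes "solves_recursion G \<rho>" "solves_recursion G \<rho>'" "i \<le> top_level G"
  shows "\<rho> i = \<rho>' i"
  using assms(3)
proof (induction rule: inc_induct)
  case base
  show ?case
  proof
    fix c show "\<rho> (top_level G) c = \<rho>' (top_level G) c"
      using assms(1,2) by (cases "c \<in> level G (top_level G)")
        (auto simp: solves_recursion_def measure_on_def level_top)
  qed
next
  case (step i)
  have out: "\<rho> i y = 0" "\<rho>' i y = 0" if "y \<notin> level G i" for y
    using assms(1,2) step(2) that by (auto simp: solves_recursion_def measure_on_def)
  have rec: "\<sigma> i y = (\<Sum>c\<in>level G (Suc i). \<sigma> (Suc i) c * level_measure G i c y)"
    if "solves_recursion G \<sigma>" "y \<in> level G i" for \<sigma> y
  proof -
    have "\<forall>i\<in>{1..top_level G}. \<forall>y\<in>level G (i - 1).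
        \<sigma> (i - 1) y = (\<Sum>c\<in>level G i. \<sigma> i c * level_measure G (i - 1) c y)"
      using that(1) unfolding solves_recursion_def by (elim conjE)
    from bspec[OF bspec[OF this, of "Suc i"], of y] show ?thesis using that(2) step(2) by simp
  qed
  show ?case
  proof
    fix y show "\<rho> i y = \<rho>' i y"
      using out[of y] rec[OF assms(1), of y] rec[OF assms(2), of y] step.IH by (cases "y \<in> level G i") auto
  qed
qed

section \<open>Supports, paths and the product formula\<close>

lemma Su_level_Suc:
  assumes "c \<in> level G (Suc i)" shows "Su c = (\<Union>d\<in>elems c. Su d)"
proof -
  obtain A where "c = Cls A" using level_SucD(2)[OF assms] by (rule that)
  then show ?thesis by (simp add: elems_def)
qed

text \<open>Supports inherit disjointness from the classes, level by level. Hence \<open>x\<close>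
  alone determines the entry of a path at each level, which gives uniqueness of paths.\<close>

lemma Su_disjoint:
  assumes "c \<in> level G i" "c' \<in> level G i" "x \<in> Su c" "x \<in> Su c'"
  shows "c = c'"
  using assms
proof (induction i arbitrary: c c')
  case 0
  then show ?case by (auto simp: level_0)
next
  case (Suc i)
  obtain d d' where d: "d \<in> elems c" "x \<in> Su d" "d' \<in> elems c'" "x \<in> Su d'"
    using Suc.prems by (auto simp: Su_level_Suc)
  have "d = d'"
    using d level_SucD(3)[OF Suc.prems(1)] level_SucD(3)[OF Suc.prems(2)] by (intro Suc.IH) auto
  then show ?case using elems_disjoint[OF Suc.prems(1,2)] d by blast
qed

lemma path_exists:
  assumes "c \<in> level G i" "x \<in> Su c"
  shows "\<exists>\<gamma>. length \<gamma> = Suc i \<and> \<gamma> ! 0 = Vtx x \<and> \<gamma> ! i = c \<and>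
    (\<forall>j\<le>i. \<gamma> ! j \<in> level G j) \<and> (\<forall>j<i. \<gamma> ! j \<in> elems (\<gamma> ! Suc j))"
  using assms
proof (induction i arbitrary: c)
  case 0
  then show ?case by (intro exI[of _ "[c]"]) (auto simp: level_0)
next
  case (Suc i)
  obtain d where d: "d \<in> elems c" "x \<in> Su d"
    using Suc.prems by (auto simp: Su_level_Suc)
  then obtain \<gamma> where \<gamma>: "length \<gamma> = Suc i" "\<gamma> ! 0 = Vtx x" "\<gamma> ! i = d"
    "\<forall>j\<le>i. \<gamma> ! j \<in> level G j" "\<forall>j<i. \<gamma> ! j \<in> elems (\<gamma> ! Suc j)"
    using Suc.IH[of d] level_SucD(3)[OF Suc.prems(1)] by blast
  \<comment> \<open>Paths are listed from the bottom, so the new top \<open>c\<close> is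
    appended.\<close>
  then show ?case
    using Suc.prems(1) d
    by (intro exI[of _ "\<gamma> @ [c]"]) (auto simp: nth_append le_Suc_eq less_Suc_eq)
qed

lemma hier_path_step:
  "hier_path G x \<gamma> \<Longrightarrow> i < top_level G \<Longrightarrow> \<gamma> ! i \<in> elems (\<gamma> ! Suc i)"
  unfolding hier_path_def by (elim conjE) (drule bspec[of _ _ "Suc i"], auto)

lemma hier_path_Su:
  assumes "hier_path G x \<gamma>" "i \<le> top_level G" shows "x \<in> Su (\<gamma> ! i)"
  using assms(2)
proof (induction i)
  case 0
  then show ?case using assms(1) by (simp add: hier_path_def)
next
  case (Suc i)
  then have "\<gamma> ! Suc i \<in> level G (Suc i)" using assms(1) by (simp add: hier_path_def)
  then show ?case using Suc hier_path_step[OF assms(1), of i] by (auto simp: Su_level_Suc)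
qed

lemma hier_path_ex1:
  assumes "x \<in> Su (root_class G)"
  shows "\<exists>!\<gamma>. hier_path G x \<gamma>"
proof (rule ex_ex1I)
  obtain \<gamma> where \<gamma>: "length \<gamma> = Suc (top_level G)" "\<gamma> ! 0 = Vtx x" "\<gamma> ! top_level G = root_class G"
    "\<forall>j\<le>top_level G. \<gamma> ! j \<in> level G j" "\<forall>j<top_level G. \<gamma> ! j \<in> elems (\<gamma> ! Suc j)"
    using path_exists[of "root_class G" "top_level G" x] assms level_top by blast
  have "\<gamma> ! (i - 1) \<in> elems (\<gamma> ! i)" if "i \<in> {1..top_level G}" for i
    using \<gamma>(5)[rule_format, of "i - 1"] that by (cases i) simp_all
  then show "\<exists>\<gamma>. hier_path G x \<gamma>" using \<gamma>(1-4) unfolding hier_path_def by blast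
  fix \<gamma> \<gamma>' assume *: "hier_path G x \<gamma>" "hier_path G x \<gamma>'"
  show "\<gamma> = \<gamma>'"
  proof (rule nth_equalityI)
    show "length \<gamma> = length \<gamma>'" using * by (simp add: hier_path_def)
    fix i assume "i < length \<gamma>"
    then have "i \<le> top_level G" using * by (simp add: hier_path_def)
    then show "\<gamma> ! i = \<gamma>' ! i"
      using * hier_path_Su by (intro Su_disjoint[of _ i _ x]) (auto simp: hier_path_def)
  qed
qed

text \<open>Among the classes of the next level only \<open>c\<close> contains \<open>y\<close>, so
  a single summand of the recursion survives.\<close>

lemma lim_measure_path_step:
  assumes c: "c \<in> level G (Suc i)" and y: "y \<in> elems c"
  shows "lim_measure i y = lim_measure (Suc i) c * level_measure G i c y"
proof -
  have "level_measure G i c' y = 0" if "c' \<in> level G (Suc i) - {c}" for c'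
    using that elems_disjoint[OF c _ y] by (intro level_measure_outside) auto
  then show ?thesis
    using lim_measure_step[of y i] level_SucD(3)[OF c] y c finite_level
    by (auto simp: sum.remove[of _ c])
qed

lemma lim_measure_path:
  assumes \<gamma>: "hier_path G x \<gamma>" and i: "i \<le> top_level G"
  shows "lim_measure 0 (Vtx x) =
    lim_measure i (\<gamma> ! i) * (\<Prod>j=1..i. level_measure G (j - 1) (\<gamma> ! j) (\<gamma> ! (j - 1)))"
  using i
proof (induction i)
  case 0
  then show ?case using \<gamma> by (simp add: hier_path_def)
next
  case (Suc i)
  have "\<gamma> ! Suc i \<in> level G (Suc i)" using \<gamma> Suc.prems by (simp add: hier_path_def)
  from lim_measure_path_step[OF this hier_path_step[OF \<gamma>]] Suc
  show ?case by (simp add: mult_ac)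
qed

text \<open>A nonzero value needs a nonzero summand in the recursion, that is, a class of the next
  level that contains the point and has a nonzero value itself. Repeated up to the root, this would
  put \<open>x\<close> into its support.\<close>

lemma lim_measure_off_root:
  assumes x: "x \<in> verts G" and root: "x \<notin> Su (root_class G)"
  shows "lim_measure 0 (Vtx x) = 0"
proof (rule ccontr)
  assume neq: "lim_measure 0 (Vtx x) \<noteq> 0"
  have "\<exists>c\<in>level G i. x \<in> Su c \<and> lim_measure i c \<noteq> 0" for i
  proof (induction i)
    case 0
    then show ?case using neq x by (auto simp: level_0)
  next
    case (Suc i)
    then obtain y where y: "y \<in> level G i" "x \<in> Su y" "lim_measure i y \<noteq> 0" by blast
    then obtain c where c: "c \<in> level G (Suc i)" "lim_measure (Suc i) c * level_measure G i c y \<noteq> 0"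
      using lim_measure_step[OF y(1)] by (metis (lifting) sum.not_neutral_contains_not_neutral)
    then have "y \<in> elems c" using level_measure_outside[OF c(1), of y] by auto
    then show ?case using c y by (auto simp: Su_level_Suc)
  qed
  from this[of "top_level G"] show False using root by (simp add: level_top)
qed

end

text \<open>The first two clauses secure the definitions: a level with one element gives meaning to
  \<open>LEAST\<close> and \<open>the_elem\<close>, and unique existence of the invariant measure
  does so for \<open>THE\<close>.\<close>

theorem theorem3p1:
  fixes G :: "'a wgraph"
  assumes "weighted_graph G" and "assumption_A G"
  shows "card (level G (top_level G)) = 1 \<and>
    (\<forall>N>0. \<exists>!\<mu>. invariant_prob G N \<mu>) \<and>
    (\<exists>\<pi>. (\<forall>x\<in>verts G. ((\<lambda>N. inv_measure G N x) \<longlongrightarrow> \<pi> x) at_top) \<and>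
      (\<exists>\<rho>. solves_recursion G \<rho> \<and>
        (\<forall>\<rho>'. solves_recursion G \<rho>' \<longrightarrow> (\<forall>i\<le>top_level G. \<rho>' i = \<rho> i)) \<and>
        (\<forall>x\<in>verts G. \<pi> x = \<rho> 0 (Vtx x))) \<and>
      (\<forall>x\<in>verts G.
        (x \<in> Su (root_class G) \<longrightarrow>
          (\<exists>!\<gamma>. hier_path G x \<gamma>) \<and>
          (\<forall>\<gamma>. hier_path G x \<gamma> \<longrightarrow>
            \<pi> x = (\<Prod>i=1..top_level G. level_measure G (i - 1) (\<gamma> ! i) (\<gamma> ! (i - 1))))) \<and>
        (x \<notin> Su (root_class G) \<longrightarrow> \<pi> x = 0)))"
proof -
  interpret hierarchy G using assms by unfold_locales
  have J: "jump_graph G" using weighted by (rule weighted_graph_jump_graph)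
  \<comment> \<open>Level 0 is \<open>G\<close> renamed along \<open>Vtx\<close>, so its limit law
    is the limit for \<open>G\<close>.\<close>
  have lim: "((\<lambda>N. inv_measure G N x) \<longlongrightarrow> lim_measure 0 (Vtx x)) at_top" if x: "x \<in> verts G" for x
  proof -
    have "inv_measure (L 0) N (Vtx x) = inv_measure G N x" if "N > 0" for N
      using inv_measure_map_wgraph[OF weighted _ that x, of the_vtx Vtx] by simp
    moreover have "((\<lambda>N. inv_measure (L 0) N (Vtx x)) \<longlongrightarrow> lim_measure 0 (Vtx x)) at_top"
      using x by (intro tendsto_lim_measure) (simp add: level_0)
    ultimately show ?thesis
      by (elim Lim_transform_eventually) (auto intro!: eventually_mono[OF eventually_gt_at_top[of 0]])
  qed
  have path: "lim_measure 0 (Vtx x) = (\<Prod>i=1..top_level G. level_measure G (i - 1) (\<gamma> ! i) (\<gamma> ! (i - 1)))"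
    if "hier_path G x \<gamma>" for x \<gamma>
    using lim_measure_path[OF that order.refl] that lim_measure_root by (simp add: hier_path_def)
  have "\<forall>\<rho>'. solves_recursion G \<rho>' \<longrightarrow> (\<forall>i\<le>top_level G. \<rho>' i = lim_measure i)"
    using solution_unique lim_measure_solves by blast
  with lim_measure_solves have "\<exists>\<rho>. solves_recursion G \<rho> \<and>
      (\<forall>\<rho>'. solves_recursion G \<rho>' \<longrightarrow> (\<forall>i\<le>top_level G. \<rho>' i = \<rho> i)) \<and>
      (\<forall>x\<in>verts G. lim_measure 0 (Vtx x) = \<rho> 0 (Vtx x))" by blast
  moreover have "\<forall>x\<in>verts G.
      (x \<in> Su (root_class G) \<longrightarrow>
        (\<exists>!\<gamma>. hier_path G x \<gamma>) \<and>
        (\<forall>\<gamma>. hier_path G x \<gamma> \<longrightarrow> lim_measure 0 (Vtx x) =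
          (\<Prod>i=1..top_level G. level_measure G (i - 1) (\<gamma> ! i) (\<gamma> ! (i - 1))))) \<and>
      (x \<notin> Su (root_class G) \<longrightarrow> lim_measure 0 (Vtx x) = 0)"
    using hier_path_ex1 path lim_measure_off_root by blast
  moreover have "\<forall>x\<in>verts G. ((\<lambda>N. inv_measure G N x) \<longlongrightarrow> lim_measure 0 (Vtx x)) at_top"
    using lim by blast
  moreover have "\<forall>N>0. \<exists>!\<mu>. invariant_prob G N \<mu>"
    using invariant_prob_ex1[OF J] by blast
  ultimately show ?thesis
    using card_top_level by (intro conjI exI[of _ "\<lambda>x. lim_measure 0 (Vtx x)"])
qed

end
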